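(* Let $\varphi:\mathbb C\cong\mathbb R^2\to\mathbb R$ be a subharmonic $\mathcal C^2$-function such that $\Delta\varphi\in B_2(\mathbb R^2)$. Then the canonical solution operator $S:L^2(\mathbb C,\varphi)\to L^2(\mathbb C,\varphi)$ to $\overline\partial$ is compact if and only if $$\lim_{|z|\to\infty}\int_{B(z,1)}\Delta\varphi(y)\,dy=+\infty .$$
   Context: $L^2(\mathbb C,\varphi)$ is the Hilbert space of (classes of) measurable $f:\mathbb C\to\mathbb C$ with $\int_{\mathbb C}|f|^2e^{-2\varphi}\,d\lambda<\infty$, $\lambda$ being Lebesgue measure. The canonical solution operator $S$ to $\overline\partial$ assigns to $f\in L^2(\mathbb C,\varphi)$ the solution $u\in L^2(\mathbb C,\varphi)$ of $\frac{\partial u}{\partial\overline z}=f$ (in the sense of distributions) of minimal $L^2(\mathbb C,\varphi)$-norm, equivalently the solution orthogonal in $L^2(\mathbb C,\varphi)$ to all entire functions in $L^2(\mathbb C,\varphi)$. (Under the hypotheses of the claim, $\Delta\varphi\,dx$ is a doubling measure, and in that case $S$ is known to be a well-defined continuous operator.) The reverse Hölder class $B_2(\mathbb R^2)$ consists of the locally square-integrable, nonnegative, almost everywhere non-zero functions $V$ on $\mathbb R^2$ for which there is a constant $C>0$ such that $$\left(\frac1{|Q|}\int_Q V^2\,dx\right)^{1/2}\le C\,\frac1{|Q|}\int_Q V\,dx$$ for every ball $Q\subset\mathbb R^2$. Here $|Q|$ is the Lebesgue measure of $Q$, $\Delta=\partial_x^2+\partial_y^2$, and $B(z,1)$ is the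 ball of center $z$ and radius $1$. *)

theory Defs
  imports "HOL-Analysis.Analysis"
begin

definition dx :: "(complex \<Rightarrow> 'b::real_normed_vector) \<Rightarrow> complex \<Rightarrow> 'b" where
  "dx f z = frechet_derivative f (at z) 1"

definition dy :: "(complex \<Rightarrow> 'b::real_normed_vector) \<Rightarrow> complex \<Rightarrow> 'b" where
  "dy f z = frechet_derivative f (at z) \<i>"

text \<open>
  Differentiability is over the reals: \<open>frechet_derivative\<close> is only meaningful where \<open>f\<close> is
  differentiable, which is why differentiability is demanded separately.
\<close>

primrec Ck :: "nat \<Rightarrow> (complex \<Rightarrow> 'b::real_normed_vector) \<Rightarrow> bool" where
  "Ck 0 f \<longleftrightarrow> continuous_on UNIV f"
| "Ck (Suc k) f \<longleftrightarrow> f differentiable_on UNIV \<and> Ck k (dx f) \<and> Ck k (dy f)"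

definition laplacian :: "(complex \<Rightarrow> real) \<Rightarrow> complex \<Rightarrow> real" where
  "laplacian f z = dx (dx f) z + dy (dy f) z"

definition dbar :: "(complex \<Rightarrow> complex) \<Rightarrow> complex \<Rightarrow> complex" where
  "dbar f z = (dx f z + \<i> * dy f z) / 2"

definition test_function :: "(complex \<Rightarrow> complex) \<Rightarrow> bool" where
  "test_function \<psi> \<longleftrightarrow> (\<forall>k. Ck k \<psi>) \<and> compact (closure {z. \<psi> z \<noteq> 0})"

text \<open>
  Meant for locally integrable \<open>u\<close> and \<open>f\<close>. This is automatic for elements of the weighted space
  below when the weight is continuous.
\<close>

definition weak_dbar :: "(complex \<Rightarrow> complex) \<Rightarrow> (complex \<Rightarrow> complex) \<Rightarrow> bool" where
  "weak_dbar u f \<longleftrightarrow> (\<forall>\<psi>. test_function \<psi> \<longrightarrow>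
     (LINT z|lebesgue. u z * dbar \<psi> z) = - (LINT z|lebesgue. f z * \<psi> z))"

text \<open>
  Upper semicontinuity and the sub-mean value inequality on all circles. Only finite-valued
  functions on the whole plane are considered; for these the circle means of a subharmonic
  function are finite, so integrability is no additional restriction.
\<close>

definition subharmonic :: "(complex \<Rightarrow> real) \<Rightarrow> bool" where
  "subharmonic \<phi> \<longleftrightarrow> (\<forall>c. open {z. \<phi> z < c}) \<and>
     (\<forall>a. \<forall>r>0. set_integrable lborel {0..2*pi} (\<lambda>t. \<phi> (a + of_real r * cis t)) \<and>
        \<phi> a \<le> (1 / (2*pi)) * (LINT t:{0..2*pi}|lborel. \<phi> (a + of_real r * cis t)))"

definition reverse_Holder_2 :: "(complex \<Rightarrow> real) set" where
  "reverse_Holder_2 = {V. V \<in> borel_measurable lebesgue \<and>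
     (\<forall>K. compact K \<longrightarrow> set_integrable lebesgue K (\<lambda>z. (V z)\<^sup>2)) \<and>
     (\<forall>z. 0 \<le> V z) \<and> (AE z in lebesgue. V z \<noteq> 0) \<and>
     (\<exists>C>0. \<forall>a. \<forall>r>0.
        sqrt ((1 / measure lebesgue (ball a r)) * (LINT z:ball a r|lebesgue. (V z)\<^sup>2))
          \<le> C * ((1 / measure lebesgue (ball a r)) * (LINT z:ball a r|lebesgue. V z)))}"

definition L2_fun :: "(complex \<Rightarrow> real) \<Rightarrow> (complex \<Rightarrow> complex) set" where
  "L2_fun \<phi> = {f \<in> borel_measurable lebesgue.
     integrable lebesgue (\<lambda>z. (norm (f z))\<^sup>2 * exp (- 2 * \<phi> z))}"

definition L2_norm :: "(complex \<Rightarrow> real) \<Rightarrow> (complex \<Rightarrow> complex) \<Rightarrow> real" where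
  "L2_norm \<phi> f = sqrt (LINT z|lebesgue. (norm (f z))\<^sup>2 * exp (- 2 * \<phi> z))"

definition L2_rel :: "(complex \<Rightarrow> real) \<Rightarrow> ((complex \<Rightarrow> complex) \<times> (complex \<Rightarrow> complex)) set" where
  "L2_rel \<phi> = {(f, g). f \<in> L2_fun \<phi> \<and> g \<in> L2_fun \<phi> \<and> (AE z in lebesgue. f z = g z)}"

definition L2_space :: "(complex \<Rightarrow> real) \<Rightarrow> (complex \<Rightarrow> complex) set set" where
  "L2_space \<phi> = L2_fun \<phi> // L2_rel \<phi>"

definition L2_dist :: "(complex \<Rightarrow> real) \<Rightarrow> (complex \<Rightarrow> complex) set \<Rightarrow> (complex \<Rightarrow> complex) set \<Rightarrow> real" where
  "L2_dist \<phi> F G = L2_norm \<phi> (\<lambda>z. (SOME f. f \<in> F) z - (SOME g. g \<in> G) z)"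

lemma equiv_L2_rel: "equiv (L2_fun \<phi>) (L2_rel \<phi>)"
proof (rule equivI)
  show "L2_rel \<phi> \<subseteq> L2_fun \<phi> \<times> L2_fun \<phi>" "refl_on (L2_fun \<phi>) (L2_rel \<phi>)"
    by (auto simp: L2_rel_def refl_on_def)
  show "sym (L2_rel \<phi>)"
    by (auto simp: L2_rel_def sym_def eq_commute)
  show "trans (L2_rel \<phi>)"
    unfolding trans_def L2_rel_def by (auto elim: AE_mp)
qed

lemma L2_norm_nonneg: "0 \<le> L2_norm \<phi> f"
  by (simp add: L2_norm_def)

lemma L2_norm_power2: "(L2_norm \<phi> f)\<^sup>2 = (LINT z|lebesgue. (norm (f z))\<^sup>2 * exp (- 2 * \<phi> z))"
  by (simp add: L2_norm_def)

lemma L2_fun_add: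
  assumes "\<phi> \<in> borel_measurable lebesgue" and f: "f \<in> L2_fun \<phi>" and g: "g \<in> L2_fun \<phi>"
  shows "(\<lambda>z. f z + g z) \<in> L2_fun \<phi>"
proof -
  have [measurable]: "f \<in> borel_measurable lebesgue" "g \<in> borel_measurable lebesgue"
      "\<phi> \<in> borel_measurable lebesgue"
    using assms by (auto simp: L2_fun_def)
  let ?b = "\<lambda>z. 2 * ((norm (f z))\<^sup>2 * exp (- 2 * \<phi> z)) + 2 * ((norm (g z))\<^sup>2 * exp (- 2 * \<phi> z))"
  have "integrable lebesgue ?b"
    using f g by (auto simp: L2_fun_def)
  moreover have "(\<lambda>z. (norm (f z + g z))\<^sup>2 * exp (- 2 * \<phi> z)) \<in> borel_measurable lebesgue"
    by measurable
  moreover have "norm ((norm (f z + g z))\<^sup>2 * exp (- 2 * \<phi> z)) \<le> norm (?b z)" for z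
  proof -
    have "(norm (f z + g z))\<^sup>2 \<le> (norm (f z) + norm (g z))\<^sup>2"
      by (simp add: norm_triangle_ineq)
    also have "\<dots> \<le> 2 * (norm (f z))\<^sup>2 + 2 * (norm (g z))\<^sup>2"
      using zero_le_power2[of "norm (f z) - norm (g z)"]
      unfolding power2_sum power2_diff by linarith
    finally have "(norm (f z + g z))\<^sup>2 * exp (- 2 * \<phi> z)
        \<le> (2 * (norm (f z))\<^sup>2 + 2 * (norm (g z))\<^sup>2) * exp (- 2 * \<phi> z)"
      by (rule mult_right_mono) simp
    then show ?thesis
      by (simp add: algebra_simps)
  qed
  ultimately have "integrable lebesgue (\<lambda>z. (norm (f z + g z))\<^sup>2 * exp (- 2 * \<phi> z))"
    by (blast intro: Bochner_Integration.integrable_bound AE_I2)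
  then show ?thesis
    by (simp add: L2_fun_def)
qed

lemma L2_fun_uminus: "f \<in> L2_fun \<phi> \<Longrightarrow> (\<lambda>z. - f z) \<in> L2_fun \<phi>"
  by (auto simp: L2_fun_def)

lemma L2_fun_diff:
  assumes "\<phi> \<in> borel_measurable lebesgue" "f \<in> L2_fun \<phi>" "g \<in> L2_fun \<phi>"
  shows "(\<lambda>z. f z - g z) \<in> L2_fun \<phi>"
  using L2_fun_add[OF assms(1,2) L2_fun_uminus[OF assms(3)]] by simp

lemma norm_add_weighted:
  fixes x y :: complex and A B :: real
  assumes "A > 0" "B > 0"
  shows "(norm (x + y))\<^sup>2 \<le> (A + B) * ((norm x)\<^sup>2 / A + (norm y)\<^sup>2 / B)"
proof -
  have "(norm (x + y))\<^sup>2 \<le> (norm x + norm y)\<^sup>2"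
    by (simp add: norm_triangle_ineq)
  also have "\<dots> = (A + B) * ((norm x)\<^sup>2 / A + (norm y)\<^sup>2 / B) - (B * norm x - A * norm y)\<^sup>2 / (A * B)"
    using assms by (simp add: field_simps power2_eq_square)
  also have "\<dots> \<le> (A + B) * ((norm x)\<^sup>2 / A + (norm y)\<^sup>2 / B)"
    using assms by simp
  finally show ?thesis .
qed

lemma L2_norm_triangle:
  assumes \<phi>: "\<phi> \<in> borel_measurable lebesgue" and f: "f \<in> L2_fun \<phi>" and g: "g \<in> L2_fun \<phi>"
  shows "L2_norm \<phi> (\<lambda>z. f z + g z) \<le> L2_norm \<phi> f + L2_norm \<phi> g"
proof (rule field_le_epsilon)
  fix e :: real assume "e > 0"
  define A where "A = L2_norm \<phi> f + e / 2"
  define B where "B = L2_norm \<phi> g + e / 2"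
  have AB: "A > 0" "B > 0"
    using L2_norm_nonneg[of \<phi> f] L2_norm_nonneg[of \<phi> g] \<open>e > 0\<close> by (auto simp: A_def B_def)
  let ?F = "\<lambda>z. (norm (f z))\<^sup>2 * exp (- 2 * \<phi> z)"
  let ?G = "\<lambda>z. (norm (g z))\<^sup>2 * exp (- 2 * \<phi> z)"
  have i: "integrable lebesgue ?F" "integrable lebesgue ?G"
    using f g by (auto simp: L2_fun_def)
  have "(L2_norm \<phi> (\<lambda>z. f z + g z))\<^sup>2 = (LINT z|lebesgue. (norm (f z + g z))\<^sup>2 * exp (- 2 * \<phi> z))"
    by (rule L2_norm_power2)
  also have "\<dots> \<le> (LINT z|lebesgue. (A + B) * (?F z / A + ?G z / B))"
  proof (rule integral_mono)
    show "integrable lebesgue (\<lambda>z. (norm (f z + g z))\<^sup>2 * exp (- 2 * \<phi> z))"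
      using L2_fun_add[OF assms] by (simp add: L2_fun_def)
    show "integrable lebesgue (\<lambda>z. (A + B) * (?F z / A + ?G z / B))"
      using i by (intro integrable_mult_right Bochner_Integration.integrable_add integrable_divide) auto
    fix z
    have "(norm (f z + g z))\<^sup>2 * exp (- 2 * \<phi> z)
        \<le> (A + B) * ((norm (f z))\<^sup>2 / A + (norm (g z))\<^sup>2 / B) * exp (- 2 * \<phi> z)"
      by (rule mult_right_mono[OF norm_add_weighted[OF AB]]) simp
    then show "(norm (f z + g z))\<^sup>2 * exp (- 2 * \<phi> z) \<le> (A + B) * (?F z / A + ?G z / B)"
      by (simp add: algebra_simps)
  qed
  also have "\<dots> = (A + B) * ((L2_norm \<phi> f)\<^sup>2 / A + (L2_norm \<phi> g)\<^sup>2 / B)"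
    using i by (simp add: L2_norm_power2)
  also have "\<dots> \<le> (A + B) * (A\<^sup>2 / A + B\<^sup>2 / B)"
    using AB L2_norm_nonneg[of \<phi> f] L2_norm_nonneg[of \<phi> g] \<open>e > 0\<close>
    by (intro mult_left_mono add_mono divide_right_mono power_mono) (auto simp: A_def B_def)
  also have "\<dots> = (A + B)\<^sup>2"
    using AB by (simp add: power2_eq_square)
  finally have "L2_norm \<phi> (\<lambda>z. f z + g z) \<le> A + B"
    by (rule power2_le_imp_le) (use AB in simp)
  then show "L2_norm \<phi> (\<lambda>z. f z + g z) \<le> L2_norm \<phi> f + L2_norm \<phi> g + e"
    by (simp add: A_def B_def)
qed

lemma L2_norm_eq_0_iff:
  assumes "f \<in> L2_fun \<phi>"
  shows "L2_norm \<phi> f = 0 \<longleftrightarrow> (AE z in lebesgue. f z = 0)"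
  using assms by (simp add: L2_norm_def L2_fun_def integral_nonneg_eq_0_iff_AE)

lemma L2_space_some_in:
  assumes "F \<in> L2_space \<phi>"
  shows "(SOME f. f \<in> F) \<in> F" "(SOME f. f \<in> F) \<in> L2_fun \<phi>"
proof -
  obtain f where "f \<in> L2_fun \<phi>" "F = L2_rel \<phi> `` {f}"
    using assms unfolding L2_space_def quotient_def by auto
  then have "f \<in> F"
    by (simp add: L2_rel_def)
  then show 1: "(SOME f. f \<in> F) \<in> F"
    by (rule someI[of "\<lambda>f. f \<in> F"])
  show "(SOME f. f \<in> F) \<in> L2_fun \<phi>"
    using 1 \<open>F = _\<close> by (auto simp: L2_rel_def)
qed

lemma Metric_space_L2:
  assumes \<phi>: "\<phi> \<in> borel_measurable lebesgue"
  shows "Metric_space (L2_space \<phi>) (L2_dist \<phi>)"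
proof
  fix F G
  show "0 \<le> L2_dist \<phi> F G"
    by (simp add: L2_dist_def L2_norm_nonneg)
  show "L2_dist \<phi> F G = L2_dist \<phi> G F"
    by (simp add: L2_dist_def L2_norm_def norm_minus_commute)
next
  fix F G
  assume F: "F \<in> L2_space \<phi>" and G: "G \<in> L2_space \<phi>"
  let ?f = "SOME f. f \<in> F" and ?g = "SOME g. g \<in> G"
  note f = L2_space_some_in[OF F] and g = L2_space_some_in[OF G]
  have "L2_dist \<phi> F G = 0 \<longleftrightarrow> (AE z in lebesgue. ?f z - ?g z = 0)"
    unfolding L2_dist_def by (rule L2_norm_eq_0_iff[OF L2_fun_diff[OF \<phi> f(2) g(2)]])
  also have "\<dots> \<longleftrightarrow> (?f, ?g) \<in> L2_rel \<phi>"
    using f g by (simp add: L2_rel_def)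
  also have "\<dots> \<longleftrightarrow> F = G"
    using quotient_eq_iff[OF equiv_L2_rel _ _ f(1) g(1)] F G by (simp add: L2_space_def)
  finally show "L2_dist \<phi> F G = 0 \<longleftrightarrow> F = G" .
next
  fix F G H
  assume "F \<in> L2_space \<phi>" "G \<in> L2_space \<phi>" "H \<in> L2_space \<phi>"
  note s = this[THEN L2_space_some_in(2)]
  show "L2_dist \<phi> F H \<le> L2_dist \<phi> F G + L2_dist \<phi> G H"
    using L2_norm_triangle[OF \<phi> L2_fun_diff[OF \<phi> s(1,2)] L2_fun_diff[OF \<phi> s(2,3)]]
    by (simp add: L2_dist_def)
qed

definition canonical_solution ::
  "(complex \<Rightarrow> real) \<Rightarrow> (complex \<Rightarrow> complex) \<Rightarrow> (complex \<Rightarrow> complex) \<Rightarrow> bool" where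
  "canonical_solution \<phi> f u \<longleftrightarrow> u \<in> L2_fun \<phi> \<and> weak_dbar u f \<and>
     (\<forall>v \<in> L2_fun \<phi>. weak_dbar v f \<longrightarrow> L2_norm \<phi> u \<le> L2_norm \<phi> v)"

text \<open>
  The set of all canonical solutions for (any representative of) the class \<open>F\<close>. For continuous
  \<open>\<phi>\<close> the minimal solution is unique up to null sets, so this set is itself an element of
  \<open>L2_space \<phi>\<close> whenever a canonical solution exists, and it is empty (hence not in
  \<open>L2_space \<phi>\<close>) otherwise.
\<close>

definition canonical_solution_operator ::
  "(complex \<Rightarrow> real) \<Rightarrow> (complex \<Rightarrow> complex) set \<Rightarrow> (complex \<Rightarrow> complex) set" where
  "canonical_solution_operator \<phi> F = {u. \<exists>f\<in>F. canonical_solution \<phi> f u}"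

text \<open>
  Linearity is not part of the definition. It is automatic for the canonical solution operator,
  which is linear as soon as it is everywhere defined.
\<close>

definition compact_operator_L2 ::
  "(complex \<Rightarrow> real) \<Rightarrow> ((complex \<Rightarrow> complex) set \<Rightarrow> (complex \<Rightarrow> complex) set) \<Rightarrow> bool" where
  "compact_operator_L2 \<phi> T \<longleftrightarrow> T \<in> L2_space \<phi> \<rightarrow> L2_space \<phi> \<and>
     (\<forall>B. Metric_space.mbounded (L2_space \<phi>) (L2_dist \<phi>) B \<longrightarrow>
        compactin (Metric_space.mtopology (L2_space \<phi>) (L2_dist \<phi>))
          (Metric_space.mtopology (L2_space \<phi>) (L2_dist \<phi>) closure_of (T ` B)))"

end

theory Submission
  imports Defs
begin

text \<open>
  Write \<open>V\<close> for the Laplacian of \<open>\<phi>\<close> and \<open>\<mu>(z, r)\<close> for the integral of \<open>V\<close> over the ball of centre \<open>z\<close> and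
  radius \<open>r\<close>. The equation is studied through its dual problem. For a test function \<open>\<psi>\<close> the elements
  \<open>dual \<psi> = cnj \<psi> \<cdot> e\<^sup>2\<^sup>\<phi>\<close> and \<open>dual_dbar \<psi> = cnj (dbar \<psi>) \<cdot> e\<^sup>2\<^sup>\<phi>\<close> of the weighted space turn the weak
  equation into \<open>\<langle>u, dual_dbar \<psi>\<rangle> = - \<langle>f, dual \<psi>\<rangle>\<close>. With \<open>g = \<psi> e\<^sup>\<phi>\<close>, integration by parts
  (\<open>energy_identity\<close>) shows that four times the squared norm of \<open>dual_dbar \<psi>\<close> is the energy of \<open>g\<close> for
  a Schroedinger operator with magnetic field \<open>V\<close> and electric potential \<open>V\<close>: the squared
  \<open>L\<^sup>2\<close>-norm of the covariant gradient of \<open>g\<close> plus the integral of \<open>V |g|\<^sup>2\<close>; the squared norm of \<open>dual \<psi>\<close> is the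
  integral of \<open>|g|\<^sup>2\<close>.

  If \<open>\<mu>(z, 1)\<close> tends to infinity, the sublevel sets of this energy are totally bounded. By the
  diamagnetic inequality the covariant gradient dominates the increments of \<open>|g|\<close>. On a square of
  side \<open>r\<close> with centre \<open>c\<close> a Poincare argument therefore bounds the integral of \<open>|g|\<^sup>2\<close> by a constant
  times \<open>r\<^sup>2 (1 + 1 / \<mu>(c, r/2))\<close> times the energy (\<open>cell_bound\<close>). The reverse Holder inequality
  enters here twice: \<open>V\<close> is at least half its mean on a fixed proportion of every ball, and for fixed
  \<open>r\<close> the mass \<open>\<mu>(c, r/2)\<close> is at least a fixed multiple of \<open>\<mu>(c, 1)\<close>. Hence for every
  \<open>r\<close> the mass of \<open>|g|\<^sup>2\<close> far out is at most a multiple of \<open>r\<^sup>2\<close> times the energy, and on bounded sets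
  Poincare's inequality on a fine grid controls \<open>g\<close> by its energy and finitely many averages
  (\<open>compactness_estimate\<close>). The energy is in particular coercive, so minimising
  \<open>\<parallel>dual_dbar \<psi>\<parallel>\<^sup>2 / 2 + Re \<langle>f, dual \<psi>\<rangle>\<close> over test functions gives a solution \<open>u\<close> that is a limit of
  elements \<open>dual_dbar \<psi>\<close>. These are orthogonal to all weakly holomorphic functions, so \<open>u\<close> is canonical.
  Its squared norm is the limit of \<open>- \<langle>f, dual \<psi>\<rangle>\<close>; applied to differences of solutions, this makes
  \<open>\<parallel>u - u'\<parallel>\<close> small as soon as the dual approximants are close, and the compactness estimate provides
  finite nets for these (\<open>sufficiency\<close>).

  Conversely, suppose that \<open>\<mu>(z\<^sub>n, 1)\<close> stays bounded along a sequence tending to infinity. On the unit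
  ball about \<open>z\<^sub>n\<close> an explicit gauge \<open>\<theta>\<close> removes the magnetic potential up to an error whose
  \<open>L\<^sup>2\<close>-norm is at most that of \<open>V\<close>, which the reverse Holder inequality bounds. So
  \<open>\<eta>\<^sub>n = \<xi> e\<^sup>i\<^sup>\<theta>\<^sup>-\<^sup>\<phi>\<close>, with a fixed bump \<open>\<xi>\<close> moved to \<open>z\<^sub>n\<close>, has \<open>dual \<eta>\<^sub>n\<close> of constant norm and
  \<open>dual_dbar \<eta>\<^sub>n\<close> of bounded norm. The canonical solution \<open>u\<^sub>n\<close> for \<open>f\<^sub>n = dual \<eta>\<^sub>n\<close> satisfies
  \<open>\<langle>u\<^sub>n, dual_dbar \<eta>\<^sub>n\<rangle> = - \<parallel>f\<^sub>n\<parallel>\<^sup>2\<close>, so it keeps a fixed amount of mass near \<open>z\<^sub>n\<close> and the sequence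
  has no convergent subsequence (\<open>necessity\<close>).
\<close>

section \<open>Calculus with the partial derivatives\<close>

lemma dx_eqI: "(f has_derivative D) (at z) \<Longrightarrow> dx f z = D 1"
  unfolding dx_def by (metis frechet_derivative_at)

lemma dy_eqI: "(f has_derivative D) (at z) \<Longrightarrow> dy f z = D \<i>"
  unfolding dy_def by (metis frechet_derivative_at)

lemma has_derivative_dx_dy:
  assumes "f differentiable (at z)"
  shows "(f has_derivative (\<lambda>h. Re h *\<^sub>R dx f z + Im h *\<^sub>R dy f z)) (at z)"
proof -
  have d: "(f has_derivative frechet_derivative f (at z)) (at z)"
    using assms by (simp add: frechet_derivative_works)
  interpret linear "frechet_derivative f (at z)"
    using d by (rule has_derivative_linear)
  have "frechet_derivative f (at z) h = Re h *\<^sub>R dx f z + Im h *\<^sub>R dy f z" for h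
  proof -
    have "h = Re h *\<^sub>R 1 + Im h *\<^sub>R \<i>"
      by (simp add: complex_eq_iff)
    then have "frechet_derivative f (at z) h = frechet_derivative f (at z) (Re h *\<^sub>R 1 + Im h *\<^sub>R \<i>)"
      by simp
    then show ?thesis
      by (simp only: add scale dx_def dy_def)
  qed
  then show ?thesis
    using d by (metis (no_types, lifting) ext)
qed

lemma Ck_imp_continuous: "Ck k f \<Longrightarrow> continuous_on UNIV f"
proof (cases k)
  case (Suc m)
  assume "Ck k f"
  then have "f differentiable_on UNIV" unfolding Suc by (simp only: Ck.simps)
  then show ?thesis by (rule differentiable_imp_continuous_on)
qed simp

lemma Ck_SucD: "Ck (Suc k) f \<Longrightarrow> Ck k f"
proof (induction k arbitrary: f)
  case 0
  then have "f differentiable_on UNIV" by (simp only: Ck.simps)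
  then show ?case by (simp only: Ck.simps differentiable_imp_continuous_on)
next
  case (Suc k)
  from Suc.prems have "f differentiable_on UNIV" "Ck (Suc k) (dx f)" "Ck (Suc k) (dy f)"
    by (simp_all only: Ck.simps)
  with Suc.IH[of "dx f"] Suc.IH[of "dy f"] show ?case
    unfolding Ck.simps(2)[of k f] by blast
qed

lemma Ck_mono: "Ck m f \<Longrightarrow> k \<le> m \<Longrightarrow> Ck k f"
proof (induction m)
  case (Suc m)
  show ?case
    using Suc.IH[OF Ck_SucD[OF Suc.prems(1)]] Suc.prems by (cases "k = Suc m") (simp_all del: Ck.simps)
qed auto

lemma Ck_differentiable: "Ck k f \<Longrightarrow> k \<ge> 1 \<Longrightarrow> f differentiable (at z)"
  by (cases k) (auto simp: differentiable_on_def)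

lemma Ck_has_derivative:
  assumes "Ck k f" "k \<ge> 1"
  shows "(f has_derivative (\<lambda>h. Re h *\<^sub>R dx f z + Im h *\<^sub>R dy f z)) (at z)"
  using Ck_differentiable[OF assms] by (rule has_derivative_dx_dy)

text \<open>
  Since \<open>Ck\<close> is defined through \<open>frechet_derivative\<close>, a total derivative with
  candidate partials identifies these as the partials.
\<close>

lemma Ck_SucI:
  assumes "\<And>z. (f has_derivative (\<lambda>h. Re h *\<^sub>R p z + Im h *\<^sub>R q z)) (at z)" "Ck k p" "Ck k q"
  shows "Ck (Suc k) f" "dx f = p" "dy f = q"
proof -
  show p: "dx f = p" and q: "dy f = q"
    using dx_eqI[OF assms(1)] dy_eqI[OF assms(1)] by auto
  show "Ck (Suc k) f"
    using assms p q by (auto simp: differentiable_on_def differentiable_def intro: has_derivative_at_withinI)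
qed

lemma Ck_const [simp]: "Ck k (\<lambda>z. c)"
proof (induction k arbitrary: c)
  case (Suc k)
  show ?case
    by (rule Ck_SucI(1)[where p="\<lambda>z. 0" and q="\<lambda>z. 0"]) (simp_all add: Suc)
qed auto

lemma dx_const [simp]: "dx (\<lambda>z. c) = (\<lambda>z. 0)" and dy_const [simp]: "dy (\<lambda>z. c) = (\<lambda>z. 0)"
  by (simp_all add: fun_eq_iff dx_eqI[OF has_derivative_const] dy_eqI[OF has_derivative_const])

lemma Ck_bounded_linear:
  assumes "bounded_linear L" "Ck k f"
  shows "Ck k (\<lambda>z. L (f z))"
  using assms(2)
proof (induction k arbitrary: f)
  case 0
  then show ?case
    using bounded_linear.continuous_on[OF assms(1)] by auto
next
  case (Suc k)
  interpret bounded_linear L by fact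
  show ?case
  proof (rule Ck_SucI(1))
    fix z
    have "(f has_derivative (\<lambda>h. Re h *\<^sub>R dx f z + Im h *\<^sub>R dy f z)) (at z)"
      using Suc.prems by (rule Ck_has_derivative) simp
    from has_derivative[OF this]
    show "((\<lambda>z. L (f z)) has_derivative (\<lambda>h. Re h *\<^sub>R L (dx f z) + Im h *\<^sub>R L (dy f z))) (at z)"
      by (simp add: add scaleR)
  qed (use Suc in auto)
qed

lemma dx_bounded_linear:
  assumes "bounded_linear L" "f differentiable (at z)"
  shows "dx (\<lambda>z. L (f z)) z = L (dx f z)" "dy (\<lambda>z. L (f z)) z = L (dy f z)"
  using bounded_linear.has_derivative[OF assms(1) has_derivative_dx_dy[OF assms(2)], THEN dx_eqI]
    bounded_linear.has_derivative[OF assms(1) has_derivative_dx_dy[OF assms(2)], THEN dy_eqI]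
  by simp_all

lemma Ck_add:
  assumes "Ck k f" "Ck k g"
  shows "Ck k (\<lambda>z. f z + g z)"
  using assms
proof (induction k arbitrary: f g)
  case (Suc k)
  show ?case
  proof (rule Ck_SucI(1))
    fix z
    show "((\<lambda>z. f z + g z) has_derivative (\<lambda>h. Re h *\<^sub>R (dx f z + dx g z) + Im h *\<^sub>R (dy f z + dy g z))) (at z)"
      using has_derivative_add[OF Ck_has_derivative[OF Suc.prems(1)] Ck_has_derivative[OF Suc.prems(2)]]
      by (simp add: algebra_simps)
  qed (use Suc in auto)
qed (auto intro: continuous_on_add)

lemma dx_add:
  assumes "f differentiable (at z)" "g differentiable (at z)"
  shows "dx (\<lambda>z. f z + g z) z = dx f z + dx g z" "dy (\<lambda>z. f z + g z) z = dy f z + dy g z"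
  using has_derivative_add[OF has_derivative_dx_dy[OF assms(1)] has_derivative_dx_dy[OF assms(2)], THEN dx_eqI]
    has_derivative_add[OF has_derivative_dx_dy[OF assms(1)] has_derivative_dx_dy[OF assms(2)], THEN dy_eqI]
  by simp_all

lemma Ck_mult:
  fixes f g :: "complex \<Rightarrow> 'a::real_normed_algebra"
  assumes "Ck k f" "Ck k g"
  shows "Ck k (\<lambda>z. f z * g z)"
  using assms
proof (induction k arbitrary: f g)
  case (Suc k)
  show ?case
  proof (rule Ck_SucI(1))
    fix z
    show "((\<lambda>z. f z * g z) has_derivative (\<lambda>h. Re h *\<^sub>R (f z * dx g z + dx f z * g z) + Im h *\<^sub>R (f z * dy g z + dy f z * g z))) (at z)"
      using has_derivative_mult[OF Ck_has_derivative[OF Suc.prems(1)] Ck_has_derivative[OF Suc.prems(2)]]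
      by (simp add: algebra_simps)
  next
    have "Ck k f" "Ck k g" "Ck k (dx f)" "Ck k (dx g)" "Ck k (dy f)" "Ck k (dy g)"
      using Suc.prems[THEN Ck_SucD] Suc.prems by auto
    then show "Ck k (\<lambda>z. f z * dx g z + dx f z * g z)" "Ck k (\<lambda>z. f z * dy g z + dy f z * g z)"
      by (auto intro!: Ck_add Suc.IH)
  qed
qed (auto intro: continuous_on_mult)

lemma dx_mult:
  fixes f g :: "complex \<Rightarrow> 'a::real_normed_algebra"
  assumes "f differentiable (at z)" "g differentiable (at z)"
  shows "dx (\<lambda>z. f z * g z) z = f z * dx g z + dx f z * g z" "dy (\<lambda>z. f z * g z) z = f z * dy g z + dy f z * g z"
  using has_derivative_mult[OF has_derivative_dx_dy[OF assms(1)] has_derivative_dx_dy[OF assms(2)], THEN dx_eqI]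
    has_derivative_mult[OF has_derivative_dx_dy[OF assms(1)] has_derivative_dx_dy[OF assms(2)], THEN dy_eqI]
  by simp_all

lemma Complex_eq_plus: "Complex x y = of_real x + \<i> * of_real y"
  by (simp add: complex_eq_iff)

lemma has_vector_derivative_horizontal:
  assumes "f differentiable (at (Complex s y))"
  shows "((\<lambda>s. f (Complex s y)) has_vector_derivative dx f (Complex s y)) (at s within S)"
proof -
  have "((\<lambda>s. Complex s y) has_derivative (\<lambda>h. of_real h)) (at s within S)"
    unfolding Complex_eq_plus by (auto intro!: derivative_eq_intros)
  from has_derivative_compose[OF this has_derivative_dx_dy[OF assms]]
  show ?thesis by (simp add: has_vector_derivative_def)
qed

lemma has_vector_derivative_vertical:
  assumes "f differentiable (at (Complex x t))"
  shows "((\<lambda>t. f (Complex x t)) has_vector_derivative dy f (Complex x t)) (at t within S)"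
proof -
  have "((\<lambda>s. Complex x s) has_derivative (\<lambda>h. \<i> * of_real h)) (at t within S)"
    unfolding Complex_eq_plus by (auto intro!: derivative_eq_intros)
  from has_derivative_compose[OF this has_derivative_dx_dy[OF assms]]
  show ?thesis by (simp add: has_vector_derivative_def)
qed

lemma continuous_on_Complex [continuous_intros]:
  "continuous_on S f \<Longrightarrow> continuous_on S g \<Longrightarrow> continuous_on S (\<lambda>x. Complex (f x) (g x))"
  unfolding Complex_eq_plus by (intro continuous_intros)

lemma measurable_Complex [measurable]:
  assumes [measurable]: "f \<in> borel_measurable M" "g \<in> borel_measurable M"
  shows "(\<lambda>x. Complex (f x) (g x)) \<in> borel_measurable M"
  unfolding Complex_eq_plus by measurable

section \<open>Lebesgue measure on the plane and integration by parts\<close>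

text \<open>
  All Fubini arguments on the plane go through this identification, since the product measure lives on
  pairs.
\<close>

lemma lborel_complex_eq: "(lborel :: complex measure) = distr (lborel \<Otimes>\<^sub>M lborel) borel (\<lambda>(x, y). Complex x y)"
proof (rule lborel_eqI)
  fix l u :: complex
  assume lu: "\<And>b. b \<in> Basis \<Longrightarrow> l \<bullet> b \<le> u \<bullet> b"
  have m: "(\<lambda>(x, y). Complex x y) \<in> borel_measurable (lborel \<Otimes>\<^sub>M lborel)"
    by measurable
  have le: "Re l \<le> Re u" "Im l \<le> Im u"
    using lu[of 1] lu[of \<i>] by (auto simp: Basis_complex_def)
  have "(\<lambda>(x, y). Complex x y) -` box l u \<inter> space (lborel \<Otimes>\<^sub>M lborel) = box (Re l) (Re u) \<times> box (Im l) (Im u)"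
    by (auto simp: in_box_complex_iff space_pair_measure)
  then have "emeasure (distr (lborel \<Otimes>\<^sub>M lborel) borel (\<lambda>(x, y). Complex x y)) (box l u)
     = emeasure (lborel \<Otimes>\<^sub>M lborel) (box (Re l) (Re u) \<times> box (Im l) (Im u))"
    by (subst emeasure_distr[OF m]) auto
  also have "\<dots> = ennreal (Re u - Re l) * ennreal (Im u - Im l)"
    using le by (subst lborel.emeasure_pair_measure_Times) auto
  also have "\<dots> = (\<Prod>b\<in>Basis. (u - l) \<bullet> b)"
    using le by (simp add: Basis_complex_def ennreal_mult prod.insert)
  finally show "emeasure (distr (lborel \<Otimes>\<^sub>M lborel) borel (\<lambda>(x, y). Complex x y)) (box l u) = (\<Prod>b\<in>Basis. (u - l) \<bullet> b)" .
qed simp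

lemma nn_integral_complex:
  fixes f :: "complex \<Rightarrow> ennreal"
  assumes [measurable]: "f \<in> borel_measurable borel"
  shows "(\<integral>\<^sup>+z. f z \<partial>lborel) = (\<integral>\<^sup>+x. \<integral>\<^sup>+y. f (Complex x y) \<partial>lborel \<partial>lborel)"
    and "(\<integral>\<^sup>+z. f z \<partial>lborel) = (\<integral>\<^sup>+y. \<integral>\<^sup>+x. f (Complex x y) \<partial>lborel \<partial>lborel)"
proof -
  have *: "(\<integral>\<^sup>+z. f z \<partial>lborel) = (\<integral>\<^sup>+p. f (Complex (fst p) (snd p)) \<partial>(lborel \<Otimes>\<^sub>M lborel))"
    by (subst lborel_complex_eq, subst nn_integral_distr) (auto simp: case_prod_beta)
  show "(\<integral>\<^sup>+z. f z \<partial>lborel) = (\<integral>\<^sup>+x. \<integral>\<^sup>+y. f (Complex x y) \<partial>lborel \<partial>lborel)"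
    unfolding * by (subst lborel.nn_integral_fst[symmetric]) auto
  show "(\<integral>\<^sup>+z. f z \<partial>lborel) = (\<integral>\<^sup>+y. \<integral>\<^sup>+x. f (Complex x y) \<partial>lborel \<partial>lborel)"
    unfolding * by (subst lborel_pair.nn_integral_snd[symmetric]) auto
qed

lemma integral_complex:
  fixes f :: "complex \<Rightarrow> 'a::{banach, second_countable_topology}"
  assumes "integrable lborel f"
  shows "(\<integral>z. f z \<partial>lborel) = (\<integral>x. \<integral>y. f (Complex x y) \<partial>lborel \<partial>lborel)"
    and "(\<integral>z. f z \<partial>lborel) = (\<integral>y. \<integral>x. f (Complex x y) \<partial>lborel \<partial>lborel)"
proof -
  have [measurable]: "f \<in> borel_measurable borel"
    using assms by auto
  have i: "integrable (lborel \<Otimes>\<^sub>M lborel) (\<lambda>p. f (Complex (fst p) (snd p)))"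
    using assms by (subst (asm) lborel_complex_eq, subst (asm) integrable_distr_eq) (auto simp: case_prod_beta)
  have *: "(\<integral>z. f z \<partial>lborel) = (\<integral>p. f (Complex (fst p) (snd p)) \<partial>(lborel \<Otimes>\<^sub>M lborel))"
    by (subst lborel_complex_eq, subst integral_distr) (auto simp: case_prod_beta)
  show "(\<integral>z. f z \<partial>lborel) = (\<integral>x. \<integral>y. f (Complex x y) \<partial>lborel \<partial>lborel)"
    using lborel_pair.integral_fst'[OF i] unfolding * by simp
  show "(\<integral>z. f z \<partial>lborel) = (\<integral>y. \<integral>x. f (Complex x y) \<partial>lborel \<partial>lborel)"
    unfolding * using lborel_pair.integral_snd[of "\<lambda>x y. f (Complex x y)"] i
    by (simp add: case_prod_unfold)
qed

lemma continuous_borel: "continuous_on UNIV f \<Longrightarrow> f \<in> borel_measurable borel"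
  by (rule borel_measurable_continuous_onI)

lemma integrable_compact_support:
  fixes f :: "complex \<Rightarrow> 'a::{banach, second_countable_topology}"
  assumes "continuous_on UNIV f" "bounded {z. f z \<noteq> 0}"
  shows "integrable lborel f"
proof -
  have "integrable lborel (\<lambda>z. indicator (closure {z. f z \<noteq> 0}) z *\<^sub>R f z)"
    using assms by (intro borel_integrable_compact) (auto intro: continuous_on_subset)
  moreover have "(\<lambda>z. indicator (closure {z. f z \<noteq> 0}) z *\<^sub>R f z) = f"
    using closure_subset[of "{z. f z \<noteq> 0}"] by (auto simp: indicator_def fun_eq_iff)
  ultimately show ?thesis by simp
qed

lemma dx_zero_outside:
  assumes "\<And>z. z \<notin> cball 0 R \<Longrightarrow> f z = 0" "z \<notin> cball 0 R"
  shows "dx f z = 0" "dy f z = 0"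
proof -
  have "(f has_derivative (\<lambda>h. 0)) (at z)"
  proof (rule has_derivative_transform_within_open[where f="\<lambda>z. 0" and s="- cball 0 R"])
    show "0 = f x" if "x \<in> - cball 0 R" for x using assms(1)[of x] that by simp
  qed (use assms(2) in auto)
  then show "dx f z = 0" "dy f z = 0"
    by (auto dest: dx_eqI dy_eqI)
qed

lemma bounded_support_iff: "bounded {z. f z \<noteq> 0} \<longleftrightarrow> (\<exists>R>0. \<forall>z. z \<notin> cball 0 R \<longrightarrow> f z = 0)"
  for f :: "'a::real_normed_vector \<Rightarrow> 'b::zero"
proof
  assume "bounded {z. f z \<noteq> 0}"
  then obtain b where b: "\<forall>x\<in>{z. f z \<noteq> 0}. norm x \<le> b" unfolding bounded_iff by blast
  have "max b 1 > 0" "\<forall>z. z \<notin> cball 0 (max b 1) \<longrightarrow> f z = 0"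
    using b by (auto simp: not_le)
  then show "\<exists>R>0. \<forall>z. z \<notin> cball 0 R \<longrightarrow> f z = 0" by blast
next
  assume "\<exists>R>0. \<forall>z. z \<notin> cball 0 R \<longrightarrow> f z = 0"
  then obtain R where R: "\<forall>z. z \<notin> cball 0 R \<longrightarrow> f z = 0" by blast
  show "bounded {z. f z \<noteq> 0}"
    by (rule bounded_subset[OF bounded_cball[of 0 R]]) (use R in auto)
qed

lemma bounded_support_dx:
  assumes "bounded {z. f z \<noteq> 0}"
  shows "bounded {z. dx f z \<noteq> 0}" "bounded {z. dy f z \<noteq> 0}"
proof -
  obtain R where "R > 0" "\<And>z. z \<notin> cball 0 R \<Longrightarrow> f z = 0"
    using assms unfolding bounded_support_iff by blast
  with dx_zero_outside[of R f] show "bounded {z. dx f z \<noteq> 0}" "bounded {z. dy f z \<noteq> 0}"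
    unfolding bounded_support_iff by blast+
qed

text \<open>
  Fubini and the fundamental theorem on each line: the function vanishes at both ends of a long segment.
\<close>

lemma integral_dx_eq_0:
  fixes f :: "complex \<Rightarrow> 'a::euclidean_space"
  assumes C: "Ck 1 f" and b: "bounded {z. f z \<noteq> 0}"
  shows "integrable lborel (dx f)" "integrable lborel (dy f)"
    "(\<integral>z. dx f z \<partial>lborel) = 0" "(\<integral>z. dy f z \<partial>lborel) = 0"
proof -
  have c: "continuous_on UNIV (dx f)" "continuous_on UNIV (dy f)"
    using C by auto
  show i: "integrable lborel (dx f)" "integrable lborel (dy f)"
    using c bounded_support_dx[OF b] by (auto intro!: integrable_compact_support)
  obtain R where "R > 0" and R: "\<And>z. z \<notin> cball 0 R \<Longrightarrow> f z = 0"
    using b unfolding bounded_support_iff by blast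
  have out: "f (Complex x y) = 0 \<and> dx f (Complex x y) = 0 \<and> dy f (Complex x y) = 0" if "\<bar>x\<bar> > R \<or> \<bar>y\<bar> > R" for x y
  proof -
    have "norm (Complex x y) > R"
      using that abs_Re_le_cmod[of "Complex x y"] abs_Im_le_cmod[of "Complex x y"] by auto
    then show ?thesis
      using R dx_zero_outside[of R f] by auto
  qed
  have d: "f differentiable (at z)" for z
    using C by (rule Ck_differentiable) simp
  have "(\<integral>x. dx f (Complex x y) \<partial>lborel) = 0" for y
  proof -
    have "(\<integral>x. indicator {-(R+1)..R+1} x *\<^sub>R dx f (Complex x y) \<partial>lborel) = f (Complex (R+1) y) - f (Complex (-(R+1)) y)"
      using \<open>R > 0\<close> c by (intro integral_FTC_atLeastAtMost has_vector_derivative_horizontal d)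
        (auto intro!: continuous_intros intro: continuous_on_compose2)
    also have "\<dots> = 0"
      using out \<open>R > 0\<close> by simp
    also have "(\<lambda>x. indicator {-(R+1)..R+1} x *\<^sub>R dx f (Complex x y)) = (\<lambda>x. dx f (Complex x y))"
    proof
      fix x show "indicator {-(R+1)..R+1} x *\<^sub>R dx f (Complex x y) = dx f (Complex x y)"
        using out[of x y] by (cases "\<bar>x\<bar> > R") (auto simp: indicator_def)
    qed
    finally show ?thesis .
  qed
  then show "(\<integral>z. dx f z \<partial>lborel) = 0"
    by (subst integral_complex(2)[OF i(1)]) simp
  have "(\<integral>y. dy f (Complex x y) \<partial>lborel) = 0" for x
  proof -
    have "(\<integral>y. indicator {-(R+1)..R+1} y *\<^sub>R dy f (Complex x y) \<partial>lborel) = f (Complex x (R+1)) - f (Complex x (-(R+1)))"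
      using \<open>R > 0\<close> c by (intro integral_FTC_atLeastAtMost has_vector_derivative_vertical d)
        (auto intro!: continuous_intros intro: continuous_on_compose2)
    also have "\<dots> = 0"
      using out \<open>R > 0\<close> by simp
    also have "(\<lambda>y. indicator {-(R+1)..R+1} y *\<^sub>R dy f (Complex x y)) = (\<lambda>y. dy f (Complex x y))"
    proof
      fix y show "indicator {-(R+1)..R+1} y *\<^sub>R dy f (Complex x y) = dy f (Complex x y)"
        using out[of x y] by (cases "\<bar>y\<bar> > R") (auto simp: indicator_def)
    qed
    finally show ?thesis .
  qed
  then show "(\<integral>z. dy f z \<partial>lborel) = 0"
    by (subst integral_complex(1)[OF i(2)]) simp
qed

section \<open>Integrals depending on a parameter\<close>

text \<open>
  Differentiation under the integral sign for a parameter in the plane, phrased with partial derivatives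
  instead of bounded linear maps.
\<close>

lemma leibniz_plane:
  fixes f A B :: "complex \<Rightarrow> 'b::euclidean_space \<Rightarrow> 'c::euclidean_space"
  assumes d: "\<And>z t. t \<in> cbox a b \<Longrightarrow> ((\<lambda>z. f z t) has_derivative (\<lambda>k. Re k *\<^sub>R A z t + Im k *\<^sub>R B z t)) (at z)"
    and cf: "continuous_on (UNIV \<times> cbox a b) (\<lambda>(z, t). f z t)"
    and cA: "continuous_on (UNIV \<times> cbox a b) (\<lambda>(z, t). A z t)"
    and cB: "continuous_on (UNIV \<times> cbox a b) (\<lambda>(z, t). B z t)"
  shows "((\<lambda>z. integral (cbox a b) (f z)) has_derivative
      (\<lambda>k. Re k *\<^sub>R integral (cbox a b) (A z) + Im k *\<^sub>R integral (cbox a b) (B z))) (at z)"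
    and "continuous_on UNIV (\<lambda>z. integral (cbox a b) (f z))"
proof -
  have slice: "continuous_on (cbox a b) (h z)" if "continuous_on (UNIV \<times> cbox a b) (\<lambda>(z, t). h z t)"
    for z and h :: "complex \<Rightarrow> 'b \<Rightarrow> 'c"
  proof -
    have "continuous_on (cbox a b) (\<lambda>t. case (z, t) of (z, t) \<Rightarrow> h z t)"
      by (rule continuous_on_compose2[OF that]) (auto intro!: continuous_intros)
    then show ?thesis by simp
  qed
  note ints = integrable_continuous[OF slice[OF cf]] integrable_continuous[OF slice[OF cA]] integrable_continuous[OF slice[OF cB]]
  \<comment> \<open>the total derivative as a bounded linear map, in the form that the library rule expects\<close>
  define fx where "fx z t = blinfun_compose (blinfun_scaleR_left (A z t)) (Blinfun Re) + blinfun_compose (blinfun_scaleR_left (B z t)) (Blinfun Im)" for z t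
  have fx: "blinfun_apply (fx z t) = (\<lambda>k. Re k *\<^sub>R A z t + Im k *\<^sub>R B z t)" for z t
    by (rule ext) (simp add: fx_def blinfun.add_left bounded_linear_Blinfun_apply bounded_linear_Re bounded_linear_Im)
  have cfx: "continuous_on (UNIV \<times> cbox a b) (\<lambda>(z, t). fx z t)"
  proof -
    have "continuous_on (UNIV \<times> cbox a b) (\<lambda>p. A (fst p) (snd p))" "continuous_on (UNIV \<times> cbox a b) (\<lambda>p. B (fst p) (snd p))"
      using cA cB by (simp_all add: case_prod_unfold)
    then show ?thesis
      unfolding fx_def case_prod_unfold
      by (intro continuous_intros bounded_linear.continuous_on[OF bounded_linear_blinfun_scaleR_left])
  qed
  have "((\<lambda>z. integral (cbox a b) (f z)) has_derivative blinfun_apply (integral (cbox a b) (fx z))) (at z within UNIV)"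
    by (rule leibniz_rule) (use d fx cfx ints in auto)
  moreover have "blinfun_apply (integral (cbox a b) (fx z)) =
      (\<lambda>k. Re k *\<^sub>R integral (cbox a b) (A z) + Im k *\<^sub>R integral (cbox a b) (B z))"
  proof
    fix k
    have "fx z integrable_on cbox a b"
    proof (rule integrable_continuous)
      show "continuous_on (cbox a b) (fx z)"
      proof -
        have "continuous_on (cbox a b) (\<lambda>t. case (z, t) of (z, t) \<Rightarrow> fx z t)"
          by (rule continuous_on_compose2[OF cfx]) (auto intro!: continuous_intros)
        then show ?thesis by simp
      qed
    qed
    then have "blinfun_apply (integral (cbox a b) (fx z)) k = integral (cbox a b) (\<lambda>t. blinfun_apply (fx z t) k)"
      by (rule blinfun_apply_integral)
    also have "\<dots> = Re k *\<^sub>R integral (cbox a b) (A z) + Im k *\<^sub>R integral (cbox a b) (B z)"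
      unfolding fx using ints by (simp add: Henstock_Kurzweil_Integration.integral_add integrable_cmul)
    finally show "blinfun_apply (integral (cbox a b) (fx z)) k = Re k *\<^sub>R integral (cbox a b) (A z) + Im k *\<^sub>R integral (cbox a b) (B z)" .
  qed
  ultimately show "((\<lambda>z. integral (cbox a b) (f z)) has_derivative
      (\<lambda>k. Re k *\<^sub>R integral (cbox a b) (A z) + Im k *\<^sub>R integral (cbox a b) (B z))) (at z)"
    by simp
  show "continuous_on UNIV (\<lambda>z. integral (cbox a b) (f z))"
    by (rule integral_continuous_on_param[OF cf])
qed

text \<open>
  The integral of \<open>h\<close> from height \<open>y0\<close> up to \<open>z\<close> along the
  vertical line through \<open>z\<close>. Scaling the segment to \<open>[0, 1]\<close> gives a formula
  that is differentiable across the line of height \<open>y0\<close>.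
\<close>

definition vertical_integral :: "real \<Rightarrow> (complex \<Rightarrow> real) \<Rightarrow> complex \<Rightarrow> real" where
  "vertical_integral y0 h z = (Im z - y0) * integral {0..1} (\<lambda>t. h (Complex (Re z) (y0 + t * (Im z - y0))))"

lemma continuous_on_vertical_path:
  assumes "continuous_on UNIV h"
  shows "continuous_on S (\<lambda>(z, t). h (Complex (Re z) (y0 + t * (Im z - y0))))"
  unfolding case_prod_unfold
  by (rule continuous_on_compose2[OF assms]) (auto intro!: continuous_intros)

lemma continuous_vertical_integral:
  assumes "continuous_on UNIV h"
  shows "continuous_on UNIV (vertical_integral y0 h)"
proof -
  have "continuous_on UNIV (\<lambda>z. integral (cbox 0 1) (\<lambda>t. h (Complex (Re z) (y0 + t * (Im z - y0)))))"
    by (rule integral_continuous_on_param) (rule continuous_on_vertical_path[OF assms])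
  then show ?thesis
    unfolding vertical_integral_def[abs_def] by (intro continuous_intros) simp
qed

lemma vertical_integral_FTC:
  assumes "Ck 1 h"
  shows "vertical_integral y0 (dy h) z = h z - h (Complex (Re z) y0)"
proof -
  have "((\<lambda>t. (Im z - y0) * dy h (Complex (Re z) (y0 + t * (Im z - y0)))) has_integral
      h (Complex (Re z) (y0 + 1 * (Im z - y0))) - h (Complex (Re z) (y0 + 0 * (Im z - y0)))) {0..1}"
  proof (rule fundamental_theorem_of_calculus)
    fix t :: real
    have "((\<lambda>t. Complex (Re z) (y0 + t * (Im z - y0))) has_derivative (\<lambda>k. \<i> * of_real (k * (Im z - y0)))) (at t within {0..1})"
      unfolding Complex_eq_plus by (auto intro!: derivative_eq_intros simp: algebra_simps)
    from has_derivative_compose[OF this Ck_has_derivative[OF assms]]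
    show "((\<lambda>t. h (Complex (Re z) (y0 + t * (Im z - y0)))) has_vector_derivative (Im z - y0) * dy h (Complex (Re z) (y0 + t * (Im z - y0)))) (at t within {0..1})"
      by (simp add: has_vector_derivative_def mult.assoc)
  qed simp
  from integral_unique[OF this] show ?thesis
    by (simp add: vertical_integral_def)
qed

text \<open>
  The vertical derivative under the integral sign is the derivative of \<open>t \<mapsto> t \<cdot>
  h\<close> along the segment, so it integrates to \<open>h z\<close>.
\<close>

lemma vertical_integral_derivative:
  assumes h: "Ck 1 h"
  shows "(vertical_integral y0 h has_derivative (\<lambda>k. Re k *\<^sub>R vertical_integral y0 (dx h) z + Im k *\<^sub>R h z)) (at z)"
proof -
  let ?p = "\<lambda>z t. Complex (Re z) (y0 + t * (Im z - y0))"
  let ?f = "\<lambda>z t. (Im z - y0) * h (?p z t)"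
  let ?A = "\<lambda>z t. (Im z - y0) * dx h (?p z t)"
  let ?B = "\<lambda>z t. h (?p z t) + t * ((Im z - y0) * dy h (?p z t))"
  have c: "continuous_on UNIV h" "continuous_on UNIV (dx h)" "continuous_on UNIV (dy h)"
    using h Ck_imp_continuous[OF h] by auto
  have cp: "continuous_on S (\<lambda>x. g (?p (fst x) (snd x)))" if "continuous_on UNIV g" for g :: "complex \<Rightarrow> real" and S
    using continuous_on_vertical_path[OF that, of S y0] by (simp add: case_prod_unfold)
  have "((\<lambda>z. integral (cbox 0 1) (?f z)) has_derivative
      (\<lambda>k. Re k *\<^sub>R integral (cbox 0 1) (?A z) + Im k *\<^sub>R integral (cbox 0 1) (?B z))) (at z)"
  proof (rule leibniz_plane(1))
    fix z and t :: real
    have "((\<lambda>z. ?p z t) has_derivative (\<lambda>k. of_real (Re k) + \<i> * of_real (t * Im k))) (at z)"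
      unfolding Complex_eq_plus by (auto intro!: derivative_eq_intros simp: algebra_simps)
    from has_derivative_compose[OF this Ck_has_derivative[OF h]]
    have *: "((\<lambda>z. h (?p z t)) has_derivative (\<lambda>k. Re k * dx h (?p z t) + t * Im k * dy h (?p z t))) (at z)"
      by simp
    show "((\<lambda>z. ?f z t) has_derivative (\<lambda>k. Re k *\<^sub>R ?A z t + Im k *\<^sub>R ?B z t)) (at z)"
      by (rule derivative_eq_intros * refl)+ (simp add: algebra_simps)
  qed (auto simp: case_prod_unfold intro!: continuous_intros cp c)
  moreover have "integral (cbox 0 1) (?f z) = vertical_integral y0 h z" for z
    by (simp add: vertical_integral_def)
  moreover have "integral (cbox 0 1) (?A z) = vertical_integral y0 (dx h) z"
    by (simp add: vertical_integral_def)
  moreover have "integral (cbox 0 1) (?B z) = h z"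
  proof -
    have "(?B z has_integral 1 * h (?p z 1) - 0 * h (?p z 0)) {0..1}"
    proof (rule fundamental_theorem_of_calculus)
      fix t :: real
      have "((\<lambda>t. ?p z t) has_derivative (\<lambda>k. \<i> * of_real (k * (Im z - y0)))) (at t within {0..1})"
        unfolding Complex_eq_plus by (auto intro!: derivative_eq_intros simp: algebra_simps)
      from has_derivative_compose[OF this Ck_has_derivative[OF h]]
      have *: "((\<lambda>t. h (?p z t)) has_derivative (\<lambda>k. k * (Im z - y0) * dy h (?p z t))) (at t within {0..1})"
        by simp
      show "((\<lambda>t. t * h (?p z t)) has_vector_derivative ?B z t) (at t within {0..1})"
        unfolding has_vector_derivative_def
        by (rule derivative_eq_intros * refl)+ (simp add: algebra_simps)
    qed simp
    from integral_unique[OF this] show ?thesis by simp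
  qed
  ultimately show ?thesis by simp
qed

lemma Ck_vertical_integral:
  assumes h: "Ck 1 h"
  shows "Ck 1 (vertical_integral y0 h)" "dx (vertical_integral y0 h) = vertical_integral y0 (dx h)" "dy (vertical_integral y0 h) = h"
proof -
  have c: "Ck 0 (vertical_integral y0 (dx h))" "Ck 0 h"
    using h Ck_imp_continuous[OF h] by (auto intro: continuous_vertical_integral)
  from Ck_SucI[OF vertical_integral_derivative[OF h] this]
  show "Ck 1 (vertical_integral y0 h)" "dx (vertical_integral y0 h) = vertical_integral y0 (dx h)" "dy (vertical_integral y0 h) = h"
    by simp_all
qed

text \<open>
  Differentiating \<open>b(x, s) - b(x, y) = \<integral> b\<^sub>y(x, t) dt\<close> with respect to
  \<open>x\<close> under the integral sign expresses the increments of \<open>b\<^sub>x\<close> in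
  \<open>s\<close> by \<open>(b\<^sub>y)\<^sub>x\<close>; the difference quotient at \<open>s =
  y\<close> then converges to it by continuity.
\<close>

lemma mixed_partials_commute:
  fixes b :: "complex \<Rightarrow> real"
  assumes b: "Ck 2 b"
  shows "dx (dy b) z = dy (dx b) z"
proof -
  have b1: "Ck 1 b" "Ck 1 (dx b)" "Ck 1 (dy b)"
    using b Ck_mono[OF b, of 1] by (auto simp: numeral_2_eq_2)
  define x y where "x = Re z" and "y = Im z"
  let ?h = "dx (dy b)"
  have ch: "continuous_on UNIV ?h" using b1 by simp
  \<comment> \<open>differentiate \<open>b (x, s) - b (x, y) = \<integral> b\<^sub>y\<close> in \<open>x\<close>\<close>
  have eq: "dx b (Complex x s) - dx b (Complex x y) = (s - y) * integral {0..1} (\<lambda>t. ?h (Complex x (y + t * (s - y))))" for s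
  proof -
    have "(\<lambda>w. b (Complex (Re w) y)) = (\<lambda>w. b w - vertical_integral y (dy b) w)"
      using vertical_integral_FTC[OF b1(1), of y] by auto
    moreover have "((\<lambda>w. b (Complex (Re w) y)) has_derivative (\<lambda>k. Re k * dx b (Complex x y))) (at (Complex x s))"
    proof -
      have "((\<lambda>w. Complex (Re w) y) has_derivative (\<lambda>k. of_real (Re k))) (at (Complex x s))"
        unfolding Complex_eq_plus by (auto intro!: derivative_eq_intros)
      from has_derivative_compose[OF this Ck_has_derivative[OF b1(1)]] show ?thesis by simp
    qed
    moreover have "((\<lambda>w. b w - vertical_integral y (dy b) w) has_derivative
        (\<lambda>k. (Re k *\<^sub>R dx b (Complex x s) + Im k *\<^sub>R dy b (Complex x s)) -
          (Re k *\<^sub>R vertical_integral y ?h (Complex x s) + Im k *\<^sub>R dy b (Complex x s)))) (at (Complex x s))"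
      by (intro has_derivative_diff Ck_has_derivative[OF b1(1)] vertical_integral_derivative b1) simp
    ultimately have "(\<lambda>k. Re k * dx b (Complex x y)) = (\<lambda>k. (Re k *\<^sub>R dx b (Complex x s) + Im k *\<^sub>R dy b (Complex x s)) -
          (Re k *\<^sub>R vertical_integral y ?h (Complex x s) + Im k *\<^sub>R dy b (Complex x s)))"
      by (metis (no_types, lifting) has_derivative_unique)
    from fun_cong[OF this, of 1] show ?thesis
      by (simp add: vertical_integral_def)
  qed
  let ?J = "\<lambda>s. integral {0..1} (\<lambda>t. ?h (Complex x (y + t * (s - y))))"
  have "continuous_on UNIV (\<lambda>s. integral (cbox 0 1) (\<lambda>t. ?h (Complex x (y + t * (s - y)))))"
    by (rule integral_continuous_on_param)
      (auto simp: case_prod_unfold intro!: continuous_on_compose2[OF ch] continuous_intros)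
  then have "isCont ?J y"
    by (simp add: continuous_on_eq_continuous_at)
  then have J: "(?J \<longlongrightarrow> ?J y) (at y)"
    by (simp add: isCont_def)
  have "\<forall>\<^sub>F s in at y. ?J s = (dx b (Complex x s) - dx b (Complex x y)) / (s - y)"
    unfolding eventually_at_filter by (rule always_eventually) (auto simp: eq)
  from Lim_transform_eventually[OF J this]
  have "((\<lambda>s. (dx b (Complex x s) - dx b (Complex x y)) / (s - y)) \<longlongrightarrow> ?h z) (at y)"
    by (simp add: x_def y_def)
  then have "((\<lambda>s. dx b (Complex x s)) has_field_derivative ?h z) (at y)"
    by (simp add: has_field_derivative_iff)
  moreover have "((\<lambda>s. dx b (Complex x s)) has_field_derivative dy (dx b) z) (at y)"
    using has_vector_derivative_vertical[of "dx b" x y] Ck_differentiable[OF b1(2)]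
    by (simp add: x_def y_def has_real_derivative_iff_has_vector_derivative)
  ultimately show ?thesis
    by (rule DERIV_unique)
qed

section \<open>The magnetic energy of a weighted test function\<close>

lemma Ck_exp:
  fixes f :: "complex \<Rightarrow> real"
  assumes "Ck k f"
  shows "Ck k (\<lambda>z. exp (f z))"
  using assms
proof (induction k arbitrary: f)
  case (Suc k)
  note D = Ck_has_derivative[OF Suc.prems]
  have "Ck k (dx f)" "Ck k (dy f)" using Suc.prems by simp_all
  with Suc.IH[OF Ck_SucD[OF Suc.prems]] have *: "Ck k (\<lambda>z. dx f z * exp (f z))" "Ck k (\<lambda>z. dy f z * exp (f z))"
    by (simp_all only: Ck_mult)
  have "((\<lambda>z. exp (f z)) has_derivative (\<lambda>h. Re h *\<^sub>R (dx f z * exp (f z)) + Im h *\<^sub>R (dy f z * exp (f z)))) (at z)" for z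
    using has_derivative_exp[OF D] by (simp add: algebra_simps)
  from Ck_SucI(1)[OF this *] show ?case .
qed (auto intro: continuous_on_exp)

lemma dx_exp:
  fixes f :: "complex \<Rightarrow> real"
  assumes "f differentiable (at z)"
  shows "dx (\<lambda>z. exp (f z)) z = exp (f z) * dx f z" "dy (\<lambda>z. exp (f z)) z = exp (f z) * dy f z"
  using has_derivative_exp[OF has_derivative_dx_dy[OF assms], THEN dx_eqI]
    has_derivative_exp[OF has_derivative_dx_dy[OF assms], THEN dy_eqI] by simp_all

lemma dx_square:
  fixes f :: "complex \<Rightarrow> real"
  assumes "f differentiable (at z)"
  shows "dx (\<lambda>z. (f z)\<^sup>2) z = 2 * f z * dx f z" "dy (\<lambda>z. (f z)\<^sup>2) z = 2 * f z * dy f z"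
  using dx_mult[OF assms assms] by (simp_all add: power2_eq_square)

lemma dx_diff:
  assumes "f differentiable (at z)" "g differentiable (at z)"
  shows "dx (\<lambda>z. f z - g z) z = dx f z - dx g z" "dy (\<lambda>z. f z - g z) z = dy f z - dy g z"
  using has_derivative_diff[OF has_derivative_dx_dy[OF assms(1)] has_derivative_dx_dy[OF assms(2)], THEN dx_eqI]
    has_derivative_diff[OF has_derivative_dx_dy[OF assms(1)] has_derivative_dx_dy[OF assms(2)], THEN dy_eqI]
  by simp_all

lemma Ck_2: "Ck 2 f \<longleftrightarrow> f differentiable_on UNIV \<and> Ck 1 (dx f) \<and> Ck 1 (dy f)"
  by (simp add: numeral_2_eq_2)

lemma Ck_2_imp_1: "Ck 2 f \<Longrightarrow> Ck 1 f"
  by (erule Ck_mono) simp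

lemma continuous_laplacian:
  assumes "Ck 2 \<phi>" shows "continuous_on UNIV (laplacian \<phi>)"
proof -
  have "continuous_on UNIV (dx (dx \<phi>))" "continuous_on UNIV (dy (dy \<phi>))"
    using assms by (auto simp: numeral_2_eq_2)
  then show ?thesis
    unfolding laplacian_def[abs_def] by (rule continuous_on_add)
qed

text \<open>
  Real form of the commutator identity for \<open>g = a + i b\<close>. The two integrands differ by the
  divergence of the field with components \<open>2 a b\<^sub>y + \<phi>\<^sub>x |g|\<^sup>2\<close> and
  \<open>- 2 a b\<^sub>x + \<phi>\<^sub>y |g|\<^sup>2\<close>, where the second derivatives of
  \<open>b\<close> cancel because mixed partials commute.
\<close>

lemma magnetic_divergence:
  fixes \<phi> a b :: "complex \<Rightarrow> real"
  assumes \<phi>: "Ck 2 \<phi>" and a: "Ck 2 a" and b: "Ck 2 b"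
    and ba: "bounded {z. a z \<noteq> 0}" and bb: "bounded {z. b z \<noteq> 0}"
  shows "(\<integral>z. (dx a z + dy \<phi> z * b z)\<^sup>2 + (dx b z - dy \<phi> z * a z)\<^sup>2 + (dy a z - dx \<phi> z * b z)\<^sup>2
            + (dy b z + dx \<phi> z * a z)\<^sup>2 + laplacian \<phi> z * ((a z)\<^sup>2 + (b z)\<^sup>2) \<partial>lborel)
       = (\<integral>z. (dx a z + dy \<phi> z * b z - (dy b z + dx \<phi> z * a z))\<^sup>2
            + (dx b z - dy \<phi> z * a z + (dy a z - dx \<phi> z * b z))\<^sup>2 \<partial>lborel)"
proof -
  \<comment> \<open>the two components of the vector field whose divergence is the difference\<close>
  let ?F = "\<lambda>z. 2 * (a z * dy b z) + dx \<phi> z * ((a z)\<^sup>2 + (b z)\<^sup>2)"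
  let ?G = "\<lambda>z. dy \<phi> z * ((a z)\<^sup>2 + (b z)\<^sup>2) + (- 2) * (a z * dx b z)"
  note C1 = Ck_2_imp_1[OF \<phi>] Ck_2_imp_1[OF a] Ck_2_imp_1[OF b] \<phi>[unfolded Ck_2] a[unfolded Ck_2] b[unfolded Ck_2]
  have sq: "Ck 1 (\<lambda>z. (a z)\<^sup>2 + (b z)\<^sup>2)"
    unfolding power2_eq_square by (intro Ck_add Ck_mult C1)
  have F: "Ck 1 ?F" and G: "Ck 1 ?G"
    by (intro Ck_add Ck_mult sq Ck_const; use C1 in blast)+
  have bF: "bounded {z. ?F z \<noteq> 0}" and bG: "bounded {z. ?G z \<noteq> 0}"
    by (rule bounded_subset[OF bounded_Un[THEN iffD2, OF conjI[OF ba bb]]], auto)+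
  have diff: "f differentiable (at z)" if "Ck 1 f" for f :: "complex \<Rightarrow> real" and z
    using that by (rule Ck_differentiable) simp
  have d[simp]: "a differentiable (at z)" "b differentiable (at z)" "dx b differentiable (at z)" "dy b differentiable (at z)"
     "dx \<phi> differentiable (at z)" "dy \<phi> differentiable (at z)" for z
    using C1 by (auto intro: diff simp del: Ck.simps One_nat_def)
  have dF: "dx ?F z = 2 * (a z * dx (dy b) z + dx a z * dy b z) + (dx \<phi> z * (2 * a z * dx a z + 2 * b z * dx b z) + dx (dx \<phi>) z * ((a z)\<^sup>2 + (b z)\<^sup>2))"
    and dG: "dy ?G z = (dy \<phi> z * (2 * a z * dy a z + 2 * b z * dy b z) + dy (dy \<phi>) z * ((a z)\<^sup>2 + (b z)\<^sup>2)) - 2 * (a z * dy (dx b) z + dy a z * dx b z)" for z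
    by (simp_all add: dx_add dx_diff dx_mult dx_square)
  have cont: "continuous_on UNIV a" "continuous_on UNIV b" "continuous_on UNIV (dx a)" "continuous_on UNIV (dy a)"
      "continuous_on UNIV (dx b)" "continuous_on UNIV (dy b)" "continuous_on UNIV (dx \<phi>)" "continuous_on UNIV (dy \<phi>)"
      "continuous_on UNIV (laplacian \<phi>)"
    using C1 continuous_laplacian[OF \<phi>] by (auto intro: Ck_imp_continuous simp del: Ck.simps One_nat_def)
  let ?S = "{z. a z \<noteq> 0} \<union> {z. b z \<noteq> 0} \<union> {z. dx a z \<noteq> 0} \<union> {z. dy a z \<noteq> 0} \<union> {z. dx b z \<noteq> 0} \<union> {z. dy b z \<noteq> 0}"
  have bS: "bounded ?S"
    using ba bb bounded_support_dx[OF ba] bounded_support_dx[OF bb] by simp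
  let ?L = "\<lambda>z. (dx a z + dy \<phi> z * b z)\<^sup>2 + (dx b z - dy \<phi> z * a z)\<^sup>2 + (dy a z - dx \<phi> z * b z)\<^sup>2
            + (dy b z + dx \<phi> z * a z)\<^sup>2 + laplacian \<phi> z * ((a z)\<^sup>2 + (b z)\<^sup>2)"
  let ?R = "\<lambda>z. (dx a z + dy \<phi> z * b z - (dy b z + dx \<phi> z * a z))\<^sup>2
            + (dx b z - dy \<phi> z * a z + (dy a z - dx \<phi> z * b z))\<^sup>2"
  have iL: "integrable lborel ?L"
    by (rule integrable_compact_support) (auto intro!: continuous_intros cont bounded_subset[OF bS])
  have iR: "integrable lborel ?R"
    by (rule integrable_compact_support) (auto intro!: continuous_intros cont bounded_subset[OF bS])
  have "?L z = ?R z + (dx ?F z + dy ?G z)" for z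
    unfolding dF dG laplacian_def mixed_partials_commute[OF b, of z] by (simp add: power2_eq_square algebra_simps)
  then have "integral\<^sup>L lborel ?L = (\<integral>z. ?R z + (dx ?F z + dy ?G z) \<partial>lborel)"
    by presburger
  also have "\<dots> = integral\<^sup>L lborel ?R + (integral\<^sup>L lborel (dx ?F) + integral\<^sup>L lborel (dy ?G))"
    using iR integral_dx_eq_0(1)[OF F bF] integral_dx_eq_0(2)[OF G bG] by simp
  also have "integral\<^sup>L lborel (dx ?F) = 0" by (rule integral_dx_eq_0(3)[OF F bF])
  also have "integral\<^sup>L lborel (dy ?G) = 0" by (rule integral_dx_eq_0(4)[OF G bG])
  finally show ?thesis by simp
qed

text \<open>The covariant derivatives of \<open>\<psi> e\<^sup>\<phi>\<close> for the magnetic potential \<open>(\<phi>\<^sub>y, -\<phi>\<^sub>x)\<close>.\<close>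

definition cov_dx :: "(complex \<Rightarrow> real) \<Rightarrow> (complex \<Rightarrow> complex) \<Rightarrow> complex \<Rightarrow> complex" where
  "cov_dx \<phi> \<psi> z = (dx \<psi> z + Complex (dx \<phi> z) (- dy \<phi> z) * \<psi> z) * of_real (exp (\<phi> z))"

definition cov_dy :: "(complex \<Rightarrow> real) \<Rightarrow> (complex \<Rightarrow> complex) \<Rightarrow> complex \<Rightarrow> complex" where
  "cov_dy \<phi> \<psi> z = (dy \<psi> z + Complex (dy \<phi> z) (dx \<phi> z) * \<psi> z) * of_real (exp (\<phi> z))"

text \<open>
  The magnetic Schroedinger energy density of \<open>\<psi> e\<^sup>\<phi>\<close>.
\<close>

definition energy_density :: "(complex \<Rightarrow> real) \<Rightarrow> (complex \<Rightarrow> complex) \<Rightarrow> complex \<Rightarrow> real" where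
  "energy_density \<phi> \<psi> z = (norm (cov_dx \<phi> \<psi> z))\<^sup>2 + (norm (cov_dy \<phi> \<psi> z))\<^sup>2
     + laplacian \<phi> z * (norm (\<psi> z * of_real (exp (\<phi> z))))\<^sup>2"

lemma cov_sum: "cov_dx \<phi> \<psi> z + \<i> * cov_dy \<phi> \<psi> z = 2 * dbar \<psi> z * of_real (exp (\<phi> z))"
  by (simp add: cov_dx_def cov_dy_def dbar_def algebra_simps complex_eq_iff)

text \<open>
  The sum \<open>cov_dx + i cov_dy\<close> is \<open>2 e\<^sup>\<phi> dbar \<psi>\<close>; expanding its
  squared norm leaves a cross term, and this integrates to the potential term.
\<close>

lemma energy_identity:
  assumes \<phi>: "Ck 2 \<phi>" and \<psi>: "Ck 2 \<psi>" and b\<psi>: "bounded {z. \<psi> z \<noteq> 0}"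
  shows "(\<integral>z. energy_density \<phi> \<psi> z \<partial>lborel) = 4 * (\<integral>z. (norm (dbar \<psi> z * of_real (exp (\<phi> z))))\<^sup>2 \<partial>lborel)"
proof -
  \<comment> \<open>real and imaginary part of \<open>\<psi> e\<^sup>\<phi>\<close>\<close>
  define a where "a z = Re (\<psi> z) * exp (\<phi> z)" for z
  define b where "b z = Im (\<psi> z) * exp (\<phi> z)" for z
  have a: "Ck 2 a" and b: "Ck 2 b"
    unfolding a_def[abs_def] b_def[abs_def]
    by (intro Ck_mult Ck_exp \<phi> Ck_bounded_linear[OF bounded_linear_Re \<psi>] Ck_bounded_linear[OF bounded_linear_Im \<psi>])+
  have bab: "bounded {z. a z \<noteq> 0}" "bounded {z. b z \<noteq> 0}"
    by (rule bounded_subset[OF b\<psi>], auto simp: a_def b_def)+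
  have dp: "\<psi> differentiable (at z)" "\<phi> differentiable (at z)" for z
    using Ck_differentiable[OF \<psi>] Ck_differentiable[OF \<phi>] by auto
  have dRe: "(\<lambda>z. Re (\<psi> z)) differentiable (at z)" "(\<lambda>z. Im (\<psi> z)) differentiable (at z)"
      "(\<lambda>z. exp (\<phi> z)) differentiable (at z)" for z
    using Ck_differentiable[OF Ck_bounded_linear[OF bounded_linear_Re \<psi>]]
      Ck_differentiable[OF Ck_bounded_linear[OF bounded_linear_Im \<psi>]] Ck_differentiable[OF Ck_exp[OF \<phi>]] by auto
  have da: "dx a z = (Re (dx \<psi> z) + Re (\<psi> z) * dx \<phi> z) * exp (\<phi> z)" "dy a z = (Re (dy \<psi> z) + Re (\<psi> z) * dy \<phi> z) * exp (\<phi> z)"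
      "dx b z = (Im (dx \<psi> z) + Im (\<psi> z) * dx \<phi> z) * exp (\<phi> z)" "dy b z = (Im (dy \<psi> z) + Im (\<psi> z) * dy \<phi> z) * exp (\<phi> z)" for z
    unfolding a_def[abs_def] b_def[abs_def] dx_mult[OF dRe(1) dRe(3)] dx_mult[OF dRe(2) dRe(3)]
      dx_exp[OF dp(2)] dx_bounded_linear[OF bounded_linear_Re dp(1)] dx_bounded_linear[OF bounded_linear_Im dp(1)]
    by (simp_all add: algebra_simps)
  have P: "Re (cov_dx \<phi> \<psi> z) = dx a z + dy \<phi> z * b z" "Im (cov_dx \<phi> \<psi> z) = dx b z - dy \<phi> z * a z"
      "Re (cov_dy \<phi> \<psi> z) = dy a z - dx \<phi> z * b z" "Im (cov_dy \<phi> \<psi> z) = dy b z + dx \<phi> z * a z" for z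
    by (simp_all add: cov_dx_def cov_dy_def da a_def b_def algebra_simps)
  have L: "energy_density \<phi> \<psi> z = (dx a z + dy \<phi> z * b z)\<^sup>2 + (dx b z - dy \<phi> z * a z)\<^sup>2 + (dy a z - dx \<phi> z * b z)\<^sup>2
            + (dy b z + dx \<phi> z * a z)\<^sup>2 + laplacian \<phi> z * ((a z)\<^sup>2 + (b z)\<^sup>2)" for z
    unfolding energy_density_def cmod_power2 P by (simp add: a_def b_def)
  have R: "(dx a z + dy \<phi> z * b z - (dy b z + dx \<phi> z * a z))\<^sup>2 + (dx b z - dy \<phi> z * a z + (dy a z - dx \<phi> z * b z))\<^sup>2
      = 4 * (norm (dbar \<psi> z * of_real (exp (\<phi> z))))\<^sup>2" for z
  proof -
    have "(norm (cov_dx \<phi> \<psi> z + \<i> * cov_dy \<phi> \<psi> z))\<^sup>2 = (dx a z + dy \<phi> z * b z - (dy b z + dx \<phi> z * a z))\<^sup>2 + (dx b z - dy \<phi> z * a z + (dy a z - dx \<phi> z * b z))\<^sup>2"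
      unfolding cmod_power2 by (simp add: P algebra_simps)
    then show ?thesis
      unfolding cov_sum by (simp add: norm_mult power_mult_distrib)
  qed
  show ?thesis
    using magnetic_divergence[OF \<phi> a b bab] unfolding L R by simp
qed

lemma continuous_energy_density:
  assumes \<phi>: "Ck 2 \<phi>" and \<psi>: "Ck 2 \<psi>"
  shows "continuous_on UNIV (cov_dx \<phi> \<psi>)" "continuous_on UNIV (cov_dy \<phi> \<psi>)" "continuous_on UNIV (energy_density \<phi> \<psi>)" "continuous_on UNIV (dbar \<psi>)"
proof -
  have c: "continuous_on UNIV \<psi>" "continuous_on UNIV (dx \<psi>)" "continuous_on UNIV (dy \<psi>)"
      "continuous_on UNIV \<phi>" "continuous_on UNIV (dx \<phi>)" "continuous_on UNIV (dy \<phi>)"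
    using \<phi>[unfolded Ck_2] \<psi>[unfolded Ck_2] \<phi> \<psi> by (auto intro: Ck_imp_continuous simp del: Ck.simps One_nat_def)
  show 1: "continuous_on UNIV (cov_dx \<phi> \<psi>)" "continuous_on UNIV (cov_dy \<phi> \<psi>)" "continuous_on UNIV (dbar \<psi>)"
    unfolding cov_dx_def[abs_def] cov_dy_def[abs_def] dbar_def[abs_def] by (intro continuous_intros c; simp)+
  show "continuous_on UNIV (energy_density \<phi> \<psi>)"
    unfolding energy_density_def[abs_def] by (intro continuous_intros 1 c continuous_laplacian \<phi>)
qed

lemma nn_integral_energy:
  assumes \<phi>: "Ck 2 \<phi>" and \<psi>: "Ck 2 \<psi>" and b\<psi>: "bounded {z. \<psi> z \<noteq> 0}" and V: "\<And>z. 0 \<le> laplacian \<phi> z"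
  shows "(\<integral>\<^sup>+z. ennreal (energy_density \<phi> \<psi> z) \<partial>lborel) = ennreal (4 * (\<integral>z. (norm (dbar \<psi> z * of_real (exp (\<phi> z))))\<^sup>2 \<partial>lborel))"
  unfolding energy_identity[OF assms(1-3), symmetric]
proof (rule nn_integral_eq_integral)
  have "bounded ({z. \<psi> z \<noteq> 0} \<union> {z. dx \<psi> z \<noteq> 0} \<union> {z. dy \<psi> z \<noteq> 0})"
    using b\<psi> bounded_support_dx[OF b\<psi>] by simp
  then have "bounded {z. energy_density \<phi> \<psi> z \<noteq> 0}"
    by (rule bounded_subset) (auto simp: energy_density_def cov_dx_def cov_dy_def)
  then show "integrable lborel (energy_density \<phi> \<psi>)"
    by (intro integrable_compact_support continuous_energy_density \<phi> \<psi>)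
  show "AE z in lborel. 0 \<le> energy_density \<phi> \<psi> z"
    using V by (simp add: energy_density_def)
qed

section \<open>Poincare and Fefferman-Phong inequalities on squares\<close>

text \<open>
  Half-open, so that the cells of a grid are disjoint and cover the plane.
\<close>

definition square :: "real \<Rightarrow> real \<Rightarrow> real \<Rightarrow> complex set" where
  "square x y r = {z. x \<le> Re z \<and> Re z < x + r \<and> y \<le> Im z \<and> Im z < y + r}"

lemma square_borel [measurable]: "square x y r \<in> sets borel"
  unfolding square_def by measurable

lemma indicator_square: "indicator (square x y r) (Complex a b) = (indicator {x..<x+r} a * indicator {y..<y+r} b :: ennreal)"
  by (auto simp: square_def indicator_def)

lemma nn_integral_square:
  fixes f :: "complex \<Rightarrow> ennreal"
  assumes [measurable]: "f \<in> borel_measurable borel"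
  shows "(\<integral>\<^sup>+z\<in>square x y r. f z \<partial>lborel) = (\<integral>\<^sup>+b\<in>{y..<y+r}. (\<integral>\<^sup>+a\<in>{x..<x+r}. f (Complex a b) \<partial>lborel) \<partial>lborel)"
    and "(\<integral>\<^sup>+z\<in>square x y r. f z \<partial>lborel) = (\<integral>\<^sup>+a\<in>{x..<x+r}. (\<integral>\<^sup>+b\<in>{y..<y+r}. f (Complex a b) \<partial>lborel) \<partial>lborel)"
proof -
  show "(\<integral>\<^sup>+z\<in>square x y r. f z \<partial>lborel) = (\<integral>\<^sup>+b\<in>{y..<y+r}. (\<integral>\<^sup>+a\<in>{x..<x+r}. f (Complex a b) \<partial>lborel) \<partial>lborel)"
    by (subst nn_integral_complex(2), measurable, rule nn_integral_cong, subst nn_integral_multc[symmetric])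
       (simp_all add: indicator_square mult_ac)
  show "(\<integral>\<^sup>+z\<in>square x y r. f z \<partial>lborel) = (\<integral>\<^sup>+a\<in>{x..<x+r}. (\<integral>\<^sup>+b\<in>{y..<y+r}. f (Complex a b) \<partial>lborel) \<partial>lborel)"
    by (subst nn_integral_complex(1), measurable, rule nn_integral_cong, subst nn_integral_multc[symmetric])
       (simp_all add: indicator_square mult_ac)
qed

lemma emeasure_square: "r \<ge> 0 \<Longrightarrow> emeasure lborel (square x y r) = ennreal (r\<^sup>2)"
  using nn_integral_square(1)[of "\<lambda>_. 1" x y r] by (simp add: power2_eq_square ennreal_mult nn_integral_cmult_indicator)

lemma nn_integral_square_Re:
  fixes f :: "real \<Rightarrow> ennreal"
  assumes [measurable]: "f \<in> borel_measurable borel" and "r \<ge> 0"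
  shows "(\<integral>\<^sup>+z\<in>square x y r. f (Re z) \<partial>lborel) = ennreal r * (\<integral>\<^sup>+a\<in>{x..<x+r}. f a \<partial>lborel)"
    and "(\<integral>\<^sup>+z\<in>square x y r. f (Im z) \<partial>lborel) = ennreal r * (\<integral>\<^sup>+b\<in>{y..<y+r}. f b \<partial>lborel)"
  using \<open>r \<ge> 0\<close> nn_integral_square(2)[of "\<lambda>z. f (Re z)" x y r] nn_integral_square(1)[of "\<lambda>z. f (Im z)" x y r]
  by (simp_all add: nn_integral_cmult nn_integral_multc[symmetric] mult_ac)

lemma norm_increment_le_nn_integral:
  fixes u :: "real \<Rightarrow> 'a::euclidean_space"
  assumes "a \<le> b" and u: "\<And>s. s \<in> {a..b} \<Longrightarrow> (u has_vector_derivative u' s) (at s within {a..b})"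
    and c: "continuous_on {a..b} u'"
  shows "ennreal (norm (u b - u a)) \<le> (\<integral>\<^sup>+s\<in>{a..b}. ennreal (norm (u' s)) \<partial>lborel)"
proof -
  have eq: "u b - u a = (\<integral>s. indicator {a..b} s *\<^sub>R u' s \<partial>lborel)"
    using assms by (intro integral_FTC_atLeastAtMost[symmetric]) auto
  have i: "integrable lborel (\<lambda>s. indicator {a..b} s *\<^sub>R u' s)"
    using borel_integrable_atLeastAtMost'[OF c] by (simp add: set_integrable_def)
  have "ennreal (norm (u b - u a)) \<le> (\<integral>\<^sup>+s. ennreal (norm (indicator {a..b} s *\<^sub>R u' s)) \<partial>lborel)"
    unfolding eq by (rule integral_norm_bound_ennreal[OF i])
  also have "\<dots> = (\<integral>\<^sup>+s\<in>{a..b}. ennreal (norm (u' s)) \<partial>lborel)"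
    by (intro nn_integral_cong) (simp add: indicator_def)
  finally show ?thesis .
qed

text \<open>
  Cauchy-Schwarz against the indicator of the larger interval, so that the bound does not depend on the
  end points of the path.
\<close>

lemma nn_integral_interval_Cauchy_Schwarz:
  fixes X :: "real \<Rightarrow> real"
  assumes [measurable]: "X \<in> borel_measurable borel" and X: "\<And>s. 0 \<le> X s"
    and ab: "{a..b} \<subseteq> {x..<x+r}" and "r \<ge> 0"
    and d: "ennreal d \<le> (\<integral>\<^sup>+s\<in>{a..b}. ennreal (X s) \<partial>lborel)" and "d \<ge> 0"
  shows "ennreal (d\<^sup>2) \<le> ennreal r * (\<integral>\<^sup>+s\<in>{x..<x+r}. ennreal ((X s)\<^sup>2) \<partial>lborel)"
proof -
  let ?I = "indicator {x..<x+r} :: real \<Rightarrow> ennreal"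
  have "ennreal d \<le> (\<integral>\<^sup>+s. (ennreal (X s) * ?I s) * ?I s \<partial>lborel)"
    using d by (rule order_trans) (use ab in \<open>auto intro!: nn_integral_mono simp: indicator_def\<close>)
  then have "(ennreal d)\<^sup>2 \<le> (\<integral>\<^sup>+s. (ennreal (X s) * ?I s) * ?I s \<partial>lborel)\<^sup>2"
    by (rule power_mono) simp
  also have "\<dots> \<le> (\<integral>\<^sup>+s. (ennreal (X s) * ?I s)\<^sup>2 \<partial>lborel) * (\<integral>\<^sup>+s. (?I s)\<^sup>2 \<partial>lborel)"
    by (rule Cauchy_Schwarz_nn_integral) auto
  also have "(\<integral>\<^sup>+s. (?I s)\<^sup>2 \<partial>lborel) = ennreal r"
  proof -
    have "(\<integral>\<^sup>+s. (?I s)\<^sup>2 \<partial>lborel) = (\<integral>\<^sup>+s. ?I s \<partial>lborel)"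
      by (intro nn_integral_cong) (simp add: indicator_def)
    then show ?thesis using \<open>r \<ge> 0\<close> by simp
  qed
  also have "(\<integral>\<^sup>+s. (ennreal (X s) * ?I s)\<^sup>2 \<partial>lborel) = (\<integral>\<^sup>+s\<in>{x..<x+r}. ennreal ((X s)\<^sup>2) \<partial>lborel)"
    by (intro nn_integral_cong) (simp add: indicator_def X ennreal_power)
  finally show ?thesis
    using \<open>d \<ge> 0\<close> by (simp add: ennreal_power mult.commute)
qed

text \<open>
  Two points of the square are joined by a horizontal and a vertical segment. The hypotheses on
  \<open>X\<close> and \<open>Y\<close> only ask for bounds on increments along such segments, so that
  the inequality applies to \<open>h = |g|\<close>, which need not be differentiable, as well as to a
  smooth \<open>h\<close>.
\<close>

lemma Poincare_square:
  fixes h :: "complex \<Rightarrow> 'a::euclidean_space" and X Y :: "complex \<Rightarrow> real"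
  assumes [measurable]: "h \<in> borel_measurable borel" "X \<in> borel_measurable borel" "Y \<in> borel_measurable borel"
    and X0: "\<And>z. 0 \<le> X z" and Y0: "\<And>z. 0 \<le> Y z" and r: "r \<ge> 0"
    and X: "\<And>a b y. a \<le> b \<Longrightarrow> ennreal (norm (h (Complex b y) - h (Complex a y))) \<le> (\<integral>\<^sup>+s\<in>{a..b}. ennreal (X (Complex s y)) \<partial>lborel)"
    and Y: "\<And>a b x. a \<le> b \<Longrightarrow> ennreal (norm (h (Complex x b) - h (Complex x a))) \<le> (\<integral>\<^sup>+t\<in>{a..b}. ennreal (Y (Complex x t)) \<partial>lborel)"
  shows "(\<integral>\<^sup>+z\<in>square x0 y0 r. (\<integral>\<^sup>+w\<in>square x0 y0 r. ennreal ((norm (h z - h w))\<^sup>2) \<partial>lborel) \<partial>lborel)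
     \<le> ennreal (2 * r ^ 4) * (\<integral>\<^sup>+z\<in>square x0 y0 r. ennreal ((X z)\<^sup>2 + (Y z)\<^sup>2) \<partial>lborel)"
proof -
  let ?Q = "square x0 y0 r"
  define A where "A y = (\<integral>\<^sup>+s\<in>{x0..<x0+r}. ennreal ((X (Complex s y))\<^sup>2) \<partial>lborel)" for y
  define B where "B x = (\<integral>\<^sup>+t\<in>{y0..<y0+r}. ennreal ((Y (Complex x t))\<^sup>2) \<partial>lborel)" for x
  have [measurable]: "A \<in> borel_measurable borel" "B \<in> borel_measurable borel"
    unfolding A_def[abs_def] B_def[abs_def] by measurable
  have hor: "ennreal ((norm (h (Complex x y) - h (Complex x' y)))\<^sup>2) \<le> ennreal r * A y"
    if "x \<in> {x0..<x0+r}" "x' \<in> {x0..<x0+r}" for x x' y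
  proof -
    have *: "ennreal ((norm (h (Complex x y) - h (Complex x' y)))\<^sup>2) \<le> ennreal r * A y"
      if "x \<in> {x0..<x0+r}" "x' \<in> {x0..<x0+r}" "x' \<le> x" for x x'
      unfolding A_def
      by (rule nn_integral_interval_Cauchy_Schwarz[OF _ _ _ r X[OF that(3)]]) (use that X0 in auto)
    show ?thesis
      using *[of x x'] *[of x' x] that by (cases "x' \<le> x") (auto simp: norm_minus_commute)
  qed
  have ver: "ennreal ((norm (h (Complex x y) - h (Complex x y')))\<^sup>2) \<le> ennreal r * B x"
    if "y \<in> {y0..<y0+r}" "y' \<in> {y0..<y0+r}" for x y y'
  proof -
    have *: "ennreal ((norm (h (Complex x y) - h (Complex x y')))\<^sup>2) \<le> ennreal r * B x"
      if "y \<in> {y0..<y0+r}" "y' \<in> {y0..<y0+r}" "y' \<le> y" for y y'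
      unfolding B_def
      by (rule nn_integral_interval_Cauchy_Schwarz[OF _ _ _ r Y[OF that(3)]]) (use that Y0 in auto)
    show ?thesis
      using *[of y y'] *[of y' y] that by (cases "y' \<le> y") (auto simp: norm_minus_commute)
  qed
  have pt: "ennreal ((norm (h z - h w))\<^sup>2) \<le> ennreal (2 * r) * A (Im z) + ennreal (2 * r) * B (Re w)"
    if z: "z \<in> ?Q" and w: "w \<in> ?Q" for z w
  proof -
    \<comment> \<open>the corner of the path from \<open>z\<close> to \<open>w\<close>\<close>
    let ?m = "h (Complex (Re w) (Im z))"
    have "(norm (h z - h w))\<^sup>2 \<le> (norm (h z - ?m) + norm (?m - h w))\<^sup>2"
      using norm_triangle_ineq[of "h z - ?m" "?m - h w"] by (intro power_mono) auto
    also have "\<dots> \<le> 2 * (norm (h z - ?m))\<^sup>2 + 2 * (norm (?m - h w))\<^sup>2"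
      using sum_squares_bound[of "norm (h z - ?m)" "norm (?m - h w)"] by (simp add: power2_sum)
    finally have "ennreal ((norm (h z - h w))\<^sup>2) \<le> ennreal (2 * (norm (h z - ?m))\<^sup>2 + 2 * (norm (?m - h w))\<^sup>2)"
      by (rule ennreal_leI)
    also have "\<dots> = 2 * ennreal ((norm (h z - ?m))\<^sup>2) + 2 * ennreal ((norm (?m - h w))\<^sup>2)"
      by (simp add: ennreal_mult)
    also have "\<dots> \<le> 2 * (ennreal r * A (Im z)) + 2 * (ennreal r * B (Re w))"
      using hor[of "Re z" "Re w" "Im z"] ver[of "Im z" "Im w" "Re w"] z w
      by (intro add_mono mult_left_mono) (auto simp: square_def)
    finally show ?thesis
      using r by (simp add: ennreal_mult mult.assoc)
  qed
  have "(\<integral>\<^sup>+z\<in>?Q. (\<integral>\<^sup>+w\<in>?Q. ennreal ((norm (h z - h w))\<^sup>2) \<partial>lborel) \<partial>lborel)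
      \<le> (\<integral>\<^sup>+z\<in>?Q. (\<integral>\<^sup>+w\<in>?Q. ennreal (2 * r) * A (Im z) + ennreal (2 * r) * B (Re w) \<partial>lborel) \<partial>lborel)"
  proof (rule nn_integral_mono)
    fix z
    have "(\<integral>\<^sup>+w\<in>?Q. ennreal ((norm (h z - h w))\<^sup>2) \<partial>lborel) \<le> (\<integral>\<^sup>+w\<in>?Q. ennreal (2 * r) * A (Im z) + ennreal (2 * r) * B (Re w) \<partial>lborel)"
      if "z \<in> ?Q"
      using pt[OF that] by (intro nn_integral_mono) (auto simp: indicator_def)
    then show "(\<integral>\<^sup>+w\<in>?Q. ennreal ((norm (h z - h w))\<^sup>2) \<partial>lborel) * indicator ?Q z
       \<le> (\<integral>\<^sup>+w\<in>?Q. ennreal (2 * r) * A (Im z) + ennreal (2 * r) * B (Re w) \<partial>lborel) * indicator ?Q z"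
      by (simp add: indicator_def)
  qed
  also have "\<dots> = (\<integral>\<^sup>+z\<in>?Q. ennreal (2 * r) * A (Im z) * ennreal (r\<^sup>2) + ennreal (2 * r) * (ennreal r * (\<integral>\<^sup>+a\<in>{x0..<x0+r}. B a \<partial>lborel)) \<partial>lborel)"
  proof (rule nn_integral_cong)
    fix z
    have "(\<integral>\<^sup>+w\<in>?Q. ennreal (2 * r) * A (Im z) + ennreal (2 * r) * B (Re w) \<partial>lborel)
       = (\<integral>\<^sup>+w. (ennreal (2 * r) * A (Im z)) * indicator ?Q w + ennreal (2 * r) * (B (Re w) * indicator ?Q w) \<partial>lborel)"
      by (simp add: distrib_right mult.assoc)
    also have "\<dots> = ennreal (2 * r) * A (Im z) * emeasure lborel ?Q + ennreal (2 * r) * (\<integral>\<^sup>+w\<in>?Q. B (Re w) \<partial>lborel)"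
      by (subst nn_integral_add) (auto simp: nn_integral_cmult)
    finally show "(\<integral>\<^sup>+w\<in>?Q. ennreal (2 * r) * A (Im z) + ennreal (2 * r) * B (Re w) \<partial>lborel) * indicator ?Q z
      = (ennreal (2 * r) * A (Im z) * ennreal (r\<^sup>2) + ennreal (2 * r) * (ennreal r * (\<integral>\<^sup>+a\<in>{x0..<x0+r}. B a \<partial>lborel))) * indicator ?Q z"
      using r by (simp add: emeasure_square nn_integral_square_Re)
  qed
  also have "\<dots> = (\<integral>\<^sup>+z. ennreal (2 * r) * ennreal (r\<^sup>2) * (A (Im z) * indicator ?Q z) + ennreal (2 * r) * (ennreal r * (\<integral>\<^sup>+a\<in>{x0..<x0+r}. B a \<partial>lborel)) * indicator ?Q z \<partial>lborel)"
    by (intro nn_integral_cong) (simp only: distrib_left distrib_right mult_ac)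
  also have "\<dots> = ennreal (2 * r) * ennreal (r\<^sup>2) * (\<integral>\<^sup>+z\<in>?Q. A (Im z) \<partial>lborel) + ennreal (2 * r) * (ennreal r * (\<integral>\<^sup>+a\<in>{x0..<x0+r}. B a \<partial>lborel)) * emeasure lborel ?Q"
    by (subst nn_integral_add) (auto simp: nn_integral_cmult)
  also have "\<dots> = ennreal (2 * r) * ennreal (r\<^sup>2) * (ennreal r * (\<integral>\<^sup>+b\<in>{y0..<y0+r}. A b \<partial>lborel)) + ennreal (2 * r) * (ennreal r * (\<integral>\<^sup>+a\<in>{x0..<x0+r}. B a \<partial>lborel)) * ennreal (r\<^sup>2)"
    using r by (simp add: emeasure_square nn_integral_square_Re)
  also have "\<dots> = ennreal (2 * r ^ 4) * ((\<integral>\<^sup>+b\<in>{y0..<y0+r}. A b \<partial>lborel) + (\<integral>\<^sup>+a\<in>{x0..<x0+r}. B a \<partial>lborel))"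
  proof -
    have "ennreal (2 * r ^ 4) = ennreal (2 * r) * ennreal (r\<^sup>2) * ennreal r"
      using r by (simp add: ennreal_mult[symmetric] power2_eq_square power4_eq_xxxx mult_ac)
    then show ?thesis by (simp add: distrib_left mult_ac)
  qed
  also have "(\<integral>\<^sup>+b\<in>{y0..<y0+r}. A b \<partial>lborel) = (\<integral>\<^sup>+z\<in>?Q. ennreal ((X z)\<^sup>2) \<partial>lborel)"
    unfolding A_def by (rule nn_integral_square(1)[symmetric]) measurable
  also have "(\<integral>\<^sup>+a\<in>{x0..<x0+r}. B a \<partial>lborel) = (\<integral>\<^sup>+z\<in>?Q. ennreal ((Y z)\<^sup>2) \<partial>lborel)"
    unfolding B_def by (rule nn_integral_square(2)[symmetric]) measurable
  also have "(\<integral>\<^sup>+z\<in>?Q. ennreal ((X z)\<^sup>2) \<partial>lborel) + (\<integral>\<^sup>+z\<in>?Q. ennreal ((Y z)\<^sup>2) \<partial>lborel)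
     = (\<integral>\<^sup>+z\<in>?Q. ennreal ((X z)\<^sup>2 + (Y z)\<^sup>2) \<partial>lborel)"
    by (subst nn_integral_add[symmetric]) (auto simp: distrib_right[symmetric])
  finally show ?thesis .
qed

text \<open>
  Average \<open>h(z)\<^sup>2 \<le> 2 (h(z) - h(w))\<^sup>2 + 2 h(w)\<^sup>2\<close> over
  \<open>z\<close> in the square and \<open>w\<close> in \<open>E\<close>: the first term is controlled
  by the Poincare inequality, the second by \<open>V\<close>, which is at least \<open>v\<close> on
  \<open>E\<close>.
\<close>

lemma Fefferman_Phong_square:
  fixes h V X Y :: "complex \<Rightarrow> real"
  assumes [measurable]: "h \<in> borel_measurable borel" "X \<in> borel_measurable borel" "Y \<in> borel_measurable borel" "V \<in> borel_measurable borel"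
    and X0: "\<And>z. 0 \<le> X z" and Y0: "\<And>z. 0 \<le> Y z" and V0: "\<And>z. 0 \<le> V z" and r: "r \<ge> 0"
    and X: "\<And>a b y. a \<le> b \<Longrightarrow> ennreal (norm (h (Complex b y) - h (Complex a y))) \<le> (\<integral>\<^sup>+s\<in>{a..b}. ennreal (X (Complex s y)) \<partial>lborel)"
    and Y: "\<And>a b x. a \<le> b \<Longrightarrow> ennreal (norm (h (Complex x b) - h (Complex x a))) \<le> (\<integral>\<^sup>+t\<in>{a..b}. ennreal (Y (Complex x t)) \<partial>lborel)"
    and E[measurable]: "E \<in> sets borel" and EQ: "E \<subseteq> square x0 y0 r" and v: "v > 0" and Ev: "\<And>z. z \<in> E \<Longrightarrow> v \<le> V z"
  shows "emeasure lborel E * (\<integral>\<^sup>+z\<in>square x0 y0 r. ennreal ((h z)\<^sup>2) \<partial>lborel)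
     \<le> ennreal (4 * r ^ 4) * (\<integral>\<^sup>+z\<in>square x0 y0 r. ennreal ((X z)\<^sup>2 + (Y z)\<^sup>2) \<partial>lborel)
      + ennreal (2 * r\<^sup>2 / v) * (\<integral>\<^sup>+z\<in>square x0 y0 r. ennreal (V z * (h z)\<^sup>2) \<partial>lborel)"
proof -
  let ?Q = "square x0 y0 r"
  have "emeasure lborel E * (\<integral>\<^sup>+z\<in>?Q. ennreal ((h z)\<^sup>2) \<partial>lborel) = (\<integral>\<^sup>+z\<in>?Q. (\<integral>\<^sup>+w\<in>E. ennreal ((h z)\<^sup>2) \<partial>lborel) \<partial>lborel)"
  proof -
    have "(\<integral>\<^sup>+w\<in>E. ennreal ((h z)\<^sup>2) \<partial>lborel) * indicator ?Q z = emeasure lborel E * (ennreal ((h z)\<^sup>2) * indicator ?Q z)" for z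
      by (subst nn_integral_cmult_indicator) (simp_all add: mult_ac)
    then show ?thesis by (simp add: nn_integral_cmult)
  qed
  also have "\<dots> \<le> (\<integral>\<^sup>+z\<in>?Q. (\<integral>\<^sup>+w. 2 * (ennreal ((norm (h z - h w))\<^sup>2) * indicator ?Q w) + ennreal (2 / v) * (ennreal (V w * (h w)\<^sup>2) * indicator ?Q w) \<partial>lborel) \<partial>lborel)"
  proof (intro nn_integral_mono mult_right_mono)
    fix z w
    show "ennreal ((h z)\<^sup>2) * indicator E w
       \<le> 2 * (ennreal ((norm (h z - h w))\<^sup>2) * indicator ?Q w) + ennreal (2 / v) * (ennreal (V w * (h w)\<^sup>2) * indicator ?Q w)"
    proof (cases "w \<in> E")
      case True
      have "(h z)\<^sup>2 \<le> 2 * (h z - h w)\<^sup>2 + 2 * (h w)\<^sup>2"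
        using zero_le_power2[of "h z - 2 * h w"] by (simp add: power2_eq_square algebra_simps)
      also have "2 * (h w)\<^sup>2 \<le> 2 / v * (V w * (h w)\<^sup>2)"
        using mult_right_mono[OF Ev[OF True], of "(h w)\<^sup>2"] v by (simp add: field_simps)
      finally have "ennreal ((h z)\<^sup>2) \<le> ennreal (2 * (h z - h w)\<^sup>2 + 2 / v * (V w * (h w)\<^sup>2))"
        by (rule ennreal_leI) simp
      also have "\<dots> = 2 * ennreal ((norm (h z - h w))\<^sup>2) + ennreal (2 / v) * ennreal (V w * (h w)\<^sup>2)"
      proof -
        have "ennreal (2 * (h z - h w)\<^sup>2) = 2 * ennreal ((norm (h z - h w))\<^sup>2)"
          by (simp add: ennreal_mult)
        moreover have "ennreal (2 / v * (V w * (h w)\<^sup>2)) = ennreal (2 / v) * ennreal (V w * (h w)\<^sup>2)"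
          using v V0[of w] by (intro ennreal_mult) auto
        moreover have "ennreal (2 * (h z - h w)\<^sup>2 + 2 / v * (V w * (h w)\<^sup>2)) = ennreal (2 * (h z - h w)\<^sup>2) + ennreal (2 / v * (V w * (h w)\<^sup>2))"
          using v V0[of w] by (intro ennreal_plus) auto
        ultimately show ?thesis by simp
      qed
      finally show ?thesis using True EQ by (auto simp: indicator_def)
    qed simp
  qed simp
  also have "\<dots> = (\<integral>\<^sup>+z\<in>?Q. 2 * (\<integral>\<^sup>+w\<in>?Q. ennreal ((norm (h z - h w))\<^sup>2) \<partial>lborel) + ennreal (2 / v) * (\<integral>\<^sup>+w\<in>?Q. ennreal (V w * (h w)\<^sup>2) \<partial>lborel) \<partial>lborel)"
    by (subst nn_integral_add) (auto simp: nn_integral_cmult)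
  also have "\<dots> = (\<integral>\<^sup>+z. 2 * ((\<integral>\<^sup>+w\<in>?Q. ennreal ((norm (h z - h w))\<^sup>2) \<partial>lborel) * indicator ?Q z) + ennreal (2 / v) * (\<integral>\<^sup>+w\<in>?Q. ennreal (V w * (h w)\<^sup>2) \<partial>lborel) * indicator ?Q z \<partial>lborel)"
    by (intro nn_integral_cong) (simp only: distrib_left distrib_right mult_ac)
  also have "\<dots> = 2 * (\<integral>\<^sup>+z\<in>?Q. (\<integral>\<^sup>+w\<in>?Q. ennreal ((norm (h z - h w))\<^sup>2) \<partial>lborel) \<partial>lborel) + ennreal (2 / v) * (\<integral>\<^sup>+w\<in>?Q. ennreal (V w * (h w)\<^sup>2) \<partial>lborel) * emeasure lborel ?Q"
    by (subst nn_integral_add) (auto simp: nn_integral_cmult)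
  also have "\<dots> \<le> 2 * (ennreal (2 * r ^ 4) * (\<integral>\<^sup>+z\<in>?Q. ennreal ((X z)\<^sup>2 + (Y z)\<^sup>2) \<partial>lborel)) + ennreal (2 / v) * (\<integral>\<^sup>+w\<in>?Q. ennreal (V w * (h w)\<^sup>2) \<partial>lborel) * emeasure lborel ?Q"
    by (intro add_mono mult_left_mono Poincare_square X0 Y0 X Y r) auto
  also have "\<dots> = ennreal (4 * r ^ 4) * (\<integral>\<^sup>+z\<in>?Q. ennreal ((X z)\<^sup>2 + (Y z)\<^sup>2) \<partial>lborel)
      + ennreal (2 * r\<^sup>2 / v) * (\<integral>\<^sup>+z\<in>?Q. ennreal (V z * (h z)\<^sup>2) \<partial>lborel)"
  proof -
    have "ennreal (4 * r ^ 4) = 2 * ennreal (2 * r ^ 4)"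
      using r by (simp add: ennreal_mult[symmetric] flip: ennreal_numeral)
    moreover have "ennreal (2 * r\<^sup>2 / v) = ennreal (2 / v) * ennreal (r\<^sup>2)"
      using v by (simp add: ennreal_mult[symmetric])
    ultimately show ?thesis using r by (simp add: emeasure_square mult_ac)
  qed
  finally show ?thesis .
qed

text \<open>
  Multiplication by the unimodular function \<open>exp (i p)\<close>, where \<open>p\<close> is an
  antiderivative of \<open>q\<close>, turns the covariant derivative into an ordinary one and leaves
  \<open>|g|\<close> unchanged.
\<close>

lemma norm_increment_gauge:
  fixes g :: "real \<Rightarrow> complex" and q :: "real \<Rightarrow> real"
  assumes ab: "a \<le> b" and g: "\<And>s. (g has_vector_derivative g' s) (at s within {a..b})"
    and c: "continuous_on {a..b} g" "continuous_on {a..b} g'" "continuous_on {a..b} q"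
  shows "ennreal (norm (norm (g b) - norm (g a))) \<le> (\<integral>\<^sup>+s\<in>{a..b}. ennreal (norm (g' s + \<i> * of_real (q s) * g s)) \<partial>lborel)"
proof -
  obtain p where p: "\<And>s. s \<in> {a..b} \<Longrightarrow> (p has_vector_derivative q s) (at s within {a..b})"
    using antiderivative_continuous[OF c(3)] by blast
  let ?e = "\<lambda>s. exp (\<i> * of_real (p s))"
  have cp: "continuous_on {a..b} p"
    using p by (rule continuous_on_vector_derivative)
  have d: "((\<lambda>s. g s * ?e s) has_vector_derivative (g' s + \<i> * of_real (q s) * g s) * ?e s) (at s within {a..b})"
    if "s \<in> {a..b}" for s
  proof -
    have "((\<lambda>s. \<i> * of_real (p s)) has_vector_derivative \<i> * of_real (q s)) (at s within {a..b})"
      using p[OF that] by (intro has_vector_derivative_mult_right has_vector_derivative_of_real)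
        (simp add: has_real_derivative_iff_has_vector_derivative)
    moreover have "(exp has_field_derivative ?e s) (at (\<i> * of_real (p s)) within (\<lambda>s. \<i> * of_real (p s)) ` {a..b})"
      by (rule has_field_derivative_at_within) (rule DERIV_exp)
    ultimately have "(?e has_vector_derivative \<i> * of_real (q s) * ?e s) (at s within {a..b})"
      using field_vector_diff_chain_within[of "\<lambda>s. \<i> * of_real (p s)" "\<i> * of_real (q s)" s "{a..b}" exp "?e s"]
      by (simp add: o_def)
    from has_vector_derivative_mult[OF g this] show ?thesis
      by (simp add: algebra_simps)
  qed
  have "norm (norm (g b) - norm (g a)) \<le> norm (g b * ?e b - g a * ?e a)"
    using norm_triangle_ineq3[of "g b * ?e b" "g a * ?e a"] by (simp add: norm_mult)
  then have "ennreal (norm (norm (g b) - norm (g a))) \<le> ennreal (norm (g b * ?e b - g a * ?e a))"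
    by (rule ennreal_leI)
  also have "\<dots> \<le> (\<integral>\<^sup>+s\<in>{a..b}. ennreal (norm ((g' s + \<i> * of_real (q s) * g s) * ?e s)) \<partial>lborel)"
    by (rule norm_increment_le_nn_integral[OF ab d]) (auto intro!: continuous_intros c cp)
  finally show ?thesis by (simp add: norm_mult)
qed

lemma diamagnetic:
  assumes \<phi>: "Ck 2 \<phi>" and \<psi>: "Ck 2 \<psi>" and "a \<le> b"
  defines "h \<equiv> \<lambda>z. norm (\<psi> z * of_real (exp (\<phi> z)))"
  shows "ennreal (norm (h (Complex b y) - h (Complex a y))) \<le> (\<integral>\<^sup>+s\<in>{a..b}. ennreal (norm (cov_dx \<phi> \<psi> (Complex s y))) \<partial>lborel)"
    and "ennreal (norm (h (Complex x b) - h (Complex x a))) \<le> (\<integral>\<^sup>+t\<in>{a..b}. ennreal (norm (cov_dy \<phi> \<psi> (Complex x t))) \<partial>lborel)"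
proof -
  let ?g = "\<lambda>z. \<psi> z * of_real (exp (\<phi> z))"
  have E: "Ck 2 (\<lambda>z. complex_of_real (exp (\<phi> z)))"
    by (rule Ck_bounded_linear[OF bounded_linear_of_real Ck_exp[OF \<phi>]])
  have g2: "Ck 2 ?g"
    by (intro Ck_mult \<psi> E)
  have g1: "Ck 1 ?g" "Ck 1 \<phi>" using g2 \<phi> by (auto intro: Ck_2_imp_1 simp del: One_nat_def)
  have d: "\<phi> differentiable (at z)" "\<psi> differentiable (at z)" "?g differentiable (at z)" "(\<lambda>z. exp (\<phi> z)) differentiable (at z)" "(\<lambda>z. complex_of_real (exp (\<phi> z))) differentiable (at z)" for z
    using Ck_differentiable[OF \<phi>] Ck_differentiable[OF \<psi>] Ck_differentiable[OF g2] Ck_differentiable[OF E] Ck_differentiable[OF Ck_exp[OF \<phi>]] by auto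
  have dg: "dx ?g z = (dx \<psi> z + \<psi> z * of_real (dx \<phi> z)) * of_real (exp (\<phi> z))" "dy ?g z = (dy \<psi> z + \<psi> z * of_real (dy \<phi> z)) * of_real (exp (\<phi> z))" for z
    unfolding dx_mult[OF d(2) d(5)] dx_bounded_linear[OF bounded_linear_of_real d(4)] dx_exp[OF d(1)] by (simp_all add: algebra_simps)
  have cov: "cov_dx \<phi> \<psi> z = dx ?g z + \<i> * of_real (- dy \<phi> z) * ?g z" "cov_dy \<phi> \<psi> z = dy ?g z + \<i> * of_real (dx \<phi> z) * ?g z" for z
    unfolding cov_dx_def cov_dy_def dg by (simp_all add: Complex_eq_plus algebra_simps)
  have c: "continuous_on UNIV ?g" "continuous_on UNIV (dx ?g)" "continuous_on UNIV (dy ?g)" "continuous_on UNIV (dx \<phi>)" "continuous_on UNIV (dy \<phi>)"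
    using g1 Ck_imp_continuous[OF g2] by auto
  have cc: "continuous_on S (\<lambda>s. k (Complex s y))" "continuous_on S (\<lambda>s. k (Complex x s))"
    if "continuous_on UNIV k" for k :: "complex \<Rightarrow> 'b::topological_space" and S x y
    by (rule continuous_on_compose2[OF that]; auto intro!: continuous_intros)+
  show "ennreal (norm (h (Complex b y) - h (Complex a y))) \<le> (\<integral>\<^sup>+s\<in>{a..b}. ennreal (norm (cov_dx \<phi> \<psi> (Complex s y))) \<partial>lborel)"
    unfolding h_def cov
    by (rule norm_increment_gauge[OF \<open>a \<le> b\<close> has_vector_derivative_horizontal[OF d(3)]])
       (intro continuous_on_minus cc c)+
  show "ennreal (norm (h (Complex x b) - h (Complex x a))) \<le> (\<integral>\<^sup>+t\<in>{a..b}. ennreal (norm (cov_dy \<phi> \<psi> (Complex x t))) \<partial>lborel)"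
    unfolding h_def cov
    by (rule norm_increment_gauge[OF \<open>a \<le> b\<close> has_vector_derivative_vertical[OF d(3)]])
       (intro cc c)+
qed

lemma square_floor:
  assumes "r > 0"
  shows "z \<in> square (r * of_int i) (r * of_int j) r \<longleftrightarrow> i = \<lfloor>Re z / r\<rfloor> \<and> j = \<lfloor>Im z / r\<rfloor>"
proof -
  have "k = \<lfloor>u / r\<rfloor> \<longleftrightarrow> r * of_int k \<le> u \<and> u < r * of_int k + r" for u k
    using assms by (subst eq_commute) (simp add: floor_eq_iff field_simps)
  then show ?thesis by (auto simp: square_def)
qed

definition grid_cell :: "real \<Rightarrow> int \<times> int \<Rightarrow> complex set" where
  "grid_cell r p = square (r * of_int (fst p)) (r * of_int (snd p)) r"

lemma grid_cell_borel [measurable]: "grid_cell r p \<in> sets borel"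
  by (simp add: grid_cell_def)

text \<open>
  Integrals over cells are values of the measures with densities \<open>F\<close> and \<open>G\<close>,
  so countable additivity sums the local inequalities.
\<close>

lemma nn_integral_grid_mono:
  fixes F G :: "complex \<Rightarrow> ennreal"
  assumes [measurable]: "F \<in> borel_measurable borel" "G \<in> borel_measurable borel" and r: "r > 0"
    and le: "\<And>p. p \<in> I \<Longrightarrow> (\<integral>\<^sup>+z\<in>grid_cell r p. F z \<partial>lborel) \<le> (\<integral>\<^sup>+z\<in>grid_cell r p. G z \<partial>lborel)"
  shows "(\<integral>\<^sup>+z\<in>(\<Union>p\<in>I. grid_cell r p). F z \<partial>lborel) \<le> (\<integral>\<^sup>+z\<in>(\<Union>p\<in>I. grid_cell r p). G z \<partial>lborel)"
proof -
  have dis: "disjoint_family_on (grid_cell r) I"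
    using r by (auto simp: disjoint_family_on_def grid_cell_def square_floor prod_eq_iff)
  have cnt: "countable I" by (rule countable_subset[OF subset_UNIV]) simp
  have m: "(\<Union>p\<in>I. grid_cell r p) \<in> sets borel"
    by (rule sets.countable_UN'[OF cnt]) auto
  have "(\<integral>\<^sup>+z\<in>(\<Union>p\<in>I. grid_cell r p). F z \<partial>lborel) = emeasure (density lborel F) (\<Union>p\<in>I. grid_cell r p)"
    using m by (simp add: emeasure_density)
  also have "\<dots> = (\<integral>\<^sup>+p. emeasure (density lborel F) (grid_cell r p) \<partial>count_space I)"
    by (rule emeasure_UN_countable) (auto simp: dis cnt)
  also have "\<dots> \<le> (\<integral>\<^sup>+p. emeasure (density lborel G) (grid_cell r p) \<partial>count_space I)"
    by (rule nn_integral_mono) (simp add: emeasure_density le)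
  also have "\<dots> = emeasure (density lborel G) (\<Union>p\<in>I. grid_cell r p)"
    by (rule emeasure_UN_countable[symmetric]) (auto simp: dis cnt)
  also have "\<dots> = (\<integral>\<^sup>+z\<in>(\<Union>p\<in>I. grid_cell r p). G z \<partial>lborel)"
    using m by (simp add: emeasure_density)
  finally show ?thesis .
qed

section \<open>Consequences of the reverse Holder inequality\<close>

lemma nn_integral_set_eq:
  fixes u :: "'a \<Rightarrow> real"
  assumes "set_integrable M A u" "\<And>w. 0 \<le> u w"
  shows "(\<integral>\<^sup>+w\<in>A. ennreal (u w) \<partial>M) = ennreal (LINT w:A|M. u w)"
proof -
  have "(\<integral>\<^sup>+w\<in>A. ennreal (u w) \<partial>M) = (\<integral>\<^sup>+w. ennreal (indicator A w *\<^sub>R u w) \<partial>M)"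
    by (intro nn_integral_cong) (simp add: indicator_def)
  also have "\<dots> = ennreal (LINT w:A|M. u w)"
    using assms unfolding set_integrable_def set_lebesgue_integral_def
    by (intro nn_integral_eq_integral) auto
  finally show ?thesis .
qed

lemma set_integrable_continuous_bounded:
  fixes f :: "complex \<Rightarrow> 'b::{banach, second_countable_topology}"
  assumes c: "continuous_on UNIV f" and A: "A \<in> sets borel" "bounded A"
  shows "set_integrable lborel A f"
proof -
  obtain R where "A \<subseteq> ball 0 R"
    using bounded_subset_ballD[OF A(2)] by blast
  then have R: "A \<subseteq> cball 0 R" using ball_subset_cball by blast
  have "set_integrable lborel (cball 0 R) f"
    unfolding set_integrable_def by (rule borel_integrable_compact) (auto intro: continuous_on_subset[OF c])
  then show ?thesis
    by (rule set_integrable_subset) (use A R in auto)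
qed

lemma set_integral_lebesgue_eq:
  fixes f :: "complex \<Rightarrow> 'b::{banach, second_countable_topology}"
  assumes "f \<in> borel_measurable borel" "A \<in> sets borel"
  shows "(LINT z:A|lebesgue. f z) = (LINT z:A|lborel. f z)"
proof -
  have "(\<lambda>z. indicator A z *\<^sub>R f z) \<in> borel_measurable borel" using assms by measurable
  then show ?thesis unfolding set_lebesgue_integral_def by (intro integral_completion) simp
qed

lemma integral_lebesgue_eq:
  fixes f :: "complex \<Rightarrow> 'b::{banach, second_countable_topology}"
  assumes "f \<in> borel_measurable borel"
  shows "(LINT z|lebesgue. f z) = (LINT z|lborel. f z)"
  using assms by (intro integral_completion) simp

lemma area_ball: "r \<ge> 0 \<Longrightarrow> measure lborel (ball (a::complex) r) = pi * r\<^sup>2"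
  using content_ball[of r a] by (simp add: unit_ball_vol_2)

locale holder_weight =
  fixes \<phi> :: "complex \<Rightarrow> real"
  assumes \<phi>: "Ck 2 \<phi>" and rh: "laplacian \<phi> \<in> reverse_Holder_2"
begin

abbreviation V :: "complex \<Rightarrow> real" where "V \<equiv> laplacian \<phi>"

abbreviation weighted :: "(complex \<Rightarrow> complex) \<Rightarrow> complex \<Rightarrow> complex" where
  "weighted \<psi> z \<equiv> \<psi> z * of_real (exp (\<phi> z))"

abbreviation sq_int :: "complex set \<Rightarrow> (complex \<Rightarrow> complex) \<Rightarrow> ennreal" where
  "sq_int A \<psi> \<equiv> (\<integral>\<^sup>+z\<in>A. ennreal ((norm (weighted \<psi> z))\<^sup>2) \<partial>lborel)"

abbreviation total_sq :: "(complex \<Rightarrow> complex) \<Rightarrow> ennreal" where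
  "total_sq \<psi> \<equiv> (\<integral>\<^sup>+z. ennreal ((norm (weighted \<psi> z))\<^sup>2) \<partial>lborel)"

abbreviation energy :: "complex set \<Rightarrow> (complex \<Rightarrow> complex) \<Rightarrow> ennreal" where
  "energy A \<psi> \<equiv> (\<integral>\<^sup>+z\<in>A. ennreal (energy_density \<phi> \<psi> z) \<partial>lborel)"

abbreviation total_energy :: "(complex \<Rightarrow> complex) \<Rightarrow> ennreal" where
  "total_energy \<psi> \<equiv> (\<integral>\<^sup>+z. ennreal (energy_density \<phi> \<psi> z) \<partial>lborel)"

abbreviation cell_integral :: "real \<Rightarrow> int \<times> int \<Rightarrow> (complex \<Rightarrow> complex) \<Rightarrow> complex" where
  "cell_integral r p \<psi> \<equiv> (LINT z:grid_cell r p|lborel. weighted \<psi> z)"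

definition mass :: "complex \<Rightarrow> real \<Rightarrow> real" where
  "mass a r = (LINT y:ball a r|lebesgue. V y)"

lemma continuous_V: "continuous_on UNIV V"
  by (rule continuous_laplacian[OF \<phi>])

lemma V_borel [measurable]: "V \<in> borel_measurable borel"
  by (rule continuous_borel[OF continuous_V])

lemma V_nonneg: "0 \<le> V z"
  using rh by (simp add: reverse_Holder_2_def)

lemma mass_lborel: "mass a r = (LINT y:ball a r|lborel. V y)"
  unfolding mass_def by (rule set_integral_lebesgue_eq) auto

lemma V_set_integrable: "A \<in> sets borel \<Longrightarrow> bounded A \<Longrightarrow> set_integrable lborel A V"
  by (rule set_integrable_continuous_bounded[OF continuous_V])

lemma V_sq_set_integrable: "A \<in> sets borel \<Longrightarrow> bounded A \<Longrightarrow> set_integrable lborel A (\<lambda>z. (V z)\<^sup>2)"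
  by (rule set_integrable_continuous_bounded) (auto intro!: continuous_intros continuous_V)

lemma mass_nonneg: "0 \<le> mass a r"
  unfolding mass_lborel set_lebesgue_integral_def by (rule Bochner_Integration.integral_nonneg) (simp add: V_nonneg)

lemma mass_mono: "r \<le> s \<Longrightarrow> mass a r \<le> mass a s"
  unfolding mass_lborel set_lebesgue_integral_def
  using V_set_integrable[of "ball a r"] V_set_integrable[of "ball a s"]
  by (intro integral_mono) (auto simp: set_integrable_def indicator_def V_nonneg)

lemma mass_pos: assumes "r > 0" shows "mass a r > 0"
proof (rule ccontr)
  assume "\<not> mass a r > 0"
  then have 0: "mass a r = 0" using mass_nonneg[of a r] by simp
  have "AE z in lborel. indicator (ball a r) z *\<^sub>R V z = 0"
    using 0 V_set_integrable[of "ball a r"] unfolding mass_lborel set_lebesgue_integral_def set_integrable_def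
    by (subst (asm) integral_nonneg_eq_0_iff_AE) (auto simp: V_nonneg)
  moreover have "AE z in lborel. V z \<noteq> 0"
    using rh by (simp add: reverse_Holder_2_def AE_completion_iff)
  ultimately have "AE z in lborel. z \<notin> ball a r"
    by eventually_elim (simp add: indicator_def split: if_splits)
  then have "emeasure lborel (ball a r) = 0"
    by (subst (asm) AE_iff_measurable[of "ball a r"]) auto
  then have "measure lborel (ball a r) = 0" by (simp add: measure_def)
  then show False using area_ball[of r a] assms by simp
qed

lemma reverse_Holder:
  obtains C where "C \<ge> 1" "\<And>a r. r > 0 \<Longrightarrow> (LINT z:ball a r|lborel. (V z)\<^sup>2) \<le> C\<^sup>2 * (mass a r)\<^sup>2 / (pi * r\<^sup>2)"
proof -
  obtain C where C: "C > 0" "\<And>a r. r > 0 \<Longrightarrow>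
        sqrt ((1 / measure lebesgue (ball a r)) * (LINT z:ball a r|lebesgue. (V z)\<^sup>2))
          \<le> C * ((1 / measure lebesgue (ball a r)) * (LINT z:ball a r|lebesgue. V z))"
    using rh unfolding reverse_Holder_2_def by blast
  have "(LINT z:ball a r|lborel. (V z)\<^sup>2) \<le> (max C 1)\<^sup>2 * (mass a r)\<^sup>2 / (pi * r\<^sup>2)" if r: "r > 0" for a r
  proof -
    let ?b = "pi * r\<^sup>2" and ?I = "(LINT z:ball a r|lborel. (V z)\<^sup>2)"
    have b: "?b > 0" using r by simp
    have I: "?I = (LINT z:ball a r|lebesgue. (V z)\<^sup>2)"
      by (rule set_integral_lebesgue_eq[symmetric]) auto
    have "measure lebesgue (ball a r) = ?b"
      using area_ball[of r a] r by (simp add: measure_completion)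
    then have "sqrt (?I / ?b) \<le> C * (mass a r / ?b)"
      using C(2)[OF r, of a] unfolding I mass_def by simp
    also have "\<dots> \<le> max C 1 * (mass a r / ?b)"
      using b mass_nonneg[of a r] by (intro mult_right_mono) auto
    finally have "sqrt (?I / ?b) \<le> max C 1 * (mass a r / ?b)" .
    moreover have "0 \<le> sqrt (?I / ?b)"
      using b by (auto simp: set_lebesgue_integral_def intro!: Bochner_Integration.integral_nonneg divide_nonneg_pos)
    ultimately have "(sqrt (?I / ?b))\<^sup>2 \<le> (max C 1 * (mass a r / ?b))\<^sup>2"
      by (rule power_mono)
    moreover have "?I / ?b \<ge> 0"
      using b by (auto simp: set_lebesgue_integral_def intro!: Bochner_Integration.integral_nonneg divide_nonneg_pos)
    ultimately have "?I / ?b \<le> (max C 1 * (mass a r / ?b))\<^sup>2"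
      by simp
    then have "?I \<le> (max C 1 * (mass a r / ?b))\<^sup>2 * ?b"
      using b by (simp add: pos_divide_le_eq)
    also have "\<dots> = (max C 1)\<^sup>2 * (mass a r)\<^sup>2 / ?b"
      using b by (simp add: field_simps power2_eq_square)
    finally show ?thesis .
  qed
  then show thesis by (intro that[of "max C 1"]) auto
qed

text \<open>
  Combined with the reverse Holder inequality this says that \<open>V\<close> has little mass on a
  subset of small area of a ball.
\<close>

lemma V_Cauchy_Schwarz:
  assumes E[measurable]: "E \<in> sets borel" and EB: "E \<subseteq> ball a r"
  shows "(LINT z:E|lborel. V z)\<^sup>2 \<le> measure lborel E * (LINT z:ball a r|lborel. (V z)\<^sup>2)"
proof -
  have [measurable]: "ball a r \<in> sets borel" by simp
  have bE: "bounded E" using EB bounded_subset bounded_ball by blast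
  have fin: "emeasure lborel E < \<infinity>" using bE by (rule emeasure_bounded_finite)
  let ?I = "LINT z:E|lborel. V z" and ?J = "LINT z:ball a r|lborel. (V z)\<^sup>2"
  have nn: "0 \<le> ?I" "0 \<le> ?J"
    by (auto simp: set_lebesgue_integral_def V_nonneg intro!: Bochner_Integration.integral_nonneg)
  have "ennreal ?I = (\<integral>\<^sup>+z. (ennreal (V z) * indicator (ball a r) z) * indicator E z \<partial>lborel)"
    using EB by (subst nn_integral_set_eq[OF V_set_integrable[OF E bE] V_nonneg, symmetric])
      (auto intro!: nn_integral_cong simp: indicator_def)
  then have "(ennreal ?I)\<^sup>2 \<le> (\<integral>\<^sup>+z. (ennreal (V z) * indicator (ball a r) z)\<^sup>2 \<partial>lborel) * (\<integral>\<^sup>+z. (indicator E z)\<^sup>2 \<partial>lborel)"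
    by (simp only:) (rule Cauchy_Schwarz_nn_integral; measurable)
  also have "(\<integral>\<^sup>+z. (indicator E z)\<^sup>2 \<partial>lborel) = (\<integral>\<^sup>+z. indicator E z \<partial>lborel)"
    by (intro nn_integral_cong) (simp add: indicator_def)
  also have "\<dots> = ennreal (measure lborel E)"
    using fin by (simp add: emeasure_eq_ennreal_measure)
  also have "(\<integral>\<^sup>+z. (ennreal (V z) * indicator (ball a r) z)\<^sup>2 \<partial>lborel) = (\<integral>\<^sup>+z\<in>ball a r. ennreal ((V z)\<^sup>2) \<partial>lborel)"
    by (intro nn_integral_cong) (simp add: indicator_def ennreal_power V_nonneg)
  also have "\<dots> = ennreal ?J"
    by (rule nn_integral_set_eq[OF V_sq_set_integrable]) auto
  finally have "ennreal (?I\<^sup>2) \<le> ennreal (?J * measure lborel E)"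
    using nn by (simp add: ennreal_power ennreal_mult)
  then show ?thesis
    using nn by (simp add: ennreal_le_iff mult.commute)
qed

text \<open>
  The part of the ball where \<open>V\<close> is below half its mean carries at most half of the mass.
  The other half sits on the remaining set, which by Cauchy-Schwarz and the reverse Holder inequality
  cannot be too small.
\<close>

lemma V_large_on_large_set:
  obtains C where "C > 0" "\<And>a r. r > 0 \<Longrightarrow> r\<^sup>2 / C \<le> measure lborel {z \<in> ball a r. mass a r / (2 * pi * r\<^sup>2) \<le> V z}"
proof -
  obtain C where C: "C \<ge> 1" "\<And>a r. r > 0 \<Longrightarrow> (LINT z:ball a r|lborel. (V z)\<^sup>2) \<le> C\<^sup>2 * (mass a r)\<^sup>2 / (pi * r\<^sup>2)"
    using reverse_Holder by blast
  have "r\<^sup>2 / (4 * C\<^sup>2 / pi) \<le> measure lborel {z \<in> ball a r. mass a r / (2 * pi * r\<^sup>2) \<le> V z}" if r: "r > 0" for a r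
  proof -
    \<comment> \<open>half the mean of \<open>V\<close> over the ball\<close>
    let ?t = "mass a r / (2 * pi * r\<^sup>2)"
    define E where "E = {z \<in> ball a r. ?t \<le> V z}"
    define F where "F = {z \<in> ball a r. V z < ?t}"
    have [measurable]: "E \<in> sets borel" "F \<in> sets borel"
      unfolding E_def F_def by measurable
    have b: "bounded E" "bounded F"
      by (rule bounded_subset[OF bounded_ball[of a r]], auto simp: E_def F_def)+
    have "mass a r = (LINT z:E \<union> F|lborel. V z)"
      unfolding mass_lborel by (rule arg_cong[where f="\<lambda>S. LINT z:S|lborel. V z"]) (auto simp: E_def F_def)
    also have "\<dots> = (LINT z:E|lborel. V z) + (LINT z:F|lborel. V z)"
    proof (rule set_integral_Un)
      show "E \<inter> F = {}" by (auto simp: E_def F_def)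
    qed (intro V_set_integrable b; measurable)+
    also have "(LINT z:F|lborel. V z) \<le> (LINT z:ball a r|lborel. ?t)"
      unfolding set_lebesgue_integral_def
    proof (rule integral_mono)
      show "integrable lborel (\<lambda>z. indicat_real F z *\<^sub>R V z)"
        using V_set_integrable[OF _ b(2)] by (simp add: set_integrable_def)
      show "integrable lborel (\<lambda>z. indicat_real (ball a r) z *\<^sub>R ?t)"
        using set_integrable_continuous_bounded[of "\<lambda>_. ?t" "ball a r"] by (simp add: set_integrable_def)
      show "indicat_real F z *\<^sub>R V z \<le> indicat_real (ball a r) z *\<^sub>R ?t" for z
        using mass_nonneg[of a r] by (auto simp: indicator_def F_def)
    qed
    also have "\<dots> = mass a r / 2"
      using r area_ball[of r a] by (simp add: set_lebesgue_integral_def)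
    finally have "mass a r / 2 \<le> (LINT z:E|lborel. V z)" by simp
    then have "(mass a r / 2)\<^sup>2 \<le> (LINT z:E|lborel. V z)\<^sup>2"
      using mass_nonneg[of a r] by (intro power_mono) auto
    also have "\<dots> \<le> measure lborel E * (LINT z:ball a r|lborel. (V z)\<^sup>2)"
      by (rule V_Cauchy_Schwarz) (auto simp: E_def)
    also have "\<dots> \<le> measure lborel E * (C\<^sup>2 * (mass a r)\<^sup>2 / (pi * r\<^sup>2))"
      by (intro mult_left_mono C r) simp
    finally have "(mass a r)\<^sup>2 * (1/4) \<le> (mass a r)\<^sup>2 * (measure lborel E * (C\<^sup>2 / (pi * r\<^sup>2)))"
      by (simp add: field_simps power2_eq_square)
    then have "1/4 \<le> measure lborel E * (C\<^sup>2 / (pi * r\<^sup>2))"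
      by (rule mult_left_le_imp_le) (use mass_pos[OF r, of a] in simp)
    then show ?thesis
      using r C(1) unfolding E_def by (simp add: field_simps)
  qed
  moreover have "4 * C\<^sup>2 / pi > 0" using C(1) by simp
  ultimately show thesis by (intro that)
qed

text \<open>
  Removing a thin outer annulus from a ball costs at most half of the mass, by Cauchy-Schwarz and the
  reverse Holder inequality. Iterating this shrinks the radius below any given \<open>\<rho>\<close> at
  the cost of a constant factor.
\<close>

lemma mass_doubling:
  assumes "\<rho> > 0"
  obtains c where "c > 0" "\<And>a. c * mass a 1 \<le> mass a \<rho>"
proof -
  obtain C where C: "C \<ge> 1" "\<And>a r. r > 0 \<Longrightarrow> (LINT z:ball a r|lborel. (V z)\<^sup>2) \<le> C\<^sup>2 * (mass a r)\<^sup>2 / (pi * r\<^sup>2)"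
    using reverse_Holder by blast
  \<comment> \<open>the annulus between the radii \<open>k r\<close> and \<open>r\<close> has relative area \<open>1 / (4 C\<^sup>2)\<close>\<close>
  define k where "k = sqrt (1 - 1 / (4 * C\<^sup>2))"
  have C2: "C\<^sup>2 \<ge> 1" using C(1) by simp
  have k2: "k\<^sup>2 = 1 - 1 / (4 * C\<^sup>2)"
    unfolding k_def using C2 by (intro real_sqrt_pow2) (simp add: divide_le_eq)
  have k: "0 < k" "k < 1"
    using C2 by (auto simp: k_def divide_less_eq)
  have step: "mass a r / 2 \<le> mass a (k * r)" if r: "r > 0" for a r
  proof -
    define E where "E = ball a r - ball a (k * r)"
    have [measurable]: "E \<in> sets borel" unfolding E_def by measurable
    have sub: "ball a (k * r) \<subseteq> ball a r"
      using k r by (intro subset_ball) simp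
    have b: "bounded E" by (rule bounded_subset[OF bounded_ball[of a r]]) (auto simp: E_def)
    have "mass a r = (LINT z:E \<union> ball a (k * r)|lborel. V z)"
      unfolding mass_lborel using sub by (intro arg_cong[where f="\<lambda>S. LINT z:S|lborel. V z"]) (auto simp: E_def)
    also have "\<dots> = (LINT z:E|lborel. V z) + mass a (k * r)"
      unfolding mass_lborel by (rule set_integral_Un) (auto simp: E_def intro: V_set_integrable[OF _ b[unfolded E_def]] V_set_integrable)
    finally have split: "mass a r = (LINT z:E|lborel. V z) + mass a (k * r)" .
    have "measure lborel E = pi * r\<^sup>2 - pi * (k * r)\<^sup>2"
      unfolding E_def using sub r k
      using emeasure_bounded_finite[OF bounded_ball[of a r]]
      by (subst measure_Diff) (auto simp: area_ball)
    also have "\<dots> = pi * r\<^sup>2 / (4 * C\<^sup>2)"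
      by (simp add: power_mult_distrib k2 algebra_simps)
    finally have mE: "measure lborel E = pi * r\<^sup>2 / (4 * C\<^sup>2)" .
    have "(LINT z:E|lborel. V z)\<^sup>2 \<le> measure lborel E * (LINT z:ball a r|lborel. (V z)\<^sup>2)"
      by (rule V_Cauchy_Schwarz) (auto simp: E_def)
    also have "\<dots> \<le> measure lborel E * (C\<^sup>2 * (mass a r)\<^sup>2 / (pi * r\<^sup>2))"
      by (intro mult_left_mono C r) simp
    also have "\<dots> = (mass a r / 2)\<^sup>2"
      unfolding mE using r C(1) by (simp add: field_simps power2_eq_square)
    finally have "(LINT z:E|lborel. V z) \<le> mass a r / 2"
      by (rule power2_le_imp_le) (simp add: mass_nonneg)
    with split show ?thesis by linarith
  qed
  have iter: "(1/2) ^ n * mass a 1 \<le> mass a (k ^ n)" for n a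
  proof (induction n)
    case (Suc n)
    then show ?case
      using step[of "k ^ n" a] k by simp
  qed simp
  obtain n where n: "k ^ n < \<rho>"
    using real_arch_pow_inv[OF assms k(2)] by blast
  have "(1/2) ^ n * mass a 1 \<le> mass a \<rho>" for a
    using iter[of n a] mass_mono[of "k ^ n" \<rho> a] n by simp
  then show thesis by (intro that[of "(1/2) ^ n"]) auto
qed

text \<open>
  The Fefferman-Phong inequality with \<open>h = |\<psi> e\<^sup>\<phi>|\<close> and with
  \<open>E\<close> the part of the inscribed disc on which \<open>V\<close> is at least half its mean.
  For fixed \<open>m\<close> the constant tends to \<open>0\<close> with \<open>r\<close>.
\<close>

lemma cell_bound:
  obtains K where "K > 0"
    "\<And>r x y m \<psi>. r > 0 \<Longrightarrow> m > 0 \<Longrightarrow> m \<le> mass (Complex (x + r/2) (y + r/2)) (r/2) \<Longrightarrow> Ck 2 \<psi> \<Longrightarrow>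
      sq_int (square x y r) \<psi>
       \<le> ennreal (K * r\<^sup>2 * (1 + 1 / m)) * energy (square x y r) \<psi>"
proof -
  obtain C where C: "C > 0" "\<And>a r. r > 0 \<Longrightarrow> r\<^sup>2 / C \<le> measure lborel {z \<in> ball a r. mass a r / (2 * pi * r\<^sup>2) \<le> V z}"
    using V_large_on_large_set by blast
  define K where "K = 4 * C * (4 + pi)"
  have K: "K > 0" using C(1) by (simp add: K_def add_pos_pos)
  have "sq_int (square x y r) \<psi>
       \<le> ennreal (K * r\<^sup>2 * (1 + 1 / m)) * energy (square x y r) \<psi>"
    if r: "r > 0" and m: "m > 0" "m \<le> mass (Complex (x + r/2) (y + r/2)) (r/2)" and \<psi>: "Ck 2 \<psi>" for r x y m \<psi>
  proof -
    let ?c = "Complex (x + r/2) (y + r/2)" and ?Q = "square x y r"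
    let ?h = "\<lambda>z. norm (weighted \<psi> z)"
    let ?X = "\<lambda>z. norm (cov_dx \<phi> \<psi> z)" and ?Y = "\<lambda>z. norm (cov_dy \<phi> \<psi> z)"
    let ?D = "\<integral>\<^sup>+z\<in>?Q. ennreal (energy_density \<phi> \<psi> z) \<partial>lborel"
    define v where "v = mass ?c (r/2) / (2 * pi * (r/2)\<^sup>2)"
    define E where "E = {z \<in> ball ?c (r/2). v \<le> V z}"
    have [measurable]: "E \<in> sets borel" unfolding E_def by measurable
    have "v > 0" using m r by (simp add: v_def)
    have bE: "bounded E" by (rule bounded_subset[OF bounded_ball[of ?c "r/2"]]) (auto simp: E_def)
    have EQ: "E \<subseteq> ?Q"
    proof
      fix z assume "z \<in> E"
      then have n: "norm (z - ?c) < r / 2" by (simp add: E_def dist_norm norm_minus_commute)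
      have "\<bar>Re z - (x + r/2)\<bar> < r / 2" "\<bar>Im z - (y + r/2)\<bar> < r / 2"
        using abs_Re_le_cmod[of "z - ?c"] abs_Im_le_cmod[of "z - ?c"] n by auto
      then show "z \<in> ?Q" unfolding square_def by (auto simp: abs_if split: if_splits)
    qed
    have cont: "continuous_on UNIV \<psi>" "continuous_on UNIV \<phi>"
      using \<psi> \<phi> by (auto intro: Ck_imp_continuous)
    have [measurable]: "?h \<in> borel_measurable borel" "?X \<in> borel_measurable borel" "?Y \<in> borel_measurable borel"
      by (intro continuous_borel continuous_intros cont continuous_energy_density[OF \<phi> \<psi>])+
    have V0: "\<And>z. 0 \<le> V z" by (rule V_nonneg)
    have "ennreal ((r/2)\<^sup>2 / C) * (\<integral>\<^sup>+z\<in>?Q. ennreal ((?h z)\<^sup>2) \<partial>lborel) \<le> emeasure lborel E * (\<integral>\<^sup>+z\<in>?Q. ennreal ((?h z)\<^sup>2) \<partial>lborel)"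
    proof (rule mult_right_mono)
      have "ennreal ((r/2)\<^sup>2 / C) \<le> ennreal (measure lborel E)"
        unfolding E_def v_def using r by (intro ennreal_leI C(2)) simp
      also have "\<dots> = emeasure lborel E"
        using emeasure_bounded_finite[OF bE] by (simp add: emeasure_eq_ennreal_measure)
      finally show "ennreal ((r/2)\<^sup>2 / C) \<le> emeasure lborel E" .
    qed simp
    also have "\<dots> \<le> ennreal (4 * r ^ 4) * (\<integral>\<^sup>+z\<in>?Q. ennreal ((?X z)\<^sup>2 + (?Y z)\<^sup>2) \<partial>lborel)
      + ennreal (2 * r\<^sup>2 / v) * (\<integral>\<^sup>+z\<in>?Q. ennreal (V z * (?h z)\<^sup>2) \<partial>lborel)"
      by (rule Fefferman_Phong_square[OF _ _ _ _ _ _ V0 _ diamagnetic(1)[OF \<phi> \<psi>] diamagnetic(2)[OF \<phi> \<psi>] _ EQ \<open>v > 0\<close>])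
         (use r in \<open>auto simp: E_def\<close>)
    also have "\<dots> \<le> ennreal (4 * r ^ 4) * ?D + ennreal (2 * r\<^sup>2 / v) * ?D"
      by (intro add_mono mult_left_mono nn_integral_mono mult_right_mono ennreal_leI)
         (auto simp: energy_density_def V_nonneg)
    also have "\<dots> = ennreal (4 * r ^ 4 + 2 * r\<^sup>2 / v) * ?D"
      using \<open>v > 0\<close> by (subst ennreal_plus) (auto simp: distrib_right)
    finally have main: "ennreal ((r/2)\<^sup>2 / C) * (\<integral>\<^sup>+z\<in>?Q. ennreal ((?h z)\<^sup>2) \<partial>lborel) \<le> ennreal (4 * r ^ 4 + 2 * r\<^sup>2 / v) * ?D" .
    have "(\<integral>\<^sup>+z\<in>?Q. ennreal ((?h z)\<^sup>2) \<partial>lborel) = ennreal (4 * C / r\<^sup>2) * (ennreal ((r/2)\<^sup>2 / C) * (\<integral>\<^sup>+z\<in>?Q. ennreal ((?h z)\<^sup>2) \<partial>lborel))"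
    proof -
      have "ennreal (4 * C / r\<^sup>2) * ennreal ((r/2)\<^sup>2 / C) = 1"
        using r C(1) by (subst ennreal_mult[symmetric]) (auto simp: field_simps)
      then show ?thesis by (simp add: mult.assoc[symmetric])
    qed
    also have "\<dots> \<le> ennreal (4 * C / r\<^sup>2) * (ennreal (4 * r ^ 4 + 2 * r\<^sup>2 / v) * ?D)"
      by (rule mult_left_mono[OF main]) simp
    also have "\<dots> = ennreal (4 * C / r\<^sup>2 * (4 * r ^ 4 + 2 * r\<^sup>2 / v)) * ?D"
      using r C(1) \<open>v > 0\<close> by (subst ennreal_mult) (auto simp: mult.assoc)
    also have "\<dots> \<le> ennreal (K * r\<^sup>2 * (1 + 1 / m)) * ?D"
    proof (intro mult_right_mono ennreal_leI)
      have "2 * r\<^sup>2 / v = pi * r ^ 4 / mass ?c (r/2)"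
        unfolding v_def by (simp add: field_simps power2_eq_square power4_eq_xxxx)
      also have "\<dots> \<le> pi * r ^ 4 / m"
        using m r by (intro divide_left_mono) auto
      finally have "4 * C / r\<^sup>2 * (4 * r ^ 4 + 2 * r\<^sup>2 / v) \<le> 4 * C / r\<^sup>2 * (4 * r ^ 4 + pi * r ^ 4 / m)"
        using r C(1) by (intro mult_left_mono add_left_mono) auto
      also have "\<dots> = 4 * C * r\<^sup>2 * (4 + pi * (1 / m))"
        using r by (simp add: field_simps power2_eq_square power4_eq_xxxx)
      also have "\<dots> \<le> 4 * C * r\<^sup>2 * ((4 + pi) * (1 + 1 / m))"
        using C(1) m pi_gt_zero by (intro mult_left_mono) (auto simp: algebra_simps)
      finally show "4 * C / r\<^sup>2 * (4 * r ^ 4 + 2 * r\<^sup>2 / v) \<le> K * r\<^sup>2 * (1 + 1 / m)"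
        unfolding K_def by (simp only: mult_ac)
    qed simp
    finally show ?thesis .
  qed
  then show thesis using that[OF K] by blast
qed

end

section \<open>Coercivity and compactness of the energy\<close>

lemma square_bounded: "bounded (square x y r)"
proof (rule bounded_subset[OF bounded_cbox])
  show "square x y r \<subseteq> cbox (Complex x y) (Complex (x + r) (y + r))"
    by (auto simp: square_def in_cbox_complex_iff)
qed

lemma square_measure: "r \<ge> 0 \<Longrightarrow> measure lborel (square x y r) = r\<^sup>2"
  by (simp add: measure_def emeasure_square)

text \<open>
  The variance identity: expand \<open>|g(z) - g(w)|\<^sup>2\<close> and integrate over both variables.
\<close>

lemma mean_square_identity:
  fixes g :: "complex \<Rightarrow> complex"
  assumes g: "continuous_on UNIV g" and r: "r \<ge> 0"
  shows "ennreal (2 * r\<^sup>2) * (\<integral>\<^sup>+z\<in>square x y r. ennreal ((norm (g z))\<^sup>2) \<partial>lborel)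
    = (\<integral>\<^sup>+z\<in>square x y r. (\<integral>\<^sup>+w\<in>square x y r. ennreal ((norm (g z - g w))\<^sup>2) \<partial>lborel) \<partial>lborel)
      + ennreal (2 * (norm (LINT z:square x y r|lborel. g z))\<^sup>2)"
proof -
  let ?Q = "square x y r"
  note I = set_integrable_continuous_bounded[OF _ square_borel square_bounded, of _ x y r]
  define S where "S = (LINT z:?Q|lborel. (norm (g z))\<^sup>2)"
  define G where "G = (LINT z:?Q|lborel. g z)"
  have const: "(LINT w:?Q|lborel. c) = r\<^sup>2 * c" for c :: real
    using r by (simp add: set_lebesgue_integral_def square_measure)
  have i1: "set_integrable lborel ?Q (\<lambda>w. (norm (g w))\<^sup>2)" "set_integrable lborel ?Q g" "set_integrable lborel ?Q (\<lambda>w. c::real)"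
      "set_integrable lborel ?Q (\<lambda>w. 2 * (g z \<bullet> g w))" "set_integrable lborel ?Q (\<lambda>w. 2 * (g w \<bullet> c'))" for c z c'
    by (intro I continuous_intros g)+
  have lin: "(LINT w:?Q|lborel. 2 * (g w \<bullet> c)) = 2 * (G \<bullet> c)" for c
  proof -
    have "(LINT w:?Q|lborel. 2 * (g w \<bullet> c)) = 2 * (\<integral>w. (indicator ?Q w *\<^sub>R g w) \<bullet> c \<partial>lborel)"
      unfolding set_lebesgue_integral_def by (subst integral_mult_right_zero[symmetric]) (simp add: mult_ac)
    also have "\<dots> = 2 * (G \<bullet> c)"
      using i1(2) unfolding G_def set_lebesgue_integral_def set_integrable_def by (subst integral_inner_left) auto
    finally show ?thesis .
  qed
  have lin': "(LINT w:?Q|lborel. g w \<bullet> c) = G \<bullet> c" for c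
    using lin[of c] by simp
  have sq: "(norm (a - b))\<^sup>2 = (norm a)\<^sup>2 + (norm b)\<^sup>2 - 2 * (a \<bullet> b)" for a b :: complex
    unfolding power2_norm_eq_inner by (simp add: inner_diff_left inner_diff_right inner_commute)
  have inner: "(LINT w:?Q|lborel. (norm (g z - g w))\<^sup>2) = r\<^sup>2 * (norm (g z))\<^sup>2 + S - 2 * (g z \<bullet> G)" for z
  proof -
    have "(LINT w:?Q|lborel. (norm (g z - g w))\<^sup>2) = (LINT w:?Q|lborel. (norm (g z))\<^sup>2 + (norm (g w))\<^sup>2 - 2 * (g w \<bullet> g z))"
      unfolding sq by (simp only: inner_commute)
    also have "\<dots> = r\<^sup>2 * (norm (g z))\<^sup>2 + S - 2 * (G \<bullet> g z)"
      using i1 by (simp add: set_integral_diff set_integral_add const S_def lin')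
    finally show ?thesis by (simp only: inner_commute)
  qed
  have "(\<integral>\<^sup>+z\<in>?Q. (\<integral>\<^sup>+w\<in>?Q. ennreal ((norm (g z - g w))\<^sup>2) \<partial>lborel) \<partial>lborel)
     = (\<integral>\<^sup>+z\<in>?Q. ennreal (r\<^sup>2 * (norm (g z))\<^sup>2 + S - 2 * (g z \<bullet> G)) \<partial>lborel)"
    by (subst nn_integral_set_eq) (auto simp: inner intro!: I continuous_intros g)
  also have "\<dots> = ennreal (LINT z:?Q|lborel. r\<^sup>2 * (norm (g z))\<^sup>2 + S - 2 * (g z \<bullet> G))"
  proof (rule nn_integral_set_eq)
    show "0 \<le> r\<^sup>2 * (norm (g z))\<^sup>2 + S - 2 * (g z \<bullet> G)" for z
      unfolding inner[symmetric] set_lebesgue_integral_def by (intro Bochner_Integration.integral_nonneg) simp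
  qed (intro I continuous_intros g)
  also have "(LINT z:?Q|lborel. r\<^sup>2 * (norm (g z))\<^sup>2 + S - 2 * (g z \<bullet> G)) = r\<^sup>2 * S + r\<^sup>2 * S - 2 * (G \<bullet> G)"
    using i1 by (simp add: set_integral_diff set_integral_add const lin') (simp add: S_def)
  also have "\<dots> = 2 * r\<^sup>2 * S - 2 * (norm G)\<^sup>2"
    by (simp add: power2_norm_eq_inner)
  finally have eq: "(\<integral>\<^sup>+z\<in>?Q. (\<integral>\<^sup>+w\<in>?Q. ennreal ((norm (g z - g w))\<^sup>2) \<partial>lborel) \<partial>lborel) = ennreal (2 * r\<^sup>2 * S - 2 * (norm G)\<^sup>2)" .
  have nn: "0 \<le> 2 * r\<^sup>2 * S - 2 * (norm G)\<^sup>2"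
  proof -
    have "0 \<le> (LINT z:?Q|lborel. r\<^sup>2 * (norm (g z))\<^sup>2 + S - 2 * (g z \<bullet> G))"
      unfolding inner[symmetric] set_lebesgue_integral_def by (intro Bochner_Integration.integral_nonneg) auto
    also have "\<dots> = r\<^sup>2 * S + r\<^sup>2 * S - 2 * (G \<bullet> G)"
      using i1 by (simp add: set_integral_diff set_integral_add const lin') (simp add: S_def)
    also have "\<dots> = 2 * r\<^sup>2 * S - 2 * (norm G)\<^sup>2"
      by (simp add: power2_norm_eq_inner)
    finally show ?thesis .
  qed
  have S: "(\<integral>\<^sup>+z\<in>?Q. ennreal ((norm (g z))\<^sup>2) \<partial>lborel) = ennreal S" "0 \<le> S"
    unfolding S_def by (rule nn_integral_set_eq[OF i1(1)], simp)
      (auto simp: set_lebesgue_integral_def intro!: Bochner_Integration.integral_nonneg)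
  show ?thesis
    unfolding eq S(1) G_def[symmetric] using nn S(2) r
    by (simp add: ennreal_mult[symmetric] ennreal_plus[symmetric] del: ennreal_plus)
qed

text \<open>
  On a small square a function is controlled by its gradient, with a small factor, and its mean. Summed
  over a fine grid, this reduces compactness on bounded sets to finitely many numbers.
\<close>

lemma Rellich_square:
  fixes g :: "complex \<Rightarrow> complex"
  assumes g: "Ck 1 g" and r: "r > 0"
  shows "(\<integral>\<^sup>+z\<in>square x y r. ennreal ((norm (g z))\<^sup>2) \<partial>lborel)
    \<le> ennreal (r\<^sup>2) * (\<integral>\<^sup>+z\<in>square x y r. ennreal ((norm (dx g z))\<^sup>2 + (norm (dy g z))\<^sup>2) \<partial>lborel)
      + ennreal ((norm (LINT z:square x y r|lborel. g z))\<^sup>2 / r\<^sup>2)"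
proof -
  let ?Q = "square x y r"
  let ?N = "\<integral>\<^sup>+z\<in>?Q. ennreal ((norm (g z))\<^sup>2) \<partial>lborel" and ?D = "\<integral>\<^sup>+z\<in>?Q. ennreal ((norm (dx g z))\<^sup>2 + (norm (dy g z))\<^sup>2) \<partial>lborel"
  let ?G = "norm (LINT z:?Q|lborel. g z)"
  have c: "continuous_on UNIV g" "continuous_on UNIV (dx g)" "continuous_on UNIV (dy g)"
    using g Ck_imp_continuous[OF g] by auto
  have d: "g differentiable (at z)" for z
    by (rule Ck_differentiable[OF g]) simp
  have cc: "continuous_on S (\<lambda>s. k (Complex s y))" "continuous_on S (\<lambda>s. k (Complex x s))"
    if "continuous_on UNIV k" for k :: "complex \<Rightarrow> complex" and S x y
    by (rule continuous_on_compose2[OF that]; auto intro!: continuous_intros)+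
  have P: "(\<integral>\<^sup>+z\<in>?Q. (\<integral>\<^sup>+w\<in>?Q. ennreal ((norm (g z - g w))\<^sup>2) \<partial>lborel) \<partial>lborel) \<le> ennreal (2 * r ^ 4) * ?D"
  proof (rule Poincare_square[where X="\<lambda>z. norm (dx g z)" and Y="\<lambda>z. norm (dy g z)"])
    show "g \<in> borel_measurable borel" "(\<lambda>z. norm (dx g z)) \<in> borel_measurable borel" "(\<lambda>z. norm (dy g z)) \<in> borel_measurable borel"
      by (intro continuous_borel continuous_intros c)+
    show "ennreal (norm (g (Complex b y) - g (Complex a y))) \<le> (\<integral>\<^sup>+s\<in>{a..b}. ennreal (norm (dx g (Complex s y))) \<partial>lborel)" if "a \<le> b" for a b y
      by (rule norm_increment_le_nn_integral[OF that has_vector_derivative_horizontal[OF d] cc(1)[OF c(2)]])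
    show "ennreal (norm (g (Complex x b) - g (Complex x a))) \<le> (\<integral>\<^sup>+s\<in>{a..b}. ennreal (norm (dy g (Complex x s))) \<partial>lborel)" if "a \<le> b" for a b x
      by (rule norm_increment_le_nn_integral[OF that has_vector_derivative_vertical[OF d] cc(2)[OF c(3)]])
  qed (use r in auto)
  have one: "ennreal (1 / (2 * r\<^sup>2)) * ennreal (2 * r\<^sup>2) = 1"
    using r by (subst ennreal_mult[symmetric]) auto
  have "?N = ennreal (1 / (2 * r\<^sup>2)) * (ennreal (2 * r\<^sup>2) * ?N)"
    using one by (simp add: mult.assoc[symmetric])
  also have "\<dots> \<le> ennreal (1 / (2 * r\<^sup>2)) * (ennreal (2 * r ^ 4) * ?D + ennreal (2 * ?G\<^sup>2))"
    unfolding mean_square_identity[OF c(1) less_imp_le[OF r]] by (rule mult_left_mono[OF add_right_mono[OF P]]) simp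
  also have "\<dots> = ennreal (1 / (2 * r\<^sup>2) * (2 * r ^ 4)) * ?D + ennreal (1 / (2 * r\<^sup>2) * (2 * ?G\<^sup>2))"
    by (subst (3 4) ennreal_mult) (auto simp: distrib_left mult.assoc)
  also have "1 / (2 * r\<^sup>2) * (2 * r ^ 4) = r\<^sup>2"
    using r by (simp add: field_simps power2_eq_square power4_eq_xxxx)
  also have "1 / (2 * r\<^sup>2) * (2 * ?G\<^sup>2) = ?G\<^sup>2 / r\<^sup>2"
    by simp
  finally show ?thesis .
qed

lemma finite_cells:
  fixes r B :: real
  assumes "r > 0"
  shows "finite {p. \<bar>r * of_int (fst p)\<bar> \<le> B \<and> \<bar>r * of_int (snd p)\<bar> \<le> B}"
proof (rule finite_subset)
  let ?N = "\<lceil>B / r\<rceil>"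
  show "{p. \<bar>r * of_int (fst p)\<bar> \<le> B \<and> \<bar>r * of_int (snd p)\<bar> \<le> B} \<subseteq> {-?N..?N} \<times> {-?N..?N}"
  proof
    fix p assume "p \<in> {p. \<bar>r * of_int (fst p)\<bar> \<le> B \<and> \<bar>r * of_int (snd p)\<bar> \<le> B}"
    moreover have "k \<in> {-?N..?N}" if "\<bar>r * of_int k\<bar> \<le> B" for k
    proof -
      have "\<bar>of_int k\<bar> \<le> B / r"
        using that assms by (simp add: abs_mult field_simps)
      then have "of_int \<bar>k\<bar> \<le> (of_int ?N :: real)"
        by linarith
      then have "\<bar>k\<bar> \<le> ?N" by (simp only: of_int_le_iff)
      then show ?thesis by auto
    qed
    ultimately show "p \<in> {-?N..?N} \<times> {-?N..?N}" by (cases p) auto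
  qed
qed simp

definition grid_index :: "real \<Rightarrow> complex \<Rightarrow> int \<times> int" where
  "grid_index r z = (\<lfloor>Re z / r\<rfloor>, \<lfloor>Im z / r\<rfloor>)"

lemma in_grid_cell_iff: "r > 0 \<Longrightarrow> z \<in> grid_cell r p \<longleftrightarrow> p = grid_index r z"
  by (cases p) (simp add: grid_cell_def square_floor grid_index_def)

lemma dist_grid_cell:
  assumes "z \<in> square x y r" "w \<in> square x y r"
  shows "norm (z - w) \<le> 2 * r"
proof -
  have "norm (z - w) \<le> \<bar>Re (z - w)\<bar> + \<bar>Im (z - w)\<bar>" by (rule cmod_le)
  also have "\<dots> \<le> r + r" using assms by (intro add_mono) (auto simp: square_def)
  finally show ?thesis by simp
qed

lemma nn_integral_grid_sum:
  fixes F :: "complex \<Rightarrow> ennreal"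
  assumes [measurable]: "F \<in> borel_measurable borel" and r: "r > 0" and "finite I"
  shows "(\<integral>\<^sup>+z\<in>(\<Union>p\<in>I. grid_cell r p). F z \<partial>lborel) = (\<Sum>p\<in>I. \<integral>\<^sup>+z\<in>grid_cell r p. F z \<partial>lborel)"
proof -
  have dis: "disjoint_family_on (grid_cell r) I"
    using r by (auto simp: disjoint_family_on_def in_grid_cell_iff prod_eq_iff)
  have m: "(\<Union>p\<in>I. grid_cell r p) \<in> sets borel"
    using \<open>finite I\<close> by auto
  have "(\<integral>\<^sup>+z\<in>(\<Union>p\<in>I. grid_cell r p). F z \<partial>lborel) = emeasure (density lborel F) (\<Union>p\<in>I. grid_cell r p)"
    using m by (simp add: emeasure_density)
  also have "\<dots> = (\<Sum>p\<in>I. emeasure (density lborel F) (grid_cell r p))"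
    by (rule sum_emeasure[symmetric]) (auto simp: dis \<open>finite I\<close>)
  finally show ?thesis by (simp add: emeasure_density)
qed

text \<open>
  The regularity that the energy estimates need: \<open>\<psi> e\<^sup>\<phi>\<close> is then twice
  continuously differentiable.
\<close>

definition admissible :: "(complex \<Rightarrow> complex) \<Rightarrow> bool" where
  "admissible \<psi> \<longleftrightarrow> Ck 2 \<psi> \<and> bounded {z. \<psi> z \<noteq> 0}"

context holder_weight
begin

lemma continuous_\<phi>: "continuous_on UNIV \<phi>"
  using \<phi> by (rule Ck_imp_continuous)

lemma weighted_borel: "Ck 2 \<psi> \<Longrightarrow> (\<lambda>z. ennreal ((norm (weighted \<psi> z))\<^sup>2)) \<in> borel_measurable borel"
  by (intro measurable_compose[OF _ measurable_ennreal] continuous_borel continuous_intros Ck_imp_continuous[of 2] continuous_\<phi>)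

lemma energy_borel: "Ck 2 \<psi> \<Longrightarrow> (\<lambda>z. ennreal (energy_density \<phi> \<psi> z)) \<in> borel_measurable borel"
  by (intro measurable_compose[OF _ measurable_ennreal] continuous_borel continuous_energy_density \<phi>)

lemma weighted_bound_cells:
  assumes r: "r > 0" and \<psi>: "Ck 2 \<psi>" and k: "k \<ge> 0"
    and le: "\<And>p. p \<in> I \<Longrightarrow> (sq_int (grid_cell r p) \<psi>)
       \<le> ennreal k * energy (grid_cell r p) \<psi>"
  shows "sq_int (\<Union>p\<in>I. grid_cell r p) \<psi>
       \<le> ennreal k * total_energy \<psi>"
proof -
  note [measurable] = weighted_borel[OF \<psi>] energy_borel[OF \<psi>]
  have "sq_int (\<Union>p\<in>I. grid_cell r p) \<psi>
     \<le> (\<integral>\<^sup>+z\<in>(\<Union>p\<in>I. grid_cell r p). ennreal k * ennreal (energy_density \<phi> \<psi> z) \<partial>lborel)"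
  proof (rule nn_integral_grid_mono[OF _ _ r])
    show "sq_int (grid_cell r p) \<psi>
       \<le> (\<integral>\<^sup>+z\<in>grid_cell r p. ennreal k * ennreal (energy_density \<phi> \<psi> z) \<partial>lborel)" if "p \<in> I" for p
      using le[OF that] by (simp add: mult.assoc nn_integral_cmult)
  qed measurable
  also have "\<dots> \<le> (\<integral>\<^sup>+z. ennreal k * ennreal (energy_density \<phi> \<psi> z) \<partial>lborel)"
    by (intro nn_integral_mono) (simp add: indicator_def)
  finally show ?thesis by (simp add: nn_integral_cmult)
qed

definition cell_center :: "real \<Rightarrow> int \<times> int \<Rightarrow> complex" where
  "cell_center r p = Complex (r * of_int (fst p) + r/2) (r * of_int (snd p) + r/2)"

text \<open>
  The hypothesis on balls of radius \<open>1\<close> passes to balls of any fixed radius by doubling.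
\<close>

lemma mass_large:
  assumes lim: "filterlim (\<lambda>z. mass z 1) at_top at_infinity" and "\<rho> > 0"
  obtains R where "\<And>z. norm z \<ge> R \<Longrightarrow> mass z \<rho> \<ge> 1"
proof -
  obtain c where c: "c > 0" "\<And>a. c * mass a 1 \<le> mass a \<rho>"
    using mass_doubling[OF \<open>\<rho> > 0\<close>] by blast
  have "eventually (\<lambda>z. mass z 1 \<ge> 1 / c) at_infinity"
    using lim by (auto simp: filterlim_at_top)
  then obtain R where "\<And>z. norm z \<ge> R \<Longrightarrow> mass z 1 \<ge> 1 / c"
    unfolding eventually_at_infinity by blast
  then have "mass z \<rho> \<ge> 1" if "norm z \<ge> R" for z
    using c(2)[of z] mult_left_mono[of "1/c" "mass z 1" c] c(1) that by fastforce
  then show thesis by (rule that)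
qed

text \<open>
  Apply the cell bound to the unit grid. The discs inscribed in cells far out have mass at least
  \<open>1\<close>; the finitely many others have positive mass because \<open>V\<close> is almost
  everywhere positive.
\<close>

lemma global_bound:
  assumes lim: "filterlim (\<lambda>z. mass z 1) at_top at_infinity"
  obtains K where "K > 0" "\<And>\<psi>. Ck 2 \<psi> \<Longrightarrow>
      total_sq \<psi> \<le> ennreal K * total_energy \<psi>"
proof -
  obtain K where K: "K > 0"
    "\<And>r x y m \<psi>. r > 0 \<Longrightarrow> m > 0 \<Longrightarrow> m \<le> mass (Complex (x + r/2) (y + r/2)) (r/2) \<Longrightarrow> Ck 2 \<psi> \<Longrightarrow>
      sq_int (square x y r) \<psi>
       \<le> ennreal (K * r\<^sup>2 * (1 + 1 / m)) * energy (square x y r) \<psi>"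
    using cell_bound by blast
  obtain R where R: "\<And>z. norm z \<ge> R \<Longrightarrow> mass z (1/2) \<ge> 1"
    using mass_large[OF lim, of "1/2"] by auto
  define P where "P = {p. norm (cell_center 1 p) < R}"
  have "finite P"
  proof (rule finite_subset[OF _ finite_cells[of 1 "R + 1"]])
    show "P \<subseteq> {p. \<bar>1 * real_of_int (fst p)\<bar> \<le> R + 1 \<and> \<bar>1 * real_of_int (snd p)\<bar> \<le> R + 1}"
    proof
      fix p assume "p \<in> P"
      then have "norm (cell_center 1 p) < R" by (simp add: P_def)
      then have "\<bar>of_int (fst p) + 1/2\<bar> < R" "\<bar>of_int (snd p) + 1/2\<bar> < R"
        using abs_Re_le_cmod[of "cell_center 1 p"] abs_Im_le_cmod[of "cell_center 1 p"] unfolding cell_center_def by simp_all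
      then show "p \<in> {p. \<bar>1 * real_of_int (fst p)\<bar> \<le> R + 1 \<and> \<bar>1 * real_of_int (snd p)\<bar> \<le> R + 1}"
        by (simp add: abs_if split: if_splits)
    qed
  qed simp
  define m where "m = Min (insert 1 ((\<lambda>p. mass (cell_center 1 p) (1/2)) ` P))"
  have m: "m > 0"
    unfolding m_def using \<open>finite P\<close> by (subst Min_gr_iff) (auto intro: mass_pos)
  have mle: "m \<le> mass (cell_center 1 p) (1/2)" for p
  proof (cases "p \<in> P")
    case True
    then show ?thesis unfolding m_def using \<open>finite P\<close> by (intro Min_le) auto
  next
    case False
    then have "1 \<le> mass (cell_center 1 p) (1/2)" by (intro R) (simp add: P_def)
    moreover have "m \<le> 1" unfolding m_def using \<open>finite P\<close> by (intro Min_le) auto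
    ultimately show ?thesis by simp
  qed
  define k where "k = K * 1\<^sup>2 * (1 + 1 / m)"
  have "k > 0" using K(1) m by (simp add: k_def add_pos_pos)
  have "total_sq \<psi> \<le> ennreal k * total_energy \<psi>"
    if \<psi>: "Ck 2 \<psi>" for \<psi>
  proof -
    have "(\<Union>p. grid_cell 1 p) = UNIV"
      by (auto simp: in_grid_cell_iff)
    moreover have "sq_int (\<Union>p\<in>UNIV. grid_cell 1 p) \<psi> \<le> ennreal k * total_energy \<psi>"
    proof (rule weighted_bound_cells[OF _ \<psi>])
      fix p
      show "sq_int (grid_cell 1 p) \<psi> \<le> ennreal k * energy (grid_cell 1 p) \<psi>"
        unfolding grid_cell_def k_def
        by (rule K(2)[OF _ m _ \<psi>]) (use mle[of p] in \<open>simp_all add: cell_center_def\<close>)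
    qed (use \<open>k > 0\<close> in auto)
    ultimately show ?thesis by simp
  qed
  then show thesis using that[OF \<open>k > 0\<close>] by blast
qed

text \<open>
  Far out the disc inscribed in a cell of side \<open>r\<close> has mass at least \<open>1\<close>, so
  the constant in the cell bound is a multiple of \<open>r\<^sup>2\<close>, and \<open>r\<close> is
  free.
\<close>

lemma tail_bound:
  assumes lim: "filterlim (\<lambda>z. mass z 1) at_top at_infinity" and e: "\<epsilon> > 0"
  obtains R where "\<And>\<psi>. Ck 2 \<psi> \<Longrightarrow>
      sq_int (- ball 0 R) \<psi> \<le> ennreal \<epsilon> * total_energy \<psi>"
proof -
  obtain K where K: "K > 0"
    "\<And>r x y m \<psi>. r > 0 \<Longrightarrow> m > 0 \<Longrightarrow> m \<le> mass (Complex (x + r/2) (y + r/2)) (r/2) \<Longrightarrow> Ck 2 \<psi> \<Longrightarrow>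
      sq_int (square x y r) \<psi>
       \<le> ennreal (K * r\<^sup>2 * (1 + 1 / m)) * energy (square x y r) \<psi>"
    using cell_bound by blast
  \<comment> \<open>makes the constant of the cell bound with \<open>m = 1\<close> equal to \<open>\<epsilon>\<close>\<close>
  define r where "r = sqrt (\<epsilon> / (2 * K))"
  have r: "r > 0" "K * r\<^sup>2 * (1 + 1 / 1) = \<epsilon>"
    using e K(1) by (auto simp: r_def)
  obtain R where R: "\<And>z. norm z \<ge> R \<Longrightarrow> mass z (r/2) \<ge> 1"
    using mass_large[OF lim, of "r/2"] r by auto
  define I where "I = {p. norm (cell_center r p) \<ge> R}"
  have "(sq_int (- ball 0 (R + 2 * r)) \<psi>) \<le> ennreal \<epsilon> * total_energy \<psi>"
    if \<psi>: "Ck 2 \<psi>" for \<psi>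
  proof -
    have sub: "- ball 0 (R + 2 * r) \<subseteq> (\<Union>p\<in>I. grid_cell r p)"
    proof
      fix z :: complex assume z: "z \<in> - ball 0 (R + 2 * r)"
      have zc: "z \<in> grid_cell r (grid_index r z)"
        using r by (simp add: in_grid_cell_iff)
      have "cell_center r (grid_index r z) \<in> grid_cell r (grid_index r z)"
        using r unfolding grid_cell_def cell_center_def by (simp add: square_def)
      then have "norm (z - cell_center r (grid_index r z)) \<le> 2 * r"
        using zc unfolding grid_cell_def by (intro dist_grid_cell)
      then have "norm (cell_center r (grid_index r z)) \<ge> R"
        using z norm_triangle_ineq2[of z "cell_center r (grid_index r z)"] by simp
      then show "z \<in> (\<Union>p\<in>I. grid_cell r p)"
        using zc unfolding I_def by blast
    qed
    have "(sq_int (- ball 0 (R + 2 * r)) \<psi>)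
        \<le> sq_int (\<Union>p\<in>I. grid_cell r p) \<psi>"
      by (intro nn_integral_mono mult_left_mono) (use sub in \<open>auto simp: indicator_def\<close>)
    also have "\<dots> \<le> ennreal \<epsilon> * total_energy \<psi>"
    proof (rule weighted_bound_cells[OF r(1) \<psi>])
      fix p assume "p \<in> I"
      then have "1 \<le> mass (cell_center r p) (r/2)" by (intro R) (simp add: I_def)
      then show "sq_int (grid_cell r p) \<psi> \<le> ennreal \<epsilon> * energy (grid_cell r p) \<psi>"
        unfolding grid_cell_def r(2)[symmetric]
        by (intro K(2) r \<psi>) (simp_all add: cell_center_def)
    qed (use e in auto)
    finally show ?thesis .
  qed
  then show thesis by (rule that)
qed

lemma weighted_derivative:
  assumes \<psi>: "Ck 2 \<psi>"
  shows "Ck 1 (weighted \<psi>)" "dx (weighted \<psi>) z = cov_dx \<phi> \<psi> z + \<i> * of_real (dy \<phi> z) * weighted \<psi> z"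
    "dy (weighted \<psi>) z = cov_dy \<phi> \<psi> z - \<i> * of_real (dx \<phi> z) * weighted \<psi> z"
proof -
  have E: "Ck 2 (\<lambda>z. complex_of_real (exp (\<phi> z)))"
    by (rule Ck_bounded_linear[OF bounded_linear_of_real Ck_exp[OF \<phi>]])
  show "Ck 1 (weighted \<psi>)"
    by (rule Ck_2_imp_1) (intro Ck_mult \<psi> E)
  have d: "\<phi> differentiable (at z)" "\<psi> differentiable (at z)" "(\<lambda>z. exp (\<phi> z)) differentiable (at z)" "(\<lambda>z. complex_of_real (exp (\<phi> z))) differentiable (at z)" for z
    using Ck_differentiable[OF \<phi>] Ck_differentiable[OF \<psi>] Ck_differentiable[OF E] Ck_differentiable[OF Ck_exp[OF \<phi>]] by auto
  show "dx (weighted \<psi>) z = cov_dx \<phi> \<psi> z + \<i> * of_real (dy \<phi> z) * weighted \<psi> z"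
    "dy (weighted \<psi>) z = cov_dy \<phi> \<psi> z - \<i> * of_real (dx \<phi> z) * weighted \<psi> z"
    unfolding dx_mult[OF d(2) d(4)] dx_bounded_linear[OF bounded_linear_of_real d(3)] dx_exp[OF d(1)] cov_dx_def cov_dy_def
    by (simp_all add: Complex_eq_plus algebra_simps)
qed

text \<open>
  On a bounded set the magnetic potential is bounded, so the ordinary gradient of \<open>\<psi>
  e\<^sup>\<phi>\<close> is controlled by the energy and the \<open>L\<^sup>2\<close>-norm; the latter
  is controlled by the energy through the assumed global bound.
\<close>

lemma local_bound:
  assumes K1: "K1 > 0" "\<And>\<psi>. Ck 2 \<psi> \<Longrightarrow>
      total_sq \<psi> \<le> ennreal K1 * total_energy \<psi>"
    and e: "\<epsilon> > 0"
  obtains r I where "r > 0" "finite I" "\<And>\<psi>. Ck 2 \<psi> \<Longrightarrow>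
      sq_int (ball 0 R) \<psi>
      \<le> ennreal \<epsilon> * total_energy \<psi>
        + ennreal ((\<Sum>p\<in>I. (norm (cell_integral r p \<psi>))\<^sup>2) / r\<^sup>2)"
proof -
  have "bounded (dx \<phi> ` cball 0 (R + 2))" "bounded (dy \<phi> ` cball 0 (R + 2))"
    using \<phi>[unfolded Ck_2] Ck_imp_continuous[of 1 "dx \<phi>"] Ck_imp_continuous[of 1 "dy \<phi>"]
    by (auto intro!: compact_imp_bounded compact_continuous_image intro: continuous_on_subset simp del: Ck.simps One_nat_def)
  then obtain M1 M2 where M12: "\<forall>x\<in>dx \<phi> ` cball 0 (R + 2). norm x \<le> M1" "\<forall>x\<in>dy \<phi> ` cball 0 (R + 2). norm x \<le> M2"
    unfolding bounded_iff by blast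
  define M where "M = max 0 (max M1 M2)"
  have M: "\<bar>dx \<phi> z\<bar> \<le> M" "\<bar>dy \<phi> z\<bar> \<le> M" if "z \<in> cball 0 (R + 2)" for z
    using that M12 by (force simp: M_def)+
  \<comment> \<open>\<open>M\<close> bounds the magnetic potential on all cells that meet the disc; \<open>k\<close> bounds the squared gradient by the energy\<close>
  define k where "k = 2 + 4 * M\<^sup>2 * K1"
  have k: "k > 0" using K1(1) by (simp add: k_def add_pos_nonneg)
  define r where "r = min 1 (sqrt (\<epsilon> / k))"
  have r: "r > 0" "r \<le> 1" using e k by (auto simp: r_def)
  have rk: "r\<^sup>2 * k \<le> \<epsilon>"
  proof -
    have "r\<^sup>2 \<le> (sqrt (\<epsilon> / k))\<^sup>2" using r by (intro power_mono) (auto simp: r_def)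
    then show ?thesis using e k by (simp add: pos_le_divide_eq)
  qed
  define I where "I = grid_index r ` ball 0 R"
  have "finite I"
  proof (rule finite_subset[OF _ finite_cells[OF r(1), of "R + 1"]])
    show "I \<subseteq> {p. \<bar>r * of_int (fst p)\<bar> \<le> R + 1 \<and> \<bar>r * of_int (snd p)\<bar> \<le> R + 1}"
    proof
      fix p assume "p \<in> I"
      then obtain z where z: "norm z < R" "p = grid_index r z" by (auto simp: I_def)
      then have "z \<in> grid_cell r p" using r by (simp add: in_grid_cell_iff)
      then show "p \<in> {p. \<bar>r * of_int (fst p)\<bar> \<le> R + 1 \<and> \<bar>r * of_int (snd p)\<bar> \<le> R + 1}"
        using abs_Re_le_cmod[of z] abs_Im_le_cmod[of z] z(1) r
        unfolding grid_cell_def square_def by (auto simp: abs_le_iff)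
    qed
  qed
  have "sq_int (ball 0 R) \<psi>
      \<le> ennreal \<epsilon> * total_energy \<psi>
        + ennreal ((\<Sum>p\<in>I. (norm (cell_integral r p \<psi>))\<^sup>2) / r\<^sup>2)"
    if \<psi>: "Ck 2 \<psi>" for \<psi>
  proof -
    note [measurable] = weighted_borel[OF \<psi>] energy_borel[OF \<psi>]
    let ?W = "\<lambda>z. ennreal ((norm (weighted \<psi> z))\<^sup>2)" and ?E = "\<lambda>z. ennreal (energy_density \<phi> \<psi> z)"
    let ?G = "\<lambda>z. ennreal ((norm (dx (weighted \<psi>) z))\<^sup>2 + (norm (dy (weighted \<psi>) z))\<^sup>2)"
    let ?c = "\<lambda>p. (norm (cell_integral r p \<psi>))\<^sup>2"
    let ?U = "\<Union>p\<in>I. grid_cell r p"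
    have cw: "continuous_on UNIV (dx (weighted \<psi>))" "continuous_on UNIV (dy (weighted \<psi>))"
      using weighted_derivative(1)[OF \<psi>] by auto
    have [measurable]: "?G \<in> borel_measurable borel"
      by (intro measurable_compose[OF _ measurable_ennreal] continuous_borel continuous_intros cw)
    have sq: "(norm (a + \<i> * of_real t * b))\<^sup>2 \<le> 2 * (norm a)\<^sup>2 + 2 * M\<^sup>2 * (norm b)\<^sup>2" if "\<bar>t\<bar> \<le> M" for a b t
    proof -
      have "norm (a + \<i> * of_real t * b) \<le> norm a + \<bar>t\<bar> * norm b"
        using norm_triangle_ineq[of a "\<i> * of_real t * b"] by (simp add: norm_mult)
      also have "\<dots> \<le> norm a + M * norm b" using that by (intro add_left_mono mult_right_mono) auto
      finally have "(norm (a + \<i> * of_real t * b))\<^sup>2 \<le> (norm a + M * norm b)\<^sup>2" by (rule power_mono) simp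
      also have "\<dots> \<le> 2 * (norm a)\<^sup>2 + 2 * (M * norm b)\<^sup>2"
        using sum_squares_bound[of "norm a" "M * norm b"] by (simp add: power2_sum)
      finally show ?thesis by (simp add: power_mult_distrib)
    qed
    have G: "?G z \<le> 2 * ?E z + ennreal (4 * M\<^sup>2) * ?W z" if zU: "z \<in> ?U" for z
    proof -
      obtain w where w: "norm w < R" "z \<in> grid_cell r (grid_index r w)"
        using zU by (auto simp: I_def)
      moreover have "w \<in> grid_cell r (grid_index r w)" using r by (simp add: in_grid_cell_iff)
      ultimately have "norm (z - w) \<le> 2 * r" unfolding grid_cell_def by (intro dist_grid_cell)
      then have z: "z \<in> cball 0 (R + 2)"
        using w(1) r norm_triangle_ineq2[of z w] by simp
      have "(norm (dx (weighted \<psi>) z))\<^sup>2 \<le> 2 * (norm (cov_dx \<phi> \<psi> z))\<^sup>2 + 2 * M\<^sup>2 * (norm (weighted \<psi> z))\<^sup>2"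
        unfolding weighted_derivative(2)[OF \<psi>] by (rule sq) (rule M(2)[OF z])
      moreover have "(norm (dy (weighted \<psi>) z))\<^sup>2 \<le> 2 * (norm (cov_dy \<phi> \<psi> z))\<^sup>2 + 2 * M\<^sup>2 * (norm (weighted \<psi> z))\<^sup>2"
        unfolding weighted_derivative(3)[OF \<psi>] using sq[of "- dx \<phi> z" "cov_dy \<phi> \<psi> z" "weighted \<psi> z"] M(1)[OF z] by simp
      moreover have "0 \<le> V z * (norm (weighted \<psi> z))\<^sup>2" using V_nonneg by simp
      ultimately have "(norm (dx (weighted \<psi>) z))\<^sup>2 + (norm (dy (weighted \<psi>) z))\<^sup>2 \<le> 2 * energy_density \<phi> \<psi> z + 4 * M\<^sup>2 * (norm (weighted \<psi> z))\<^sup>2"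
        unfolding energy_density_def by simp
      then have "?G z \<le> ennreal (2 * energy_density \<phi> \<psi> z + 4 * M\<^sup>2 * (norm (weighted \<psi> z))\<^sup>2)"
        by (rule ennreal_leI)
      also have "\<dots> = 2 * ?E z + ennreal (4 * M\<^sup>2) * ?W z"
        using V_nonneg by (subst ennreal_plus) (auto simp: energy_density_def ennreal_mult')
      finally show ?thesis .
    qed
    have "(\<integral>\<^sup>+z\<in>ball 0 R. ?W z \<partial>lborel) \<le> (\<integral>\<^sup>+z\<in>?U. ?W z \<partial>lborel)"
    proof (intro nn_integral_mono mult_left_mono)
      have "ball 0 R \<subseteq> ?U" using r by (auto simp: I_def in_grid_cell_iff)
      then show "indicator (ball 0 R) z \<le> (indicator ?U z :: ennreal)" for z
        by (auto simp: indicator_def)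
    qed simp
    also have "\<dots> = (\<Sum>p\<in>I. \<integral>\<^sup>+z\<in>grid_cell r p. ?W z \<partial>lborel)"
      by (rule nn_integral_grid_sum[OF _ r(1) \<open>finite I\<close>]) measurable
    also have "\<dots> \<le> (\<Sum>p\<in>I. ennreal (r\<^sup>2) * (\<integral>\<^sup>+z\<in>grid_cell r p. ?G z \<partial>lborel) + ennreal (?c p / r\<^sup>2))"
      unfolding grid_cell_def by (intro sum_mono Rellich_square weighted_derivative(1) \<psi> r)
    also have "\<dots> = ennreal (r\<^sup>2) * (\<integral>\<^sup>+z\<in>?U. ?G z \<partial>lborel) + ennreal ((\<Sum>p\<in>I. ?c p) / r\<^sup>2)"
    proof -
      have "(\<integral>\<^sup>+z\<in>?U. ?G z \<partial>lborel) = (\<Sum>p\<in>I. \<integral>\<^sup>+z\<in>grid_cell r p. ?G z \<partial>lborel)"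
        by (rule nn_integral_grid_sum[OF _ r(1) \<open>finite I\<close>]) measurable
      moreover have "(\<Sum>p\<in>I. ennreal (?c p / r\<^sup>2)) = ennreal ((\<Sum>p\<in>I. ?c p) / r\<^sup>2)"
        by (simp add: sum_divide_distrib)
      ultimately show ?thesis by (simp only: sum.distrib sum_distrib_left)
    qed
    also have "(\<integral>\<^sup>+z\<in>?U. ?G z \<partial>lborel) \<le> (\<integral>\<^sup>+z. 2 * ?E z + ennreal (4 * M\<^sup>2) * ?W z \<partial>lborel)"
      by (intro nn_integral_mono) (use G in \<open>auto simp: indicator_def\<close>)
    also have "\<dots> = (\<integral>\<^sup>+z. 2 * ?E z \<partial>lborel) + (\<integral>\<^sup>+z. ennreal (4 * M\<^sup>2) * ?W z \<partial>lborel)"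
      by (rule nn_integral_add) measurable
    also have "(\<integral>\<^sup>+z. 2 * ?E z \<partial>lborel) = 2 * (\<integral>\<^sup>+z. ?E z \<partial>lborel)"
      by (rule nn_integral_cmult) measurable
    also have "(\<integral>\<^sup>+z. ennreal (4 * M\<^sup>2) * ?W z \<partial>lborel) = ennreal (4 * M\<^sup>2) * (\<integral>\<^sup>+z. ?W z \<partial>lborel)"
      by (rule nn_integral_cmult) measurable
    also have "2 * (\<integral>\<^sup>+z. ?E z \<partial>lborel) + ennreal (4 * M\<^sup>2) * (\<integral>\<^sup>+z. ?W z \<partial>lborel) \<le> 2 * (\<integral>\<^sup>+z. ?E z \<partial>lborel) + ennreal (4 * M\<^sup>2) * (ennreal K1 * (\<integral>\<^sup>+z. ?E z \<partial>lborel))"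
      by (intro add_left_mono mult_left_mono K1 \<psi>) simp
    also have "\<dots> = ennreal k * (\<integral>\<^sup>+z. ?E z \<partial>lborel)"
      using K1(1) by (simp add: k_def ennreal_mult distrib_right mult.assoc)
    finally have "(\<integral>\<^sup>+z\<in>ball 0 R. ?W z \<partial>lborel) \<le> ennreal (r\<^sup>2) * (ennreal k * (\<integral>\<^sup>+z. ?E z \<partial>lborel)) + ennreal ((\<Sum>p\<in>I. ?c p) / r\<^sup>2)"
      by (simp add: add_right_mono mult_left_mono)
    also have "ennreal (r\<^sup>2) * (ennreal k * (\<integral>\<^sup>+z. ?E z \<partial>lborel)) = ennreal (r\<^sup>2 * k) * (\<integral>\<^sup>+z. ?E z \<partial>lborel)"
      using k by (simp add: ennreal_mult mult.assoc)
    also have "\<dots> \<le> ennreal \<epsilon> * (\<integral>\<^sup>+z. ?E z \<partial>lborel)"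
      by (intro mult_right_mono ennreal_leI rk) simp
    finally show ?thesis by (simp add: add_right_mono)
  qed
  then show thesis using that[OF r(1) \<open>finite I\<close>] by blast
qed

end

section \<open>The weighted space as a Hilbert space\<close>

definition L2_ip :: "(complex \<Rightarrow> real) \<Rightarrow> (complex \<Rightarrow> complex) \<Rightarrow> (complex \<Rightarrow> complex) \<Rightarrow> complex" where
  "L2_ip \<phi> f g = (LINT z|lebesgue. f z * cnj (g z) * of_real (exp (- 2 * \<phi> z)))"

definition L2_class :: "(complex \<Rightarrow> real) \<Rightarrow> (complex \<Rightarrow> complex) \<Rightarrow> (complex \<Rightarrow> complex) set" where
  "L2_class \<phi> f = L2_rel \<phi> `` {f}"

lemma L2_fun_measurable: "f \<in> L2_fun \<phi> \<Longrightarrow> f \<in> borel_measurable lebesgue"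
  by (simp add: L2_fun_def)

lemma L2_fun_scale: "f \<in> L2_fun \<phi> \<Longrightarrow> (\<lambda>z. c * f z) \<in> L2_fun \<phi>"
  by (auto simp: L2_fun_def norm_mult power_mult_distrib mult.assoc)

lemma L2_norm_scale: "L2_norm \<phi> (\<lambda>z. c * f z) = norm c * L2_norm \<phi> f"
  by (simp add: L2_norm_def norm_mult power_mult_distrib mult.assoc real_sqrt_mult)

lemma L2_norm_minus_commute: "L2_norm \<phi> (\<lambda>z. f z - g z) = L2_norm \<phi> (\<lambda>z. g z - f z)"
  by (simp add: L2_norm_def norm_minus_commute)

locale measurable_weight =
  fixes \<phi> :: "complex \<Rightarrow> real"
  assumes \<phi>_lebesgue [measurable]: "\<phi> \<in> borel_measurable lebesgue"
begin

lemmas L2_add = L2_fun_add[OF \<phi>_lebesgue]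
  and L2_diff = L2_fun_diff[OF \<phi>_lebesgue]
  and L2_triangle = L2_norm_triangle[OF \<phi>_lebesgue]

lemma L2_ip_integrable:
  assumes f: "f \<in> L2_fun \<phi>" and g: "g \<in> L2_fun \<phi>"
  shows "integrable lebesgue (\<lambda>z. f z * cnj (g z) * of_real (exp (- 2 * \<phi> z)))"
proof (rule Bochner_Integration.integrable_bound)
  have [measurable]: "f \<in> borel_measurable lebesgue" "g \<in> borel_measurable lebesgue"
    using f g by (auto simp: L2_fun_def)
  show "integrable lebesgue (\<lambda>z. (norm (f z))\<^sup>2 * exp (- 2 * \<phi> z) + (norm (g z))\<^sup>2 * exp (- 2 * \<phi> z))"
    using f g by (auto simp: L2_fun_def)
  have [measurable]: "(\<lambda>z. cnj (g z)) \<in> borel_measurable lebesgue"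
    by (rule borel_measurable_continuous_on[where f=cnj]) (auto intro: continuous_intros)
  show "(\<lambda>z. f z * cnj (g z) * of_real (exp (- 2 * \<phi> z))) \<in> borel_measurable lebesgue"
    by measurable
  have "norm (f z * cnj (g z) * of_real (exp (- 2 * \<phi> z)))
      \<le> norm ((norm (f z))\<^sup>2 * exp (- 2 * \<phi> z) + (norm (g z))\<^sup>2 * exp (- 2 * \<phi> z))" for z
  proof -
    have "norm (f z) * norm (g z) \<le> (norm (f z))\<^sup>2 + (norm (g z))\<^sup>2"
      using sum_squares_bound[of "norm (f z)" "norm (g z)"] mult_nonneg_nonneg[OF norm_ge_zero norm_ge_zero, of "f z" "g z"]
      by linarith
    from mult_right_mono[OF this, of "exp (- 2 * \<phi> z)"] show ?thesis
      by (simp add: norm_mult distrib_right)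
  qed
  then show "AE z in lebesgue. norm (f z * cnj (g z) * of_real (exp (- 2 * \<phi> z)))
      \<le> norm ((norm (f z))\<^sup>2 * exp (- 2 * \<phi> z) + (norm (g z))\<^sup>2 * exp (- 2 * \<phi> z))"
    by simp
qed

lemma L2_ip_add_left:
  "f \<in> L2_fun \<phi> \<Longrightarrow> g \<in> L2_fun \<phi> \<Longrightarrow> h \<in> L2_fun \<phi> \<Longrightarrow> L2_ip \<phi> (\<lambda>z. f z + g z) h = L2_ip \<phi> f h + L2_ip \<phi> g h"
  unfolding L2_ip_def using Bochner_Integration.integral_add[OF L2_ip_integrable[of f h] L2_ip_integrable[of g h]]
  by (simp add: distrib_right)

lemma L2_ip_diff_left:
  "f \<in> L2_fun \<phi> \<Longrightarrow> g \<in> L2_fun \<phi> \<Longrightarrow> h \<in> L2_fun \<phi> \<Longrightarrow> L2_ip \<phi> (\<lambda>z. f z - g z) h = L2_ip \<phi> f h - L2_ip \<phi> g h"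
  unfolding L2_ip_def using Bochner_Integration.integral_diff[OF L2_ip_integrable[of f h] L2_ip_integrable[of g h]]
  by (simp add: left_diff_distrib)

lemma L2_ip_scale_left: "L2_ip \<phi> (\<lambda>z. c * f z) h = c * L2_ip \<phi> f h"
  unfolding L2_ip_def by (subst integral_mult_right_zero[symmetric]) (simp add: mult.assoc)

lemma L2_ip_cnj: "L2_ip \<phi> f g = cnj (L2_ip \<phi> g f)"
  unfolding L2_ip_def by (subst Bochner_Integration.integral_cnj[symmetric]) (simp add: mult_ac)

lemma L2_ip_add_right:
  "f \<in> L2_fun \<phi> \<Longrightarrow> g \<in> L2_fun \<phi> \<Longrightarrow> h \<in> L2_fun \<phi> \<Longrightarrow> L2_ip \<phi> h (\<lambda>z. f z + g z) = L2_ip \<phi> h f + L2_ip \<phi> h g"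
  by (subst (1 2 3) L2_ip_cnj) (simp add: L2_ip_add_left)

lemma L2_ip_diff_right:
  "f \<in> L2_fun \<phi> \<Longrightarrow> g \<in> L2_fun \<phi> \<Longrightarrow> h \<in> L2_fun \<phi> \<Longrightarrow> L2_ip \<phi> h (\<lambda>z. f z - g z) = L2_ip \<phi> h f - L2_ip \<phi> h g"
  by (subst (1 2 3) L2_ip_cnj) (simp add: L2_ip_diff_left)

lemma L2_ip_scale_right: "L2_ip \<phi> h (\<lambda>z. c * f z) = cnj c * L2_ip \<phi> h f"
  by (subst (1 2) L2_ip_cnj) (simp add: L2_ip_scale_left)

lemma L2_ip_self: "L2_ip \<phi> f f = of_real ((L2_norm \<phi> f)\<^sup>2)"
  unfolding L2_ip_def L2_norm_power2
  by (subst integral_complex_of_real[symmetric]) (simp add: complex_norm_square[symmetric] flip: of_real_mult of_real_power)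

lemma L2_norm_add_sq:
  assumes "f \<in> L2_fun \<phi>" "g \<in> L2_fun \<phi>"
  shows "(L2_norm \<phi> (\<lambda>z. f z + g z))\<^sup>2 = (L2_norm \<phi> f)\<^sup>2 + (L2_norm \<phi> g)\<^sup>2 + 2 * Re (L2_ip \<phi> f g)"
proof -
  have "complex_of_real ((L2_norm \<phi> (\<lambda>z. f z + g z))\<^sup>2) = L2_ip \<phi> f f + L2_ip \<phi> g g + L2_ip \<phi> f g + L2_ip \<phi> g f"
    using assms unfolding L2_ip_self[symmetric]
    by (simp add: L2_ip_add_left L2_ip_add_right L2_add)
  also have "L2_ip \<phi> g f = cnj (L2_ip \<phi> f g)"
    by (rule L2_ip_cnj)
  finally have "Re (complex_of_real ((L2_norm \<phi> (\<lambda>z. f z + g z))\<^sup>2)) = Re (L2_ip \<phi> f f + L2_ip \<phi> g g + L2_ip \<phi> f g + cnj (L2_ip \<phi> f g))"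
    by (rule arg_cong)
  then show ?thesis
    unfolding L2_ip_self by simp
qed

text \<open>
  Expand \<open>0 \<le> \<parallel>f - c g\<parallel>\<^sup>2\<close> with \<open>c = \<langle>f,
  g\<rangle> / \<parallel>g\<parallel>\<^sup>2\<close>.
\<close>

lemma L2_Cauchy_Schwarz:
  assumes f: "f \<in> L2_fun \<phi>" and g: "g \<in> L2_fun \<phi>"
  shows "norm (L2_ip \<phi> f g) \<le> L2_norm \<phi> f * L2_norm \<phi> g"
proof (cases "L2_norm \<phi> g = 0")
  case True
  then have "AE z in lebesgue. g z = 0"
    using L2_norm_eq_0_iff[OF g] by simp
  then have "AE z in lebesgue. f z * cnj (g z) * of_real (exp (- 2 * \<phi> z)) = 0"
    by eventually_elim simp
  then have "L2_ip \<phi> f g = 0"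
    unfolding L2_ip_def by (rule integral_eq_zero_AE)
  then show ?thesis using True by simp
next
  case False
  define N where "N = (L2_norm \<phi> g)\<^sup>2"
  have "N > 0" using False by (simp add: N_def)
  define p where "p = L2_ip \<phi> f g"
  have "0 \<le> (L2_norm \<phi> (\<lambda>z. f z + (- p / N) * g z))\<^sup>2"
    by simp
  also have "\<dots> = (L2_norm \<phi> f)\<^sup>2 + (norm (- p / N))\<^sup>2 * N + 2 * Re (cnj (- p / N) * p)"
    by (simp only: L2_norm_add_sq[OF f L2_fun_scale[OF g]] L2_norm_scale L2_ip_scale_right power_mult_distrib N_def p_def)
  also have "cnj (- p / N) * p = of_real (- (norm p)\<^sup>2 / N)"
    using complex_norm_square[of p] by (simp add: mult.commute)
  also have "(norm (- p / N))\<^sup>2 * N = (norm p)\<^sup>2 / N"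
    using \<open>N > 0\<close> by (simp add: norm_divide power_divide power2_eq_square)
  finally have "(norm p)\<^sup>2 / N \<le> (L2_norm \<phi> f)\<^sup>2"
    by simp
  then have "(norm p)\<^sup>2 \<le> (L2_norm \<phi> f * L2_norm \<phi> g)\<^sup>2"
    using \<open>N > 0\<close> by (simp add: N_def divide_le_eq power_mult_distrib)
  then show ?thesis
    unfolding p_def by (rule power2_le_imp_le) (simp add: L2_norm_nonneg)
qed

lemma L2_norm_cong_AE:
  assumes "f \<in> borel_measurable lebesgue" "g \<in> borel_measurable lebesgue" "AE z in lebesgue. f z = g z"
  shows "L2_norm \<phi> f = L2_norm \<phi> g"
proof -
  note [measurable] = assms(1,2)
  have "(LINT z|lebesgue. (norm (f z))\<^sup>2 * exp (- 2 * \<phi> z)) = (LINT z|lebesgue. (norm (g z))\<^sup>2 * exp (- 2 * \<phi> z))"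
    by (rule integral_cong_AE) (use assms(3) in \<open>auto elim: AE_mp\<close>)
  then show ?thesis by (simp add: L2_norm_def)
qed

lemma nn_integral_L2_norm:
  assumes "f \<in> L2_fun \<phi>"
  shows "(\<integral>\<^sup>+z. ennreal ((norm (f z))\<^sup>2 * exp (- 2 * \<phi> z)) \<partial>lebesgue) = ennreal ((L2_norm \<phi> f)\<^sup>2)"
  using assms unfolding L2_norm_power2 by (intro nn_integral_eq_integral) (auto simp: L2_fun_def)

lemma L2_fun_nn_integralI:
  assumes "f \<in> borel_measurable lebesgue"
    and le: "(\<integral>\<^sup>+z. ennreal ((norm (f z))\<^sup>2 * exp (- 2 * \<phi> z)) \<partial>lebesgue) \<le> ennreal (c\<^sup>2)" and "c \<ge> 0"
  shows "f \<in> L2_fun \<phi>" "L2_norm \<phi> f \<le> c"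
proof -
  note [measurable] = assms(1)
  show f: "f \<in> L2_fun \<phi>"
    unfolding L2_fun_def using le
    by (auto intro!: integrableI_bounded simp: le_less_trans)
  have "ennreal ((L2_norm \<phi> f)\<^sup>2) \<le> ennreal (c\<^sup>2)"
    using le nn_integral_L2_norm[OF f] by simp
  then have "(L2_norm \<phi> f)\<^sup>2 \<le> c\<^sup>2"
    by (simp add: ennreal_le_iff)
  then show "L2_norm \<phi> f \<le> c"
    using \<open>c \<ge> 0\<close> by (rule power2_le_imp_le)
qed

text \<open>
  The summands are bounded, so consecutive differences decay geometrically.
\<close>

lemma Cauchy_if_weighted_sum_finite:
  fixes F :: "nat \<Rightarrow> complex"
  assumes w: "w > 0" and fin: "(\<Sum>k. ennreal (2 ^ k * ((norm (F (Suc k) - F k))\<^sup>2 * w))) \<noteq> \<infinity>"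
  shows "convergent F"
proof -
  have s: "summable (\<lambda>k. 2 ^ k * ((norm (F (Suc k) - F k))\<^sup>2 * w))"
    by (rule summable_suminf_not_top) (use w fin in auto)
  then have "bounded (range (\<lambda>k. 2 ^ k * ((norm (F (Suc k) - F k))\<^sup>2 * w)))"
    by (intro summable_imp_bounded)
  then obtain C where C: "\<And>k. norm (2 ^ k * ((norm (F (Suc k) - F k))\<^sup>2 * w)) \<le> C"
    unfolding bounded_iff by blast
  have C': "2 ^ k * ((norm (F (Suc k) - F k))\<^sup>2 * w) \<le> C" for k
    using C[of k] w by simp
  have b: "norm (F (Suc k) - F k) \<le> sqrt (C / w) * (sqrt (1/2)) ^ k" for k
  proof -
    have "(norm (F (Suc k) - F k))\<^sup>2 \<le> C / w * (1/2) ^ k"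
      using C'[of k] w by (simp add: field_simps power_one_over)
    then have "norm (F (Suc k) - F k) \<le> sqrt (C / w * (1/2) ^ k)"
      by (rule real_le_rsqrt)
    then show ?thesis by (simp only: real_sqrt_mult real_sqrt_power)
  qed
  have "summable (\<lambda>k. sqrt (C / w) * (sqrt (1/2)) ^ k)"
    by (intro summable_mult summable_geometric) auto
  then have "summable (\<lambda>k. F (Suc k) - F k)"
    by (rule summable_comparison_test'[where N=0]) (use b in auto)
  then have "convergent (\<lambda>n. \<Sum>k<n. F (Suc k) - F k)"
    by (simp add: summable_iff_convergent)
  then have "convergent (\<lambda>n. F n - F 0)"
    by (simp add: sum_lessThan_telescope)
  then show ?thesis
    using convergent_add[OF _ convergent_const[of "F 0"], of "\<lambda>n. F n - F 0"] by simp
qed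

text \<open>
  Riesz and Fischer: along a subsequence \<open>F\<close> with differences of norm below
  \<open>2\<^sup>-\<^sup>k\<close>, the sum of \<open>2\<^sup>k |F\<^sub>k\<^sub>+\<^sub>1 -
  F\<^sub>k|\<^sup>2\<close> has finite weighted integral, so the subsequence converges almost
  everywhere. Fatou turns this into convergence in norm.
\<close>

lemma L2_complete:
  assumes f: "\<And>n. f n \<in> L2_fun \<phi>"
    and C: "\<And>e. e > 0 \<Longrightarrow> \<exists>N. \<forall>m\<ge>N. \<forall>n\<ge>N. L2_norm \<phi> (\<lambda>z. f m z - f n z) < e"
  shows "\<exists>g\<in>L2_fun \<phi>. (\<lambda>n. L2_norm \<phi> (\<lambda>z. f n z - g z)) \<longlonglongrightarrow> 0"
proof -
  have "\<exists>N. \<forall>k. \<forall>m\<ge>N k. \<forall>n\<ge>N k. L2_norm \<phi> (\<lambda>z. f m z - f n z) < (1/2) ^ k"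
    by (rule choice) (use C in auto)
  then obtain N where N: "\<And>k m n. m \<ge> N k \<Longrightarrow> n \<ge> N k \<Longrightarrow> L2_norm \<phi> (\<lambda>z. f m z - f n z) < (1/2) ^ k"
    by blast
  \<comment> \<open>a sum instead of \<open>N k\<close>, so that \<open>s k\<close> dominates all \<open>N i\<close> with \<open>i \<le> k\<close>\<close>
  define s where "s k = (\<Sum>i\<le>k. N i)" for k
  have s: "s k \<ge> N i" if "i \<le> k" for i k
    unfolding s_def using that by (intro member_le_sum) auto
  define F where "F k = f (s k)" for k
  have F: "F k \<in> L2_fun \<phi>" for k by (simp add: F_def f)
  have Fd: "(\<lambda>z. F m z - f n z) \<in> L2_fun \<phi>" for m n
    by (intro L2_diff F f)
  have [measurable]: "F k \<in> borel_measurable lebesgue" "f k \<in> borel_measurable lebesgue" for k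
    using F f by (auto simp: L2_fun_def)
  have d: "(\<integral>\<^sup>+z. ennreal ((norm (F (Suc k) z - F k z))\<^sup>2 * exp (- 2 * \<phi> z)) \<partial>lebesgue) \<le> ennreal ((1/4) ^ k)" for k
  proof -
    have "L2_norm \<phi> (\<lambda>z. F (Suc k) z - F k z) < (1/2) ^ k"
      unfolding F_def by (rule N) (auto intro: s)
    then have "(L2_norm \<phi> (\<lambda>z. F (Suc k) z - F k z))\<^sup>2 \<le> ((1/2) ^ k)\<^sup>2"
      by (intro power_mono) (auto simp: L2_norm_nonneg)
    also have "((1/2) ^ k)\<^sup>2 = (1/4::real) ^ k"
      by (simp add: power2_eq_square flip: power_mult_distrib)
    finally show ?thesis
      by (subst nn_integral_L2_norm) (auto intro!: L2_diff F ennreal_leI)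
  qed
  have "(\<integral>\<^sup>+z. (\<Sum>k. ennreal (2 ^ k * ((norm (F (Suc k) z - F k z))\<^sup>2 * exp (- 2 * \<phi> z)))) \<partial>lebesgue)
      = (\<Sum>k. \<integral>\<^sup>+z. ennreal (2 ^ k * ((norm (F (Suc k) z - F k z))\<^sup>2 * exp (- 2 * \<phi> z))) \<partial>lebesgue)"
    by (rule nn_integral_suminf) measurable
  also have "\<dots> = (\<Sum>k. ennreal (2 ^ k) * (\<integral>\<^sup>+z. ennreal ((norm (F (Suc k) z - F k z))\<^sup>2 * exp (- 2 * \<phi> z)) \<partial>lebesgue))"
    by (subst nn_integral_cmult[symmetric]) (auto simp: ennreal_mult)
  also have "\<dots> \<le> (\<Sum>k. ennreal ((1/2) ^ k))"
  proof (rule suminf_le)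
    fix k
    have "ennreal (2 ^ k) * (\<integral>\<^sup>+z. ennreal ((norm (F (Suc k) z - F k z))\<^sup>2 * exp (- 2 * \<phi> z)) \<partial>lebesgue)
        \<le> ennreal (2 ^ k) * ennreal ((1/4) ^ k)"
      by (intro mult_left_mono d) auto
    also have "\<dots> = ennreal ((1/2) ^ k)"
      by (simp flip: ennreal_mult power_mult_distrib)
    finally show "ennreal (2 ^ k) * (\<integral>\<^sup>+z. ennreal ((norm (F (Suc k) z - F k z))\<^sup>2 * exp (- 2 * \<phi> z)) \<partial>lebesgue) \<le> ennreal ((1/2) ^ k)" .
  qed auto
  also have "\<dots> < \<infinity>"
    by (subst suminf_ennreal2) (simp_all add: summable_geometric)
  finally have "AE z in lebesgue. (\<Sum>k. ennreal (2 ^ k * ((norm (F (Suc k) z - F k z))\<^sup>2 * exp (- 2 * \<phi> z)))) \<noteq> \<infinity>"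
    by (intro nn_integral_PInf_AE) auto
  then have conv: "AE z in lebesgue. convergent (\<lambda>k. F k z)"
    by eventually_elim (rule Cauchy_if_weighted_sum_finite[OF exp_gt_zero])
  define g where "g z = lim (\<lambda>k. F k z)" for z
  have [measurable]: "g \<in> borel_measurable lebesgue"
    unfolding g_def by measurable
  have lim: "AE z in lebesgue. (\<lambda>k. F k z) \<longlonglongrightarrow> g z"
    using conv by eventually_elim (simp add: g_def convergent_LIMSEQ_iff)
  have main: "(\<lambda>z. g z - f n z) \<in> L2_fun \<phi> \<and> L2_norm \<phi> (\<lambda>z. g z - f n z) \<le> e"
    if e: "e > 0" and n: "n \<ge> M" and M: "\<And>m n. m \<ge> M \<Longrightarrow> n \<ge> M \<Longrightarrow> L2_norm \<phi> (\<lambda>z. f m z - f n z) < e" and Ms: "\<forall>\<^sub>F k in sequentially. s k \<ge> M" for e n M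
  proof -
    have "(\<integral>\<^sup>+z. ennreal ((norm (g z - f n z))\<^sup>2 * exp (- 2 * \<phi> z)) \<partial>lebesgue)
        = (\<integral>\<^sup>+z. liminf (\<lambda>k. ennreal ((norm (F k z - f n z))\<^sup>2 * exp (- 2 * \<phi> z))) \<partial>lebesgue)"
    proof (rule nn_integral_cong_AE, use lim in eventually_elim)
      fix z assume "(\<lambda>k. F k z) \<longlonglongrightarrow> g z"
      then have "(\<lambda>k. ennreal ((norm (F k z - f n z))\<^sup>2 * exp (- 2 * \<phi> z))) \<longlonglongrightarrow> ennreal ((norm (g z - f n z))\<^sup>2 * exp (- 2 * \<phi> z))"
        by (intro tendsto_intros)
      then show "ennreal ((norm (g z - f n z))\<^sup>2 * exp (- 2 * \<phi> z)) = liminf (\<lambda>k. ennreal ((norm (F k z - f n z))\<^sup>2 * exp (- 2 * \<phi> z)))"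
        by (intro lim_imp_Liminf[symmetric]) simp_all
    qed
    also have "\<dots> \<le> liminf (\<lambda>k. \<integral>\<^sup>+z. ennreal ((norm (F k z - f n z))\<^sup>2 * exp (- 2 * \<phi> z)) \<partial>lebesgue)"
      by (rule nn_integral_liminf) measurable
    also have "\<dots> = liminf (\<lambda>k. ennreal ((L2_norm \<phi> (\<lambda>z. F k z - f n z))\<^sup>2))"
      by (subst nn_integral_L2_norm) (auto intro: Fd)
    also have "\<dots> \<le> ennreal (e\<^sup>2)"
    proof (rule Liminf_le)
      show "\<forall>\<^sub>F k in sequentially. ennreal ((L2_norm \<phi> (\<lambda>z. F k z - f n z))\<^sup>2) \<le> ennreal (e\<^sup>2)"
      proof (rule eventually_mono[OF Ms])
        fix k assume "M \<le> s k"
        from M[OF this n] have "L2_norm \<phi> (\<lambda>z. F k z - f n z) \<le> e"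
          by (simp add: F_def)
        then show "ennreal ((L2_norm \<phi> (\<lambda>z. F k z - f n z))\<^sup>2) \<le> ennreal (e\<^sup>2)"
          by (intro ennreal_leI power_mono L2_norm_nonneg)
      qed
    qed simp
    finally show ?thesis
      using e L2_fun_nn_integralI[of "\<lambda>z. g z - f n z" e] by auto
  qed
  have ev: "\<forall>\<^sub>F k in sequentially. s k \<ge> N i" for i
    using eventually_ge_at_top[of i] by eventually_elim (rule s)
  have main': "(\<lambda>z. g z - f n z) \<in> L2_fun \<phi> \<and> L2_norm \<phi> (\<lambda>z. g z - f n z) \<le> (1/2) ^ i" if "n \<ge> N i" for n i
    using main[OF _ that N ev] by simp
  have "(\<lambda>z. (g z - f (N 0) z) + f (N 0) z) \<in> L2_fun \<phi>"
    using main'[of 0 "N 0"] by (intro L2_add f) auto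
  then have g: "g \<in> L2_fun \<phi>" by simp
  moreover have "(\<lambda>n. L2_norm \<phi> (\<lambda>z. f n z - g z)) \<longlonglongrightarrow> 0"
  proof (rule LIMSEQ_I)
    fix r :: real assume "r > 0"
    obtain i where i: "(1/2::real) ^ i < r"
      using real_arch_pow_inv[OF \<open>r > 0\<close>, of "1/2"] by auto
    have "norm (L2_norm \<phi> (\<lambda>z. f n z - g z) - 0) < r" if "n \<ge> N i" for n
      using main'[OF that] i L2_norm_minus_commute[of \<phi> g "f n"] by (simp add: L2_norm_nonneg)
    then show "\<exists>no. \<forall>n\<ge>no. norm (L2_norm \<phi> (\<lambda>z. f n z - g z) - 0) < r" by blast
  qed
  ultimately show ?thesis by blast
qed

lemma L2_class_in: "f \<in> L2_fun \<phi> \<Longrightarrow> L2_class \<phi> f \<in> L2_space \<phi>"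
  by (auto simp: L2_class_def L2_space_def quotient_def)

lemma L2_space_member:
  assumes "F \<in> L2_space \<phi>" "f \<in> F" shows "f \<in> L2_fun \<phi>"
  using assms by (auto simp: L2_space_def quotient_def L2_rel_def)

lemma L2_class_self: "f \<in> L2_fun \<phi> \<Longrightarrow> f \<in> L2_class \<phi> f"
  by (simp add: L2_class_def L2_rel_def)

lemma L2_space_members_AE:
  assumes "F \<in> L2_space \<phi>" "f \<in> F" "g \<in> F" shows "AE z in lebesgue. f z = g z"
proof -
  have "(f, g) \<in> L2_rel \<phi>"
    using assms quotient_eq_iff[OF equiv_L2_rel, of F \<phi> F f g] by (simp add: L2_space_def)
  then show ?thesis by (simp add: L2_rel_def)
qed

text \<open>
  The distance does not depend on the representatives that \<open>L2_dist\<close> chooses.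
\<close>

lemma L2_dist_eq:
  assumes F: "F \<in> L2_space \<phi>" "f \<in> F" and G: "G \<in> L2_space \<phi>" "g \<in> G"
  shows "L2_dist \<phi> F G = L2_norm \<phi> (\<lambda>z. f z - g z)"
  unfolding L2_dist_def
proof (rule L2_norm_cong_AE)
  have [measurable]: "(SOME f. f \<in> F) \<in> borel_measurable lebesgue" "(SOME f. f \<in> G) \<in> borel_measurable lebesgue"
    "f \<in> borel_measurable lebesgue" "g \<in> borel_measurable lebesgue"
    using L2_space_some_in(2)[OF F(1)] L2_space_some_in(2)[OF G(1)] L2_space_member[OF F] L2_space_member[OF G]
    by (auto simp: L2_fun_def)
  show "(\<lambda>z. (SOME f. f \<in> F) z - (SOME g. g \<in> G) z) \<in> borel_measurable lebesgue" "(\<lambda>z. f z - g z) \<in> borel_measurable lebesgue"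
    by measurable
  show "AE z in lebesgue. (SOME f. f \<in> F) z - (SOME g. g \<in> G) z = f z - g z"
    using L2_space_members_AE[OF F(1) L2_space_some_in(1)[OF F(1)] F(2)]
      L2_space_members_AE[OF G(1) L2_space_some_in(1)[OF G(1)] G(2)]
    by eventually_elim simp
qed

lemma L2_mcomplete: "Metric_space.mcomplete (L2_space \<phi>) (L2_dist \<phi>)"
proof -
  interpret Metric_space "L2_space \<phi>" "L2_dist \<phi>"
    by (rule Metric_space_L2[OF \<phi>_lebesgue])
  show ?thesis
    unfolding mcomplete_def
  proof (intro allI impI)
    fix \<sigma> assume "MCauchy \<sigma>"
    then have \<sigma>: "\<And>n. \<sigma> n \<in> L2_space \<phi>" and C: "\<And>e. e > 0 \<Longrightarrow> \<exists>N. \<forall>m n. N \<le> m \<longrightarrow> N \<le> n \<longrightarrow> L2_dist \<phi> (\<sigma> m) (\<sigma> n) < e"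
      unfolding MCauchy_def by blast+
    define f where "f n = (SOME f. f \<in> \<sigma> n)" for n
    have f: "f n \<in> L2_fun \<phi>" for n
      unfolding f_def by (rule L2_space_some_in(2)[OF \<sigma>])
    have "\<exists>g\<in>L2_fun \<phi>. (\<lambda>n. L2_norm \<phi> (\<lambda>z. f n z - g z)) \<longlonglongrightarrow> 0"
      by (rule L2_complete[OF f]) (use C in \<open>auto simp: L2_dist_def f_def\<close>)
    then obtain g where g: "g \<in> L2_fun \<phi>" "(\<lambda>n. L2_norm \<phi> (\<lambda>z. f n z - g z)) \<longlonglongrightarrow> 0"
      by blast
    have "L2_dist \<phi> (\<sigma> n) (L2_class \<phi> g) = L2_norm \<phi> (\<lambda>z. f n z - g z)" for n
      by (rule L2_dist_eq) (auto simp: f_def intro: \<sigma> L2_space_some_in(1)[OF \<sigma>] L2_class_in L2_class_self g)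
    then have "limitin mtopology \<sigma> (L2_class \<phi> g) sequentially"
      using g \<sigma> by (simp add: limitin_metric_dist_null L2_class_in)
    then show "\<exists>x. limitin mtopology \<sigma> x sequentially" by blast
  qed
qed

end

section \<open>The dual formulation and existence of solutions\<close>

lemma test_function_bounded: "test_function \<psi> \<Longrightarrow> bounded {z. \<psi> z \<noteq> 0}"
  unfolding test_function_def using bounded_subset[OF compact_imp_bounded closure_subset] by blast

lemma test_function_Ck: "test_function \<psi> \<Longrightarrow> Ck k \<psi>"
  by (simp add: test_function_def)

lemma test_functionI: "(\<And>k. Ck k \<psi>) \<Longrightarrow> bounded {z. \<psi> z \<noteq> 0} \<Longrightarrow> test_function \<psi>"
  by (simp add: test_function_def compact_closure)

lemma test_function_differentiable: "test_function \<psi> \<Longrightarrow> \<psi> differentiable (at z)"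
  using Ck_differentiable[OF test_function_Ck, of \<psi> 1] by simp

lemma test_function_add:
  assumes "test_function \<psi>" "test_function \<eta>" shows "test_function (\<lambda>z. \<psi> z + \<eta> z)"
proof (rule test_functionI)
  have "bounded ({z. \<psi> z \<noteq> 0} \<union> {z. \<eta> z \<noteq> 0})"
    using assms[THEN test_function_bounded] by simp
  then show "bounded {z. \<psi> z + \<eta> z \<noteq> 0}"
    by (rule bounded_subset) auto
qed (intro Ck_add test_function_Ck assms)

lemma test_function_scale:
  assumes "test_function \<psi>" shows "test_function (\<lambda>z. c * \<psi> z)"
proof (rule test_functionI)
  show "bounded {z. c * \<psi> z \<noteq> 0}"
    by (rule bounded_subset[OF test_function_bounded[OF assms]]) auto
qed (intro Ck_mult Ck_const test_function_Ck assms)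

lemma test_function_zero: "test_function (\<lambda>z. 0)"
  by (rule test_functionI) auto

lemma dbar_add:
  "\<psi> differentiable (at z) \<Longrightarrow> \<eta> differentiable (at z) \<Longrightarrow> dbar (\<lambda>z. \<psi> z + \<eta> z) z = dbar \<psi> z + dbar \<eta> z"
  unfolding dbar_def by (simp add: dx_add field_simps)

lemma dbar_scale:
  "\<psi> differentiable (at z) \<Longrightarrow> dbar (\<lambda>z. c * \<psi> z) z = c * dbar \<psi> z"
  unfolding dbar_def by (simp add: dx_mult field_simps)

lemma nonneg_quadratic_imp_zero:
  fixes A B :: real
  assumes "\<And>t. 0 \<le> t * A + t\<^sup>2 * B"
  shows "A = 0"
proof (rule ccontr)
  assume "A \<noteq> 0"
  \<comment> \<open>the choice \<open>t = - A / C\<close> makes the linear term dominate\<close>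
  define C where "C = \<bar>B\<bar> + 1"
  have "C > 0" by (simp add: C_def)
  have "0 \<le> (- A / C) * A + (- A / C)\<^sup>2 * B" by (rule assms)
  also have "\<dots> = - A\<^sup>2 / C * (1 - B / C)"
    using \<open>C > 0\<close> by (simp add: power2_eq_square field_simps)
  finally have "A\<^sup>2 / C * (1 - B / C) \<le> 0" by simp
  moreover have "B / C < 1" using \<open>C > 0\<close> by (simp add: C_def divide_less_eq)
  ultimately show False
    using \<open>A \<noteq> 0\<close> \<open>C > 0\<close> by (simp add: mult_le_0_iff divide_le_0_iff)
qed

text \<open>
  Round the finitely many values to a grid and pick one point for each pattern of grid cells that
  occurs.
\<close>

lemma finite_net:
  fixes c :: "'i \<Rightarrow> 'x \<Rightarrow> complex"
  assumes I: "finite I" and b: "\<And>i. i \<in> I \<Longrightarrow> bounded (c i ` X)" and s: "s > 0"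
  obtains Y where "Y \<subseteq> X" "finite Y" "\<And>x. x \<in> X \<Longrightarrow> \<exists>y\<in>Y. \<forall>i\<in>I. norm (c i x - c i y) \<le> s"
proof -
  define key where "key x = (\<lambda>i\<in>I. grid_index (s/2) (c i x))" for x
  have fin: "finite (grid_index (s/2) ` (c i ` X))" if i: "i \<in> I" for i
  proof -
    obtain R where R: "c i ` X \<subseteq> ball 0 R"
      using bounded_subset_ballD[OF b[OF i], of 0] by blast
    show ?thesis
    proof (rule finite_subset[OF _ finite_cells[of "s/2" "R + s"]])
      show "grid_index (s/2) ` (c i ` X) \<subseteq> {p. \<bar>s / 2 * of_int (fst p)\<bar> \<le> R + s \<and> \<bar>s / 2 * of_int (snd p)\<bar> \<le> R + s}"
      proof
        fix p assume "p \<in> grid_index (s/2) ` (c i ` X)"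
        then obtain z where z: "norm z < R" "p = grid_index (s/2) z" using R by auto
        then have "z \<in> grid_cell (s/2) p" using s by (simp add: in_grid_cell_iff)
        then show "p \<in> {p. \<bar>s / 2 * of_int (fst p)\<bar> \<le> R + s \<and> \<bar>s / 2 * of_int (snd p)\<bar> \<le> R + s}"
          using abs_Re_le_cmod[of z] abs_Im_le_cmod[of z] z(1) s
          unfolding grid_cell_def square_def by (auto simp: abs_le_iff)
      qed
    qed (use s in simp)
  qed
  have "key ` X \<subseteq> (\<Pi>\<^sub>E i\<in>I. grid_index (s/2) ` (c i ` X))"
    by (auto simp: key_def)
  then have fk: "finite (key ` X)"
    by (rule finite_subset) (intro finite_PiE I fin)
  define Y where "Y = inv_into X key ` (key ` X)"
  have "\<exists>y\<in>Y. \<forall>i\<in>I. norm (c i x - c i y) \<le> s" if "x \<in> X" for x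
  proof (intro bexI ballI)
    let ?y = "inv_into X key (key x)"
    show "?y \<in> Y" using that by (simp add: Y_def)
    fix i assume "i \<in> I"
    have "key ?y = key x" by (rule f_inv_into_f) (use that in simp)
    then have "grid_index (s/2) (c i x) = grid_index (s/2) (c i ?y)"
      using \<open>i \<in> I\<close> by (metis key_def restrict_apply')
    then have "c i x \<in> grid_cell (s/2) (grid_index (s/2) (c i x))" "c i ?y \<in> grid_cell (s/2) (grid_index (s/2) (c i x))"
      using s by (simp_all add: in_grid_cell_iff)
    then have "norm (c i x - c i ?y) \<le> 2 * (s/2)"
      unfolding grid_cell_def by (intro dist_grid_cell)
    then show "norm (c i x - c i ?y) \<le> s" by simp
  qed
  moreover have "Y \<subseteq> X"
    unfolding Y_def using inv_into_into[of _ key X] by auto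
  moreover have "finite Y" using fk by (simp add: Y_def)
  ultimately show thesis using that by blast
qed

context holder_weight
begin

sublocale measurable_weight
proof
  show "\<phi> \<in> borel_measurable lebesgue"
    using continuous_borel[OF continuous_\<phi>] by (intro measurable_completion) simp
qed

lemma continuous_admissible:
  assumes "admissible \<psi>"
  shows "continuous_on UNIV \<psi>" "continuous_on UNIV (dbar \<psi>)"
  using assms continuous_energy_density(4)[OF \<phi>] Ck_imp_continuous unfolding admissible_def by blast+

lemma admissible_dbar_bounded:
  assumes "admissible \<psi>" shows "bounded {z. dbar \<psi> z \<noteq> 0}"
proof -
  have "bounded ({z. dx \<psi> z \<noteq> 0} \<union> {z. dy \<psi> z \<noteq> 0})"
    using assms bounded_support_dx[of \<psi>] by (simp add: admissible_def)
  then show ?thesis by (rule bounded_subset) (auto simp: dbar_def)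
qed

text \<open>
  The factor \<open>e\<^sup>2\<^sup>\<phi>\<close> cancels the weight in the inner product, which
  therefore becomes the unweighted pairing with \<open>g\<close>.
\<close>

lemma compact_support_L2:
  assumes "continuous_on UNIV g" "bounded {z. g z \<noteq> 0}"
  shows "(\<lambda>z. cnj (g z) * of_real (exp (2 * \<phi> z))) \<in> L2_fun \<phi>"
    and "(L2_norm \<phi> (\<lambda>z. cnj (g z) * of_real (exp (2 * \<phi> z))))\<^sup>2 = (\<integral>z. (norm (weighted g z))\<^sup>2 \<partial>lborel)"
    and "L2_ip \<phi> f (\<lambda>z. cnj (g z) * of_real (exp (2 * \<phi> z))) = (LINT z|lebesgue. f z * g z)"
proof -
  let ?h = "\<lambda>z. cnj (g z) * of_real (exp (2 * \<phi> z))"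
  have eq: "(norm (?h z))\<^sup>2 * exp (- 2 * \<phi> z) = (norm (weighted g z))\<^sup>2" for z
  proof -
    have "(exp (2 * \<phi> z))\<^sup>2 * exp (- 2 * \<phi> z) = (exp (\<phi> z))\<^sup>2"
      by (simp add: power2_eq_square flip: exp_add)
    then show ?thesis
      by (simp add: norm_mult power_mult_distrib mult.assoc)
  qed
  have c: "continuous_on UNIV (\<lambda>z. (norm (weighted g z))\<^sup>2)" "continuous_on UNIV ?h"
    by (intro continuous_intros assms continuous_\<phi>)+
  have i: "integrable lborel (\<lambda>z. (norm (weighted g z))\<^sup>2)"
    by (rule integrable_compact_support[OF c(1)]) (rule bounded_subset[OF assms(2)], auto)
  have "integrable lebesgue (\<lambda>z. (norm (weighted g z))\<^sup>2)"
    using i by (subst integrable_completion) auto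
  moreover have "?h \<in> borel_measurable lebesgue"
    using continuous_borel[OF c(2)] by (intro measurable_completion) simp
  ultimately show "?h \<in> L2_fun \<phi>"
    by (simp only: L2_fun_def eq mem_Collect_eq)
  show "(L2_norm \<phi> ?h)\<^sup>2 = (\<integral>z. (norm (weighted g z))\<^sup>2 \<partial>lborel)"
    unfolding L2_norm_power2 eq by (rule integral_lebesgue_eq) (rule continuous_borel[OF c(1)])
  have "f z * cnj (?h z) * of_real (exp (- 2 * \<phi> z)) = f z * g z" for z
  proof -
    have "complex_of_real (exp (2 * \<phi> z)) * of_real (exp (- 2 * \<phi> z)) = 1"
      by (simp flip: of_real_mult exp_add)
    then show ?thesis by (simp add: mult.assoc)
  qed
  then show "L2_ip \<phi> f ?h = (LINT z|lebesgue. f z * g z)"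
    by (simp only: L2_ip_def)
qed

text \<open>
  The elements of the weighted space that represent the two sides of the weak equation for
  \<open>\<psi>\<close>.
\<close>

definition dual :: "(complex \<Rightarrow> complex) \<Rightarrow> complex \<Rightarrow> complex" where
  "dual \<psi> z = cnj (\<psi> z) * of_real (exp (2 * \<phi> z))"

definition dual_dbar :: "(complex \<Rightarrow> complex) \<Rightarrow> complex \<Rightarrow> complex" where
  "dual_dbar \<psi> z = cnj (dbar \<psi> z) * of_real (exp (2 * \<phi> z))"

lemma dual_L2:
  assumes "admissible \<psi>"
  shows "dual \<psi> \<in> L2_fun \<phi>" "(L2_norm \<phi> (dual \<psi>))\<^sup>2 = (\<integral>z. (norm (weighted \<psi> z))\<^sup>2 \<partial>lborel)"
    "L2_ip \<phi> f (dual \<psi>) = (LINT z|lebesgue. f z * \<psi> z)"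
    "dual_dbar \<psi> \<in> L2_fun \<phi>" "(L2_norm \<phi> (dual_dbar \<psi>))\<^sup>2 = (\<integral>z. (norm (weighted (dbar \<psi>) z))\<^sup>2 \<partial>lborel)"
    "L2_ip \<phi> f (dual_dbar \<psi>) = (LINT z|lebesgue. f z * dbar \<psi> z)"
  using compact_support_L2[OF continuous_admissible(1)[OF assms]] compact_support_L2[OF continuous_admissible(2)[OF assms] admissible_dbar_bounded[OF assms]]
    assms unfolding dual_def[abs_def] dual_dbar_def[abs_def] admissible_def by simp_all

lemma test_admissible: "test_function \<psi> \<Longrightarrow> admissible \<psi>"
  by (simp only: admissible_def test_function_Ck test_function_bounded)

lemmas test_L2 = dual_L2[OF test_admissible]

text \<open>
  Weak solvability as a family of linear conditions in the Hilbert space.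
\<close>

lemma weak_dbar_iff:
  "weak_dbar u f \<longleftrightarrow> (\<forall>\<psi>. test_function \<psi> \<longrightarrow> L2_ip \<phi> u (dual_dbar \<psi>) = - L2_ip \<phi> f (dual \<psi>))"
  unfolding weak_dbar_def by (auto simp: test_L2(3,6))

lemma dual_add:
  assumes "test_function \<psi>" "test_function \<eta>"
  shows "dual (\<lambda>z. \<psi> z + \<eta> z) = (\<lambda>z. dual \<psi> z + dual \<eta> z)" "dual_dbar (\<lambda>z. \<psi> z + \<eta> z) = (\<lambda>z. dual_dbar \<psi> z + dual_dbar \<eta> z)"
  using assms[THEN test_function_differentiable] by (auto simp: dual_def dual_dbar_def dbar_add distrib_right fun_eq_iff)

lemma dual_scale:
  assumes "test_function \<psi>"
  shows "dual (\<lambda>z. c * \<psi> z) = (\<lambda>z. cnj c * dual \<psi> z)" "dual_dbar (\<lambda>z. c * \<psi> z) = (\<lambda>z. cnj c * dual_dbar \<psi> z)"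
  using test_function_differentiable[OF assms] by (auto simp: dual_def dual_dbar_def dbar_scale fun_eq_iff)

lemma test_function_diff:
  assumes "test_function \<psi>" "test_function \<eta>"
  shows "test_function (\<lambda>z. \<psi> z - \<eta> z)" "dual (\<lambda>z. \<psi> z - \<eta> z) = (\<lambda>z. dual \<psi> z - dual \<eta> z)" "dual_dbar (\<lambda>z. \<psi> z - \<eta> z) = (\<lambda>z. dual_dbar \<psi> z - dual_dbar \<eta> z)"
  using test_function_add[OF assms(1) test_function_scale[OF assms(2), of "-1"]]
    dual_add[OF assms(1) test_function_scale[OF assms(2), of "-1"]] dual_scale[OF assms(2), of "-1"] by auto

lemma nn_integral_weighted:
  assumes "admissible \<psi>"
  shows "total_sq \<psi> = ennreal ((L2_norm \<phi> (dual \<psi>))\<^sup>2)"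
    "total_energy \<psi> = ennreal (4 * (L2_norm \<phi> (dual_dbar \<psi>))\<^sup>2)"
proof -
  have c: "continuous_on UNIV (\<lambda>z. (norm (weighted \<psi> z))\<^sup>2)"
    by (intro continuous_intros continuous_admissible[OF assms] continuous_\<phi>)
  have "integrable lborel (\<lambda>z. (norm (weighted \<psi> z))\<^sup>2)"
    by (rule integrable_compact_support[OF c], rule bounded_subset[of "{z. \<psi> z \<noteq> 0}"])
       (use assms in \<open>auto simp: admissible_def\<close>)
  then show "total_sq \<psi> = ennreal ((L2_norm \<phi> (dual \<psi>))\<^sup>2)"
    unfolding dual_L2(2)[OF assms] by (intro nn_integral_eq_integral) auto
  show "total_energy \<psi> = ennreal (4 * (L2_norm \<phi> (dual_dbar \<psi>))\<^sup>2)"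
    unfolding dual_L2(5)[OF assms] using assms unfolding admissible_def
    by (intro nn_integral_energy \<phi> V_nonneg) auto
qed

lemma coercive:
  assumes lim: "filterlim (\<lambda>z. mass z 1) at_top at_infinity"
  obtains K where "K > 0" "\<And>\<psi>. admissible \<psi> \<Longrightarrow> L2_norm \<phi> (dual \<psi>) \<le> K * L2_norm \<phi> (dual_dbar \<psi>)"
proof -
  obtain K where K: "K > 0" "\<And>\<psi>. Ck 2 \<psi> \<Longrightarrow>
      total_sq \<psi> \<le> ennreal K * total_energy \<psi>"
    using global_bound[OF lim] by blast
  have "L2_norm \<phi> (dual \<psi>) \<le> sqrt (4 * K) * L2_norm \<phi> (dual_dbar \<psi>)" if a: "admissible \<psi>" for \<psi>
  proof -
    have "ennreal ((L2_norm \<phi> (dual \<psi>))\<^sup>2) \<le> ennreal K * ennreal (4 * (L2_norm \<phi> (dual_dbar \<psi>))\<^sup>2)"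
      using K(2)[of \<psi>] a unfolding nn_integral_weighted[OF a] by (simp add: admissible_def)
    also have "\<dots> = ennreal (K * (4 * (L2_norm \<phi> (dual_dbar \<psi>))\<^sup>2))"
      using K(1) by (intro ennreal_mult[symmetric]) auto
    finally have "(L2_norm \<phi> (dual \<psi>))\<^sup>2 \<le> K * (4 * (L2_norm \<phi> (dual_dbar \<psi>))\<^sup>2)"
      using K(1) by (subst (asm) ennreal_le_iff) auto
    also have "\<dots> = (sqrt (4 * K) * L2_norm \<phi> (dual_dbar \<psi>))\<^sup>2"
      using K(1) by (simp add: power_mult_distrib)
    finally show ?thesis
      by (rule power2_le_imp_le) (use K(1) in \<open>simp add: L2_norm_nonneg\<close>)
  qed
  moreover have "sqrt (4 * K) > 0" using K(1) by simp
  ultimately show thesis using that by blast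
qed

lemma cell_average_bound:
  assumes a: "admissible \<psi>" and r: "r > 0"
  shows "norm (cell_integral r p \<psi>) \<le> r * L2_norm \<phi> (dual \<psi>)"
proof -
  let ?G = "norm (cell_integral r p \<psi>)"
  have c: "continuous_on UNIV (weighted \<psi>)"
    by (intro continuous_intros continuous_admissible[OF a] continuous_\<phi>)
  have "ennreal (2 * ?G\<^sup>2) \<le> ennreal (2 * r\<^sup>2) * (sq_int (grid_cell r p) \<psi>)"
    unfolding grid_cell_def by (subst mean_square_identity[OF c]) (use r in auto)
  also have "\<dots> \<le> ennreal (2 * r\<^sup>2) * (total_sq \<psi>)"
    by (intro mult_left_mono nn_integral_mono) (auto simp: indicator_def)
  also have "\<dots> = ennreal (2 * r\<^sup>2 * (L2_norm \<phi> (dual \<psi>))\<^sup>2)"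
    unfolding nn_integral_weighted[OF a] by (intro ennreal_mult[symmetric]) auto
  finally have "2 * ?G\<^sup>2 \<le> 2 * r\<^sup>2 * (L2_norm \<phi> (dual \<psi>))\<^sup>2"
    by (subst (asm) ennreal_le_iff) auto
  then have "?G\<^sup>2 \<le> (r * L2_norm \<phi> (dual \<psi>))\<^sup>2"
    by (simp add: power_mult_distrib)
  then show ?thesis by (rule power2_le_imp_le) (use r in \<open>simp add: L2_norm_nonneg\<close>)
qed

text \<open>
  Split the plane into a large disc and its complement, and use the local bound on the one and the tail
  bound on the other.
\<close>

lemma compactness_estimate:
  assumes lim: "filterlim (\<lambda>z. mass z 1) at_top at_infinity" and e: "\<epsilon> > 0"
  obtains r I where "r > 0" "finite I" "\<And>\<psi>. admissible \<psi> \<Longrightarrow>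
      (L2_norm \<phi> (dual \<psi>))\<^sup>2 \<le> \<epsilon> * (L2_norm \<phi> (dual_dbar \<psi>))\<^sup>2 + (\<Sum>p\<in>I. (norm (cell_integral r p \<psi>))\<^sup>2) / r\<^sup>2"
proof -
  obtain K where K: "K > 0" "\<And>\<psi>. Ck 2 \<psi> \<Longrightarrow>
      total_sq \<psi> \<le> ennreal K * total_energy \<psi>"
    using global_bound[OF lim] by blast
  have e8: "\<epsilon> / 8 > 0" using e by simp
  obtain R where R: "\<And>\<psi>. Ck 2 \<psi> \<Longrightarrow>
      sq_int (- ball 0 R) \<psi> \<le> ennreal (\<epsilon> / 8) * total_energy \<psi>"
    using tail_bound[OF lim e8] by blast
  obtain r I where I: "r > 0" "finite I" "\<And>\<psi>. Ck 2 \<psi> \<Longrightarrow>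
      sq_int (ball 0 R) \<psi>
      \<le> ennreal (\<epsilon> / 8) * total_energy \<psi>
        + ennreal ((\<Sum>p\<in>I. (norm (cell_integral r p \<psi>))\<^sup>2) / r\<^sup>2)"
    using local_bound[OF K e8] by blast
  have "(L2_norm \<phi> (dual \<psi>))\<^sup>2 \<le> \<epsilon> * (L2_norm \<phi> (dual_dbar \<psi>))\<^sup>2 + (\<Sum>p\<in>I. (norm (cell_integral r p \<psi>))\<^sup>2) / r\<^sup>2"
    if a: "admissible \<psi>" for \<psi>
  proof -
    have \<psi>: "Ck 2 \<psi>" using a by (simp add: admissible_def)
    note [measurable] = weighted_borel[OF \<psi>]
    have [measurable]: "ball (0::complex) R \<in> sets borel" by simp
    let ?S = "(\<Sum>p\<in>I. (norm (cell_integral r p \<psi>))\<^sup>2) / r\<^sup>2"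
    let ?W = "\<lambda>z. ennreal ((norm (weighted \<psi> z))\<^sup>2)"
    have S: "?S \<ge> 0" by (intro divide_nonneg_nonneg sum_nonneg) auto
    have "ennreal ((L2_norm \<phi> (dual \<psi>))\<^sup>2) = (\<integral>\<^sup>+z. ?W z * indicator (ball 0 R) z + ?W z * indicator (- ball 0 R) z \<partial>lborel)"
      unfolding nn_integral_weighted[OF a, symmetric] by (intro nn_integral_cong) (simp add: indicator_def)
    also have "\<dots> = (\<integral>\<^sup>+z\<in>ball 0 R. ?W z \<partial>lborel) + (\<integral>\<^sup>+z\<in>- ball 0 R. ?W z \<partial>lborel)"
      by (rule nn_integral_add) measurable
    also have "\<dots> \<le> (ennreal (\<epsilon> / 8) * ennreal (4 * (L2_norm \<phi> (dual_dbar \<psi>))\<^sup>2) + ennreal ?S) + ennreal (\<epsilon> / 8) * ennreal (4 * (L2_norm \<phi> (dual_dbar \<psi>))\<^sup>2)"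
      using I(3)[OF \<psi>] R[OF \<psi>] unfolding nn_integral_weighted[OF a] by (rule add_mono)
    also have "ennreal (\<epsilon> / 8) * ennreal (4 * (L2_norm \<phi> (dual_dbar \<psi>))\<^sup>2) = ennreal (\<epsilon> / 2 * (L2_norm \<phi> (dual_dbar \<psi>))\<^sup>2)"
      using e by (subst ennreal_mult[symmetric]) auto
    also have "ennreal (\<epsilon> / 2 * (L2_norm \<phi> (dual_dbar \<psi>))\<^sup>2) + ennreal ?S + ennreal (\<epsilon> / 2 * (L2_norm \<phi> (dual_dbar \<psi>))\<^sup>2)
      = ennreal (\<epsilon> / 2 * (L2_norm \<phi> (dual_dbar \<psi>))\<^sup>2 + ?S + \<epsilon> / 2 * (L2_norm \<phi> (dual_dbar \<psi>))\<^sup>2)"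
      using e S by (subst ennreal_plus[symmetric] | simp)+
    also have "\<epsilon> / 2 * (L2_norm \<phi> (dual_dbar \<psi>))\<^sup>2 + ?S + \<epsilon> / 2 * (L2_norm \<phi> (dual_dbar \<psi>))\<^sup>2 = \<epsilon> * (L2_norm \<phi> (dual_dbar \<psi>))\<^sup>2 + ?S"
      by simp
    finally show ?thesis
      using e S by (subst (asm) ennreal_le_iff) auto
  qed
  then show thesis using that[OF I(1,2)] by blast
qed

lemma L2_ip_tendsto:
  assumes "\<And>n. v n \<in> L2_fun \<phi>" "w \<in> L2_fun \<phi>" "u \<in> L2_fun \<phi>"
    and "(\<lambda>n. L2_norm \<phi> (\<lambda>z. v n z - u z)) \<longlonglongrightarrow> 0"
  shows "(\<lambda>n. L2_ip \<phi> (v n) w) \<longlonglongrightarrow> L2_ip \<phi> u w"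
proof -
  have "(\<lambda>n. L2_norm \<phi> (\<lambda>z. v n z - u z) * L2_norm \<phi> w) \<longlonglongrightarrow> 0 * L2_norm \<phi> w"
    by (intro tendsto_intros assms)
  then have lim0: "(\<lambda>n. L2_norm \<phi> (\<lambda>z. v n z - u z) * L2_norm \<phi> w) \<longlonglongrightarrow> 0" by simp
  have "(\<lambda>n. L2_ip \<phi> (v n) w - L2_ip \<phi> u w) \<longlonglongrightarrow> 0"
  proof (rule Lim_null_comparison[OF _ lim0])
    show "\<forall>\<^sub>F n in sequentially. norm (L2_ip \<phi> (v n) w - L2_ip \<phi> u w) \<le> L2_norm \<phi> (\<lambda>z. v n z - u z) * L2_norm \<phi> w"
    proof (rule always_eventually, rule allI)
      fix n
      have "L2_ip \<phi> (v n) w - L2_ip \<phi> u w = L2_ip \<phi> (\<lambda>z. v n z - u z) w"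
        by (rule L2_ip_diff_left[symmetric]) (intro assms)+
      then show "norm (L2_ip \<phi> (v n) w - L2_ip \<phi> u w) \<le> L2_norm \<phi> (\<lambda>z. v n z - u z) * L2_norm \<phi> w"
        by (simp add: L2_Cauchy_Schwarz L2_diff assms)
    qed
  qed
  then show ?thesis by (simp add: LIM_zero_iff)
qed

text \<open>
  Direct method for the convex functional \<open>J\<close>. By the parallelogram identity, the elements
  \<open>dual_dbar (\<psi> n)\<close> of a minimising sequence form a Cauchy sequence; the vanishing of
  the first variation at its limit \<open>u\<close> is the weak equation. The functional
  \<open>J\<close> itself need not attain its infimum at a test function.
\<close>

lemma minimizer_exists:
  assumes lim: "filterlim (\<lambda>z. mass z 1) at_top at_infinity" and f: "f \<in> L2_fun \<phi>"
  obtains u \<psi> where "u \<in> L2_fun \<phi>" "weak_dbar u f" "\<And>n. test_function (\<psi> n)"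
    "(\<lambda>n. L2_norm \<phi> (\<lambda>z. dual_dbar (\<psi> n) z - u z)) \<longlonglongrightarrow> 0"
proof -
  obtain K where K: "K > 0" "\<And>\<psi>. admissible \<psi> \<Longrightarrow> L2_norm \<phi> (dual \<psi>) \<le> K * L2_norm \<phi> (dual_dbar \<psi>)"
    using coercive[OF lim] by blast
  define J where "J \<psi> = (L2_norm \<phi> (dual_dbar \<psi>))\<^sup>2 / 2 + Re (L2_ip \<phi> f (dual \<psi>))" for \<psi>
  define m where "m = Inf (J ` {\<psi>. test_function \<psi>})"
  \<comment> \<open>complete the square, using coercivity for the linear term\<close>
  have lower: "- (K * L2_norm \<phi> f)\<^sup>2 / 2 \<le> J \<psi>" if "test_function \<psi>" for \<psi>
  proof -
    define x where "x = L2_norm \<phi> (dual_dbar \<psi>)"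
    define c where "c = K * L2_norm \<phi> f"
    have "\<bar>Re (L2_ip \<phi> f (dual \<psi>))\<bar> \<le> L2_norm \<phi> f * L2_norm \<phi> (dual \<psi>)"
      using abs_Re_le_cmod L2_Cauchy_Schwarz[OF f test_L2(1)[OF that]] by (rule order_trans)
    also have "\<dots> \<le> L2_norm \<phi> f * (K * x)"
      unfolding x_def by (intro mult_left_mono K(2) test_admissible that L2_norm_nonneg)
    finally have "- (c * x) \<le> Re (L2_ip \<phi> f (dual \<psi>))"
      by (simp add: c_def abs_le_iff mult_ac)
    then have "x\<^sup>2 / 2 - c * x \<le> J \<psi>" by (simp add: J_def x_def)
    moreover have "0 \<le> (x - c)\<^sup>2" by simp
    then have "- c\<^sup>2 / 2 \<le> x\<^sup>2 / 2 - c * x" by (simp add: power2_eq_square algebra_simps)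
    ultimately have "- c\<^sup>2 / 2 \<le> J \<psi>" by linarith
    then show ?thesis by (simp add: c_def)
  qed
  have ne: "J ` {\<psi>. test_function \<psi>} \<noteq> {}" using test_function_zero by blast
  have bdd: "bdd_below (J ` {\<psi>. test_function \<psi>})"
    using lower by (intro bdd_belowI[where m="- (K * L2_norm \<phi> f)\<^sup>2 / 2"]) auto
  have mle: "m \<le> J \<psi>" if "test_function \<psi>" for \<psi>
    unfolding m_def using bdd that by (intro cInf_lower) auto
  have "\<exists>\<psi>. test_function \<psi> \<and> J \<psi> < m + 1 / real (Suc n)" for n
    using cInf_lessD[OF ne, of "m + 1 / real (Suc n)"] by (auto simp: m_def)
  then obtain \<psi> where \<psi>: "\<And>n. test_function (\<psi> n)" and J\<psi>: "\<And>n. J (\<psi> n) < m + 1 / real (Suc n)"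
    by metis
  note uL = test_L2(4)[OF \<psi>]
  \<comment> \<open>\<open>J\<close> along a line, a quadratic polynomial in \<open>t\<close>\<close>
  have J_add: "J (\<lambda>z. \<eta> z + of_real t * \<theta> z) = J \<eta> + t * (Re (L2_ip \<phi> (dual_dbar \<eta>) (dual_dbar \<theta>)) + Re (L2_ip \<phi> f (dual \<theta>))) + t\<^sup>2 * ((L2_norm \<phi> (dual_dbar \<theta>))\<^sup>2 / 2)"
    if "test_function \<eta>" "test_function \<theta>" for \<eta> \<theta> t
  proof -
    note s = test_function_scale[OF that(2), of "of_real t"]
    show ?thesis
      unfolding J_def dual_add[OF that(1) s] dual_scale[OF that(2)]
      by (simp add: L2_norm_add_sq[OF test_L2(4)[OF that(1)] L2_fun_scale[OF test_L2(4)[OF that(2)]]]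
          L2_ip_add_right[OF test_L2(1)[OF that(1)] L2_fun_scale[OF test_L2(1)[OF that(2)]] f]
          L2_ip_scale_right L2_norm_scale power_mult_distrib field_simps)
  qed
  \<comment> \<open>compare \<open>J\<close> at two members of the sequence with \<open>J \<ge> m\<close> at their midpoint\<close>
  have cauchy: "(L2_norm \<phi> (\<lambda>z. dual_dbar (\<psi> i) z - dual_dbar (\<psi> j) z))\<^sup>2 \<le> 4 / real (Suc i) + 4 / real (Suc j)" for i j
  proof -
    let ?d = "\<lambda>z. \<psi> j z - \<psi> i z"
    have d: "test_function ?d" using test_function_diff(1)[OF \<psi> \<psi>] .
    define A where "A = Re (L2_ip \<phi> (dual_dbar (\<psi> i)) (dual_dbar ?d)) + Re (L2_ip \<phi> f (dual ?d))"
    define B where "B = (L2_norm \<phi> (dual_dbar ?d))\<^sup>2 / 2"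
    have "J (\<psi> j) = J (\<psi> i) + A + B"
      using J_add[OF \<psi>[of i] d, of 1] by (simp add: A_def B_def)
    moreover have "m \<le> J (\<psi> i) + (1/2) * A + (1/2)\<^sup>2 * B"
      unfolding A_def B_def J_add[OF \<psi>[of i] d, symmetric]
      by (rule mle[OF test_function_add[OF \<psi>[of i] test_function_scale[OF d]]])
    then have "m \<le> J (\<psi> i) + A / 2 + B / 4"
      by (simp add: power2_eq_square)
    ultimately have "B \<le> 2 * J (\<psi> i) + 2 * J (\<psi> j) - 4 * m"
      by linarith
    then have "B \<le> 2 * (1 / real (Suc i)) + 2 * (1 / real (Suc j))"
      using J\<psi>[of i] J\<psi>[of j] by linarith
    then have "(L2_norm \<phi> (dual_dbar ?d))\<^sup>2 \<le> 4 / real (Suc i) + 4 / real (Suc j)"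
      unfolding B_def by simp
    then show ?thesis
      unfolding test_function_diff(3)[OF \<psi> \<psi>] by (subst L2_norm_minus_commute)
  qed
  have "\<exists>u\<in>L2_fun \<phi>. (\<lambda>n. L2_norm \<phi> (\<lambda>z. dual_dbar (\<psi> n) z - u z)) \<longlonglongrightarrow> 0"
  proof (rule L2_complete[OF uL])
    fix e :: real assume "e > 0"
    obtain N where N: "8 / e\<^sup>2 < real N" using reals_Archimedean2 by blast
    have "L2_norm \<phi> (\<lambda>z. dual_dbar (\<psi> i) z - dual_dbar (\<psi> j) z) < e" if "i \<ge> N" "j \<ge> N" for i j
    proof -
      have N': "8 / e\<^sup>2 < real (Suc N)" using N by simp
      have "4 / real (Suc i) + 4 / real (Suc j) \<le> 4 / real (Suc N) + 4 / real (Suc N)"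
        using that by (intro add_mono divide_left_mono) auto
      also have "\<dots> < e\<^sup>2"
      proof -
        have "8 < e\<^sup>2 * real (Suc N)" using N' \<open>e > 0\<close> by (simp add: pos_divide_less_eq mult.commute)
        then have "8 / real (Suc N) < e\<^sup>2" by (simp add: pos_divide_less_eq del: of_nat_Suc)
        then show ?thesis by simp
      qed
      finally have "(L2_norm \<phi> (\<lambda>z. dual_dbar (\<psi> i) z - dual_dbar (\<psi> j) z))\<^sup>2 < e\<^sup>2"
        using cauchy[of i j] by linarith
      then show ?thesis by (rule power2_less_imp_less) (use \<open>e > 0\<close> in simp)
    qed
    then show "\<exists>N. \<forall>i\<ge>N. \<forall>j\<ge>N. L2_norm \<phi> (\<lambda>z. dual_dbar (\<psi> i) z - dual_dbar (\<psi> j) z) < e" by blast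
  qed
  then obtain u where u: "u \<in> L2_fun \<phi>" and ulim: "(\<lambda>n. L2_norm \<phi> (\<lambda>z. dual_dbar (\<psi> n) z - u z)) \<longlonglongrightarrow> 0"
    by blast
  have re: "Re (L2_ip \<phi> u (dual_dbar \<eta>) + L2_ip \<phi> f (dual \<eta>)) = 0" if \<eta>: "test_function \<eta>" for \<eta>
  proof -
    have "0 \<le> t * Re (L2_ip \<phi> u (dual_dbar \<eta>) + L2_ip \<phi> f (dual \<eta>)) + t\<^sup>2 * ((L2_norm \<phi> (dual_dbar \<eta>))\<^sup>2 / 2)" for t
    proof (rule LIMSEQ_le)
      show "(\<lambda>n. - (1 / real (Suc n))) \<longlonglongrightarrow> 0"
        using tendsto_minus[OF LIMSEQ_inverse_real_of_nat] by (simp add: inverse_eq_divide)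
      show "(\<lambda>n. t * (Re (L2_ip \<phi> (dual_dbar (\<psi> n)) (dual_dbar \<eta>)) + Re (L2_ip \<phi> f (dual \<eta>))) + t\<^sup>2 * ((L2_norm \<phi> (dual_dbar \<eta>))\<^sup>2 / 2))
         \<longlonglongrightarrow> t * Re (L2_ip \<phi> u (dual_dbar \<eta>) + L2_ip \<phi> f (dual \<eta>)) + t\<^sup>2 * ((L2_norm \<phi> (dual_dbar \<eta>))\<^sup>2 / 2)"
        unfolding plus_complex.sel
        by (intro tendsto_intros L2_ip_tendsto uL u ulim test_L2(4) \<eta>)
      have "- (1 / real (Suc n)) \<le> t * (Re (L2_ip \<phi> (dual_dbar (\<psi> n)) (dual_dbar \<eta>)) + Re (L2_ip \<phi> f (dual \<eta>))) + t\<^sup>2 * ((L2_norm \<phi> (dual_dbar \<eta>))\<^sup>2 / 2)" for n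
        using mle[OF test_function_add[OF \<psi>[of n] test_function_scale[OF \<eta>, of "of_real t"]]] J_add[OF \<psi>[of n] \<eta>, of t] J\<psi>[of n] by linarith
      then show "\<exists>N. \<forall>n\<ge>N. - (1 / real (Suc n)) \<le> t * (Re (L2_ip \<phi> (dual_dbar (\<psi> n)) (dual_dbar \<eta>)) + Re (L2_ip \<phi> f (dual \<eta>))) + t\<^sup>2 * ((L2_norm \<phi> (dual_dbar \<eta>))\<^sup>2 / 2)"
        by blast
    qed
    then show ?thesis by (rule nonneg_quadratic_imp_zero)
  qed
  have "weak_dbar u f"
    unfolding weak_dbar_iff
  proof (intro allI impI)
    fix \<eta> assume \<eta>: "test_function \<eta>"
    \<comment> \<open>the real parts vanish for all test functions, hence also for \<open>\<i>\<eta>\<close>, which gives the imaginary parts\<close>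
    have "Re (\<i> * (L2_ip \<phi> u (dual_dbar \<eta>) + L2_ip \<phi> f (dual \<eta>))) = 0"
      using re[OF test_function_scale[OF \<eta>, of \<i>]] unfolding dual_scale[OF \<eta>] L2_ip_scale_right by simp
    with re[OF \<eta>] have "L2_ip \<phi> u (dual_dbar \<eta>) + L2_ip \<phi> f (dual \<eta>) = 0"
      by (simp add: complex_eq_iff)
    then show "L2_ip \<phi> u (dual_dbar \<eta>) = - L2_ip \<phi> f (dual \<eta>)"
      by (simp add: eq_neg_iff_add_eq_0)
  qed
  then show thesis using that u \<psi> ulim by blast
qed

end

section \<open>The canonical solution operator and its compactness\<close>

lemma weak_dbar_cong_AE:
  assumes "f \<in> borel_measurable lebesgue" "f' \<in> borel_measurable lebesgue" "AE z in lebesgue. f z = f' z"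
    and "u \<in> borel_measurable lebesgue" "u' \<in> borel_measurable lebesgue" "AE z in lebesgue. u z = u' z"
  shows "weak_dbar u f \<longleftrightarrow> weak_dbar u' f'"
proof -
  note [measurable] = assms(1,2,4,5)
  have "(LINT z|lebesgue. u z * dbar \<psi> z) = (LINT z|lebesgue. u' z * dbar \<psi> z) \<and> (LINT z|lebesgue. f z * \<psi> z) = (LINT z|lebesgue. f' z * \<psi> z)"
    if \<psi>: "test_function \<psi>" for \<psi>
  proof -
    have "continuous_on UNIV \<psi>" "continuous_on UNIV (dx \<psi>)" "continuous_on UNIV (dy \<psi>)"
      using test_function_Ck[OF \<psi>, of 1] Ck_imp_continuous[OF test_function_Ck[OF \<psi>, of 1]] by simp_all
    then have "continuous_on UNIV \<psi>" "continuous_on UNIV (dbar \<psi>)"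
      unfolding dbar_def[abs_def] by (auto intro!: continuous_intros)
    then have [measurable]: "\<psi> \<in> borel_measurable lebesgue" "dbar \<psi> \<in> borel_measurable lebesgue"
      by (auto intro!: measurable_completion continuous_borel)
    show ?thesis
      using assms(3,6) by (auto intro!: integral_cong_AE elim!: AE_mp)
  qed
  then show ?thesis unfolding weak_dbar_def by simp
qed

context holder_weight
begin

lemma L2_norm_triangle_diff:
  assumes "f \<in> L2_fun \<phi>" "g \<in> L2_fun \<phi>"
  shows "L2_norm \<phi> f \<le> L2_norm \<phi> (\<lambda>z. f z - g z) + L2_norm \<phi> g"
  using L2_triangle[OF L2_diff[OF assms] assms(2)] by simp

text \<open>
  The difference of two solutions is weakly annihilated by \<open>dbar\<close>, hence orthogonal to
  every \<open>dual_dbar \<psi>\<close> and to the limit \<open>u\<close>.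
\<close>

lemma Pythagoras_solutions:
  assumes u: "u \<in> L2_fun \<phi>" "weak_dbar u f" and v: "v \<in> L2_fun \<phi>" "weak_dbar v f"
    and \<psi>: "\<And>n. test_function (\<psi> n)" and lim: "(\<lambda>n. L2_norm \<phi> (\<lambda>z. dual_dbar (\<psi> n) z - u z)) \<longlonglongrightarrow> 0"
  shows "(L2_norm \<phi> v)\<^sup>2 = (L2_norm \<phi> u)\<^sup>2 + (L2_norm \<phi> (\<lambda>z. v z - u z))\<^sup>2"
proof -
  let ?d = "\<lambda>z. v z - u z"
  have d: "?d \<in> L2_fun \<phi>" by (intro L2_diff u v)
  have "L2_ip \<phi> (dual_dbar (\<psi> n)) ?d = 0" for n
  proof -
    have "L2_ip \<phi> ?d (dual_dbar (\<psi> n)) = 0"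
      using u(2) v(2) \<psi>[of n] unfolding weak_dbar_iff
      by (simp add: L2_ip_diff_left[OF v(1) u(1) test_L2(4)[OF \<psi>]])
    then show ?thesis by (subst L2_ip_cnj) simp
  qed
  moreover have "(\<lambda>n. L2_ip \<phi> (dual_dbar (\<psi> n)) ?d) \<longlonglongrightarrow> L2_ip \<phi> u ?d"
    by (rule L2_ip_tendsto[OF test_L2(4)[OF \<psi>] d u(1) lim])
  ultimately have "L2_ip \<phi> u ?d = 0"
    by (simp add: LIMSEQ_const_iff)
  then show ?thesis
    using L2_norm_add_sq[OF u(1) d] by simp
qed

lemma canonical_solution_exists:
  assumes lim: "filterlim (\<lambda>z. mass z 1) at_top at_infinity" and f: "f \<in> L2_fun \<phi>"
  obtains u where "canonical_solution \<phi> f u"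
    "\<And>v. canonical_solution \<phi> f v \<Longrightarrow> AE z in lebesgue. v z = u z"
    "\<And>e. e > 0 \<Longrightarrow> \<exists>\<psi>. test_function \<psi> \<and> L2_norm \<phi> (\<lambda>z. dual_dbar \<psi> z - u z) < e"
proof -
  obtain u \<psi> where u: "u \<in> L2_fun \<phi>" "weak_dbar u f" and \<psi>: "\<And>n. test_function (\<psi> n)"
    and ul: "(\<lambda>n. L2_norm \<phi> (\<lambda>z. dual_dbar (\<psi> n) z - u z)) \<longlonglongrightarrow> 0"
    by (rule minimizer_exists[OF lim f]) (use that in blast)
  note pyth = Pythagoras_solutions[OF u _ _ \<psi> ul]
  have can: "canonical_solution \<phi> f u"
    unfolding canonical_solution_def
  proof (intro conjI ballI impI u)
    fix v assume "v \<in> L2_fun \<phi>" "weak_dbar v f"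
    then have "(L2_norm \<phi> u)\<^sup>2 \<le> (L2_norm \<phi> v)\<^sup>2" using pyth by simp
    then show "L2_norm \<phi> u \<le> L2_norm \<phi> v" by (rule power2_le_imp_le) (rule L2_norm_nonneg)
  qed
  have uniq: "AE z in lebesgue. v z = u z" if "canonical_solution \<phi> f v" for v
  proof -
    have v: "v \<in> L2_fun \<phi>" "weak_dbar v f" and "L2_norm \<phi> v \<le> L2_norm \<phi> u"
      using that u unfolding canonical_solution_def by auto
    then have "(L2_norm \<phi> v)\<^sup>2 \<le> (L2_norm \<phi> u)\<^sup>2" by (intro power_mono L2_norm_nonneg)
    then have "L2_norm \<phi> (\<lambda>z. v z - u z) = 0" using pyth[OF v] by simp
    then show ?thesis
      using L2_norm_eq_0_iff[OF L2_diff[OF v(1) u(1)]] by simp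
  qed
  have "\<exists>\<psi>. test_function \<psi> \<and> L2_norm \<phi> (\<lambda>z. dual_dbar \<psi> z - u z) < e" if e: "e > 0" for e
  proof -
    from LIMSEQ_D[OF ul e] obtain n where "norm (L2_norm \<phi> (\<lambda>z. dual_dbar (\<psi> n) z - u z) - 0) < e" by blast
    then show ?thesis using \<psi>[of n] by auto
  qed
  with can uniq show thesis using that by blast
qed

text \<open>
  The set of all canonical solutions for all representatives of \<open>F\<close> is one full class.
\<close>

lemma canonical_solution_operator_eq:
  assumes lim: "filterlim (\<lambda>z. mass z 1) at_top at_infinity" and F: "F \<in> L2_space \<phi>" "f \<in> F"
    and u: "canonical_solution \<phi> f u"
  shows "canonical_solution_operator \<phi> F = L2_class \<phi> u"
proof -
  have f: "f \<in> L2_fun \<phi>" by (rule L2_space_member[OF F])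
  obtain u0 where uniq: "\<And>v. canonical_solution \<phi> f v \<Longrightarrow> AE z in lebesgue. v z = u0 z"
    by (rule canonical_solution_exists[OF lim f]) (use that in blast)
  have uL: "u \<in> L2_fun \<phi>" using u by (simp add: canonical_solution_def)
  have cong: "canonical_solution \<phi> f' v \<longleftrightarrow> canonical_solution \<phi> f v" if "f' \<in> F" for f' v
  proof -
    have "f' \<in> L2_fun \<phi>" by (rule L2_space_member[OF F(1) that])
    then have "weak_dbar w f' \<longleftrightarrow> weak_dbar w f" if "w \<in> L2_fun \<phi>" for w
      using that f \<open>f' \<in> F\<close> L2_space_members_AE[OF F(1) \<open>f' \<in> F\<close> F(2)]
      by (intro weak_dbar_cong_AE) (auto dest: L2_fun_measurable)
    then show ?thesis unfolding canonical_solution_def by auto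
  qed
  have "canonical_solution \<phi> f v \<longleftrightarrow> v \<in> L2_class \<phi> u" for v
  proof
    assume v: "canonical_solution \<phi> f v"
    have "AE z in lebesgue. u z = v z"
      using uniq[OF v] uniq[OF u] by eventually_elim simp
    then show "v \<in> L2_class \<phi> u"
      using v uL by (simp add: L2_class_def L2_rel_def canonical_solution_def)
  next
    assume "v \<in> L2_class \<phi> u"
    then have v: "v \<in> L2_fun \<phi>" and ae: "AE z in lebesgue. u z = v z"
      by (auto simp: L2_class_def L2_rel_def)
    have "weak_dbar u f \<longleftrightarrow> weak_dbar v f"
      using v uL f ae by (intro weak_dbar_cong_AE) (auto dest: L2_fun_measurable)
    moreover have "L2_norm \<phi> u = L2_norm \<phi> v"
      using v uL ae by (intro L2_norm_cong_AE) (auto dest: L2_fun_measurable)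
    ultimately show "canonical_solution \<phi> f v"
      using u v unfolding canonical_solution_def by auto
  qed
  then have cls: "{v. canonical_solution \<phi> f v} = L2_class \<phi> u"
    by blast
  have "{v. \<exists>f'\<in>F. canonical_solution \<phi> f' v} = {v. canonical_solution \<phi> f v}"
    using cong F(2) by blast
  with cls show ?thesis
    by (simp only: canonical_solution_operator_def)
qed

text \<open>
  Expand \<open>\<langle>w, w\<rangle>\<close> with \<open>w = dual_dbar \<psi> + (w - dual_dbar
  \<psi>)\<close> and use the weak equation in the first term. If \<open>dual_dbar \<psi>\<close> is
  close to \<open>w\<close>, then \<open>\<parallel>w\<parallel>\<close> is small whenever \<open>dual
  \<psi>\<close> is.
\<close>

lemma solution_difference_bound:
  assumes f: "f \<in> L2_fun \<phi>" and w: "w \<in> L2_fun \<phi>" "weak_dbar w f" and \<psi>: "test_function \<psi>"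
  shows "(L2_norm \<phi> w)\<^sup>2 \<le> L2_norm \<phi> f * L2_norm \<phi> (dual \<psi>) + L2_norm \<phi> w * L2_norm \<phi> (\<lambda>z. w z - dual_dbar \<psi> z)"
proof -
  note D = test_L2(4)[OF \<psi>] and A = test_L2(1)[OF \<psi>]
  have "complex_of_real ((L2_norm \<phi> w)\<^sup>2) = L2_ip \<phi> w w"
    by (rule L2_ip_self[symmetric])
  also have "\<dots> = L2_ip \<phi> w (dual_dbar \<psi>) + L2_ip \<phi> w (\<lambda>z. w z - dual_dbar \<psi> z)"
    using L2_ip_diff_right[OF w(1) D w(1)] by simp
  also have "L2_ip \<phi> w (dual_dbar \<psi>) = - L2_ip \<phi> f (dual \<psi>)"
    using w(2) \<psi> by (simp add: weak_dbar_iff)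
  finally have "norm (complex_of_real ((L2_norm \<phi> w)\<^sup>2)) \<le> norm (L2_ip \<phi> f (dual \<psi>)) + norm (L2_ip \<phi> w (\<lambda>z. w z - dual_dbar \<psi> z))"
    by (metis norm_minus_cancel norm_triangle_ineq)
  also have "\<dots> \<le> L2_norm \<phi> f * L2_norm \<phi> (dual \<psi>) + L2_norm \<phi> w * L2_norm \<phi> (\<lambda>z. w z - dual_dbar \<psi> z)"
    by (intro add_mono L2_Cauchy_Schwarz f w A L2_diff D)
  finally show ?thesis by (simp only: norm_of_real abs_power2)
qed

text \<open>
  The image of a bounded set is totally bounded. Choose for each solution a test function
  \<open>\<psi>\<close> with \<open>dual_dbar \<psi>\<close> close to it. By the compactness estimate,
  the distance of two elements \<open>dual \<psi>\<close> is small once finitely many cell integrals of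
  the two functions are close, and bounded families of such tuples have finite nets.
\<close>

lemma sufficiency:
  assumes lim: "filterlim (\<lambda>z. mass z 1) at_top at_infinity"
  shows "compact_operator_L2 \<phi> (canonical_solution_operator \<phi>)"
proof -
  interpret L: Metric_space "L2_space \<phi>" "L2_dist \<phi>"
    by (rule Metric_space_L2[OF \<phi>_lebesgue])
  obtain K where K: "K > 0" "\<And>\<psi>. admissible \<psi> \<Longrightarrow> L2_norm \<phi> (dual \<psi>) \<le> K * L2_norm \<phi> (dual_dbar \<psi>)"
    using coercive[OF lim] by blast
  let ?T = "canonical_solution_operator \<phi>"
  define f where "f F = (SOME f. f \<in> F)" for F :: "(complex \<Rightarrow> complex) set"
  have f: "f F \<in> F" "f F \<in> L2_fun \<phi>" if "F \<in> L2_space \<phi>" for F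
    unfolding f_def using L2_space_some_in[OF that] by auto
  have "\<exists>u. canonical_solution \<phi> (f F) u \<and> (\<forall>e>0. \<exists>\<psi>. test_function \<psi> \<and> L2_norm \<phi> (\<lambda>z. dual_dbar \<psi> z - u z) < e)"
    if F: "F \<in> L2_space \<phi>" for F
    by (rule canonical_solution_exists[OF lim f(2)[OF F]]) blast
  then obtain u where u: "\<And>F. F \<in> L2_space \<phi> \<Longrightarrow> canonical_solution \<phi> (f F) (u F)"
    and appr: "\<And>F e. F \<in> L2_space \<phi> \<Longrightarrow> e > 0 \<Longrightarrow> \<exists>\<psi>. test_function \<psi> \<and> L2_norm \<phi> (\<lambda>z. dual_dbar \<psi> z - u F z) < e"
    by metis
  have uL: "u F \<in> L2_fun \<phi>" "weak_dbar (u F) (f F)" if "F \<in> L2_space \<phi>" for F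
    using u[OF that] by (auto simp: canonical_solution_def)
  have T: "?T F = L2_class \<phi> (u F)" if "F \<in> L2_space \<phi>" for F
    by (rule canonical_solution_operator_eq[OF lim that f(1)[OF that] u[OF that]])
  have T_in: "?T F \<in> L2_space \<phi>" "u F \<in> ?T F" if "F \<in> L2_space \<phi>" for F
    unfolding T[OF that] by (rule L2_class_in[OF uL(1)[OF that]], rule L2_class_self[OF uL(1)[OF that]])
  have "compactin L.mtopology (L.mtopology closure_of (?T ` B))" if B: "L.mbounded B" for B
  proof -
    obtain c0 R where cR: "B \<subseteq> L.mcball c0 R"
      using B unfolding L.mbounded_def by blast
    show ?thesis
    proof (cases "B = {}")
      case False
      then obtain F0 where F0: "F0 \<in> B" by blast
      then have "F0 \<in> L.mcball c0 R" using cR by blast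
      then have c: "c0 \<in> L2_space \<phi>" by simp
      have BL: "F \<in> L2_space \<phi>" if "F \<in> B" for F using that cR by auto
      define M where "M = R + L2_norm \<phi> (f c0)"
      have fM: "L2_norm \<phi> (f F) \<le> M" if "F \<in> B" for F
      proof -
        have "L2_dist \<phi> c0 F \<le> R" using cR that by auto
        then have "L2_norm \<phi> (\<lambda>z. f F z - f c0 z) \<le> R"
          unfolding L2_dist_eq[OF c f(1)[OF c] BL[OF that] f(1)[OF BL[OF that]]]
          by (subst L2_norm_minus_commute)
        then show ?thesis
          using L2_norm_triangle_diff[OF f(2)[OF BL[OF that]] f(2)[OF c]] by (simp add: M_def)
      qed
      have M0: "M \<ge> 0" using order_trans[OF L2_norm_nonneg fM[OF F0]] .
      \<comment> \<open>bounds all solutions with data in \<open>B\<close>, by the difference bound for an approximant within distance \<open>1\<close>\<close>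
      define C where "C = 2 * (M * K) + 1"
      have C1: "C \<ge> 1" using M0 K(1) by (simp add: C_def)
      have uC: "L2_norm \<phi> (u F) \<le> C" if "F \<in> B" for F
      proof -
        let ?x = "L2_norm \<phi> (u F)"
        note FL = BL[OF that]
        obtain \<psi> where \<psi>: "test_function \<psi>" "L2_norm \<phi> (\<lambda>z. dual_dbar \<psi> z - u F z) < 1"
          using appr[OF FL, of 1] by auto
        have d: "L2_norm \<phi> (dual_dbar \<psi>) \<le> 1 + ?x"
          using L2_norm_triangle_diff[OF test_L2(4)[OF \<psi>(1)] uL(1)[OF FL]] \<psi>(2) by simp
        have "L2_norm \<phi> (dual \<psi>) \<le> K * (1 + ?x)"
          by (rule order_trans[OF K(2)[OF test_admissible[OF \<psi>(1)]] mult_left_mono[OF d less_imp_le[OF K(1)]]])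
        then have "L2_norm \<phi> (f F) * L2_norm \<phi> (dual \<psi>) \<le> M * (K * (1 + ?x))"
          using fM[OF that] M0 by (intro mult_mono) (auto simp: L2_norm_nonneg)
        moreover have "?x * L2_norm \<phi> (\<lambda>z. u F z - dual_dbar \<psi> z) \<le> ?x * 1"
          using \<psi>(2) by (intro mult_left_mono) (auto simp: L2_norm_minus_commute[of _ "u F"] L2_norm_nonneg)
        ultimately have le: "?x\<^sup>2 \<le> (M * K) * (1 + ?x) + ?x"
          using solution_difference_bound[OF f(2)[OF FL] uL[OF FL] \<psi>(1)] by (simp add: mult.assoc)
        show ?thesis
        proof (rule ccontr)
          assume n: "\<not> ?x \<le> C"
          then have "?x > 1" using C1 by simp
          have "(M * K) * (1 + ?x) \<le> (M * K) * (2 * ?x)"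
            using \<open>?x > 1\<close> M0 K(1) by (intro mult_left_mono) auto
          then have "?x\<^sup>2 \<le> C * ?x"
            using le by (simp add: C_def algebra_simps)
          then show False using n \<open>?x > 1\<close> by (simp add: power2_eq_square)
        qed
      qed
      have "L.mtotally_bounded (?T ` B)"
        unfolding L.mtotally_bounded_def
      proof (intro allI impI)
        fix e :: real assume e: "e > 0"
        \<comment> \<open>accuracy of the approximants, chosen so that the error term of the difference bound is at most \<open>e\<^sup>2 / 4\<close>\<close>
        define \<delta> where "\<delta> = min 1 (e\<^sup>2 / (16 * C))"
        have \<delta>: "\<delta> > 0" "\<delta> \<le> 1" using e C1 by (auto simp: \<delta>_def)
        have \<delta>C: "2 * C * (2 * \<delta>) \<le> e\<^sup>2 / 4"
        proof -
          have "\<delta> * (16 * C) \<le> e\<^sup>2" using C1 by (simp add: \<delta>_def min_def pos_le_divide_eq[symmetric])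
          then show ?thesis by (simp add: mult_ac)
        qed
        \<comment> \<open>bound for the squared norm of \<open>dual \<psi>\<close> that makes the main term at most \<open>e\<^sup>2 / 4\<close>; \<open>\<epsilon>\<close> and \<open>s\<close> each use up half of it\<close>
        define \<tau> where "\<tau> = (e\<^sup>2 / (8 * (M + 1)))\<^sup>2"
        have \<tau>: "\<tau> > 0" using e M0 by (simp add: \<tau>_def)
        define \<epsilon> where "\<epsilon> = \<tau> / (2 * (2 * C + 2)\<^sup>2)"
        have \<epsilon>: "\<epsilon> > 0" using \<tau> C1 by (simp add: \<epsilon>_def)
        obtain r I where I: "r > 0" "finite I" "\<And>\<psi>. admissible \<psi> \<Longrightarrow>
            (L2_norm \<phi> (dual \<psi>))\<^sup>2 \<le> \<epsilon> * (L2_norm \<phi> (dual_dbar \<psi>))\<^sup>2 + (\<Sum>p\<in>I. (norm (cell_integral r p \<psi>))\<^sup>2) / r\<^sup>2"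
          using compactness_estimate[OF lim \<epsilon>] by blast
        have "\<exists>\<psi>. test_function \<psi> \<and> L2_norm \<phi> (\<lambda>z. dual_dbar \<psi> z - u F z) < \<delta>" if "F \<in> B" for F
          using appr[OF BL[OF that] \<delta>(1)] .
        then obtain \<psi> where \<psi>: "\<And>F. F \<in> B \<Longrightarrow> test_function (\<psi> F)"
          and \<psi>u: "\<And>F. F \<in> B \<Longrightarrow> L2_norm \<phi> (\<lambda>z. dual_dbar (\<psi> F) z - u F z) < \<delta>"
          by metis
        define c where "c p F = cell_integral r p (\<psi> F)" for p F
        have cb: "bounded (c p ` B)" for p
        proof (rule boundedI)
          fix x assume "x \<in> c p ` B"
          then obtain F where F: "F \<in> B" "x = c p F" by blast
          have d: "L2_norm \<phi> (dual_dbar (\<psi> F)) \<le> 1 + C"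
            using L2_norm_triangle_diff[OF test_L2(4)[OF \<psi>[OF F(1)]] uL(1)[OF BL[OF F(1)]]] \<psi>u[OF F(1)] uC[OF F(1)] \<delta> by simp
          have "L2_norm \<phi> (dual (\<psi> F)) \<le> K * (1 + C)"
            by (rule order_trans[OF K(2)[OF test_admissible[OF \<psi>[OF F(1)]]] mult_left_mono[OF d less_imp_le[OF K(1)]]])
          from order_trans[OF cell_average_bound[OF test_admissible[OF \<psi>[OF F(1)]] I(1), of p] mult_left_mono[OF this less_imp_le[OF I(1)]]]
          show "norm x \<le> r * (K * (1 + C))"
            unfolding F(2) c_def .
        qed
        define s where "s = sqrt (r\<^sup>2 * \<tau> / (2 * (real (card I) + 1)))"
        have s: "s > 0" using I(1) \<tau> by (simp add: s_def)
        obtain Y where Y: "Y \<subseteq> B" "finite Y" "\<And>F. F \<in> B \<Longrightarrow> \<exists>G\<in>Y. \<forall>p\<in>I. norm (c p F - c p G) \<le> s"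
          by (rule finite_net[of I c B s]) (use I(2) cb s that in blast)+
        have close: "L2_dist \<phi> (?T G) (?T F) < e" if F: "F \<in> B" and G: "G \<in> B" and FG: "\<forall>p\<in>I. norm (c p F - c p G) \<le> s" for F G
        proof -
          let ?w = "\<lambda>z. u G z - u F z" and ?f = "\<lambda>z. f G z - f F z" and ?\<psi> = "\<lambda>z. \<psi> G z - \<psi> F z"
          note FL = BL[OF F] and GL = BL[OF G]
          note t = test_function_diff[OF \<psi>[OF G] \<psi>[OF F]]
          have w: "?w \<in> L2_fun \<phi>" and fd: "?f \<in> L2_fun \<phi>"
            by (intro L2_diff uL f FL GL)+
          have wd: "weak_dbar ?w ?f"
            unfolding weak_dbar_iff
          proof (intro allI impI)
            fix \<eta> assume \<eta>: "test_function \<eta>"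
            show "L2_ip \<phi> ?w (dual_dbar \<eta>) = - L2_ip \<phi> ?f (dual \<eta>)"
              using uL(2)[OF GL] uL(2)[OF FL] \<eta> unfolding weak_dbar_iff
              by (simp add: L2_ip_diff_left[OF uL(1)[OF GL] uL(1)[OF FL] test_L2(4)[OF \<eta>]]
                  L2_ip_diff_left[OF f(2)[OF GL] f(2)[OF FL] test_L2(1)[OF \<eta>]])
          qed
          have nw: "L2_norm \<phi> ?w \<le> 2 * C"
            using L2_triangle[OF uL(1)[OF GL] L2_fun_uminus[OF uL(1)[OF FL]]] uC[OF F] uC[OF G]
            by (simp add: L2_norm_def)
          have nf: "L2_norm \<phi> ?f \<le> 2 * M"
            using L2_triangle[OF f(2)[OF GL] L2_fun_uminus[OF f(2)[OF FL]]] fM[OF F] fM[OF G]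
            by (simp add: L2_norm_def)
          have err: "L2_norm \<phi> (\<lambda>z. ?w z - dual_dbar ?\<psi> z) \<le> 2 * \<delta>"
          proof -
            have "L2_norm \<phi> (\<lambda>z. (u G z - dual_dbar (\<psi> G) z) + (dual_dbar (\<psi> F) z - u F z))
               \<le> L2_norm \<phi> (\<lambda>z. u G z - dual_dbar (\<psi> G) z) + L2_norm \<phi> (\<lambda>z. dual_dbar (\<psi> F) z - u F z)"
              by (intro L2_triangle L2_diff uL test_L2(4) \<psi> F G FL GL)
            also have "\<dots> \<le> \<delta> + \<delta>"
              using \<psi>u[OF F] \<psi>u[OF G] by (simp add: L2_norm_minus_commute[of \<phi> "u G"])
            finally show ?thesis by (simp add: t algebra_simps)
          qed
          have nd: "L2_norm \<phi> (dual_dbar ?\<psi>) \<le> 2 * C + 2"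
            using L2_norm_triangle_diff[OF test_L2(4)[OF t(1)] w] err nw \<delta>(2)
            by (simp add: L2_norm_minus_commute[of \<phi> "dual_dbar ?\<psi>"])
          have csum: "(\<Sum>p\<in>I. (norm (cell_integral r p ?\<psi>))\<^sup>2) / r\<^sup>2 \<le> \<tau> / 2"
          proof -
            have "cell_integral r p ?\<psi> = c p G - c p F" for p
            proof -
              have i: "set_integrable lborel (grid_cell r p) (weighted (\<psi> H))" if "H \<in> B" for H
                unfolding grid_cell_def
                by (rule set_integrable_continuous_bounded[OF _ square_borel square_bounded])
                   (intro continuous_intros continuous_\<phi> continuous_admissible test_admissible \<psi> that)
              show ?thesis
                unfolding c_def using i[OF F] i[OF G] by (simp add: left_diff_distrib set_integral_diff)
            qed
            then have "(\<Sum>p\<in>I. (norm (cell_integral r p ?\<psi>))\<^sup>2) \<le> (\<Sum>p\<in>I. s\<^sup>2)"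
              using FG by (intro sum_mono power_mono) (auto simp: norm_minus_commute)
            also have "\<dots> \<le> (real (card I) + 1) * s\<^sup>2" by (simp add: algebra_simps)
            also have "\<dots> = r\<^sup>2 * \<tau> / 2"
              using I(1) \<tau> by (simp add: s_def add_pos_nonneg field_simps)
            finally show ?thesis using I(1) by (simp add: pos_divide_le_eq mult.commute)
          qed
          have "(L2_norm \<phi> (dual ?\<psi>))\<^sup>2 \<le> \<epsilon> * (2 * C + 2)\<^sup>2 + \<tau> / 2"
          proof -
            have "\<epsilon> * (L2_norm \<phi> (dual_dbar ?\<psi>))\<^sup>2 \<le> \<epsilon> * (2 * C + 2)\<^sup>2"
              using nd \<epsilon> by (intro mult_left_mono power_mono) (auto simp: L2_norm_nonneg)
            then show ?thesis using I(3)[OF test_admissible[OF t(1)]] csum by linarith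
          qed
          also have "\<dots> = \<tau>" using C1 by (simp add: \<epsilon>_def)
          finally have "L2_norm \<phi> (dual ?\<psi>) \<le> e\<^sup>2 / (8 * (M + 1))"
            unfolding \<tau>_def by (rule power2_le_imp_le) (use M0 in auto)
          then have "L2_norm \<phi> ?f * L2_norm \<phi> (dual ?\<psi>) \<le> (2 * (M + 1)) * (e\<^sup>2 / (8 * (M + 1)))"
            using nf M0 by (intro mult_mono) (auto simp: L2_norm_nonneg)
          also have "\<dots> = e\<^sup>2 / 4" using M0 by (simp add: field_simps)
          finally have a1: "L2_norm \<phi> ?f * L2_norm \<phi> (dual ?\<psi>) \<le> e\<^sup>2 / 4" .
          have "L2_norm \<phi> ?w * L2_norm \<phi> (\<lambda>z. ?w z - dual_dbar ?\<psi> z) \<le> 2 * C * (2 * \<delta>)"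
            using nw err C1 by (intro mult_mono) (auto simp: L2_norm_nonneg)
          with a1 \<delta>C solution_difference_bound[OF fd w wd t(1)]
          have "(L2_norm \<phi> ?w)\<^sup>2 \<le> e\<^sup>2 / 2" by linarith
          also have "\<dots> < e\<^sup>2" using e by simp
          finally have "L2_norm \<phi> ?w < e" by (rule power2_less_imp_less) (use e in simp)
          then show ?thesis
            unfolding L2_dist_eq[OF T_in[OF GL] T_in[OF FL]] .
        qed
        show "\<exists>Z. finite Z \<and> Z \<subseteq> ?T ` B \<and> ?T ` B \<subseteq> (\<Union>x\<in>Z. L.mball x e)"
        proof (intro exI conjI)
          show "finite (?T ` Y)" "?T ` Y \<subseteq> ?T ` B" using Y by auto
          show "?T ` B \<subseteq> (\<Union>x\<in>?T ` Y. L.mball x e)"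
          proof
            fix x assume "x \<in> ?T ` B"
            then obtain F where F: "F \<in> B" "x = ?T F" by blast
            obtain G where G: "G \<in> Y" "\<forall>p\<in>I. norm (c p F - c p G) \<le> s" using Y(3)[OF F(1)] by blast
            have "G \<in> B" using G(1) Y(1) by blast
            then have "x \<in> L.mball (?T G) e"
              using close[OF F(1) _ G(2)] T_in(1)[OF BL] F by simp
            then show "x \<in> (\<Union>x\<in>?T ` Y. L.mball x e)" using G(1) by blast
          qed
        qed
      qed
      then show ?thesis
        using L.mtotally_bounded_eq_compact_closure_of[OF L2_mcomplete] by blast
    qed simp
  qed
  then show ?thesis
    unfolding compact_operator_L2_def using T_in(1) by auto
qed

end

section \<open>Testing the equation with continuously differentiable functions\<close>

text \<open>
  The family \<open>x\<^sup>-\<^sup>n exp (-1/x)\<close> is closed under differentiation up to linear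
  combinations, which makes smoothness of the bump a plain induction.
\<close>

definition flat_exp :: "nat \<Rightarrow> real \<Rightarrow> real" where
  "flat_exp n x = (if x > 0 then (inverse x) ^ n * exp (- inverse x) else 0)"

lemma flat_exp_tendsto_0: "(flat_exp n \<longlongrightarrow> 0) (at 0)"
proof -
  have "((\<lambda>y::real. y ^ n / exp y) \<longlongrightarrow> 0) at_top"
    by (rule tendsto_power_div_exp_0)
  from filterlim_compose[OF this filterlim_inverse_at_top_right]
  have "((\<lambda>x::real. inverse x ^ n / exp (inverse x)) \<longlongrightarrow> 0) (at_right 0)" .
  moreover have "\<forall>\<^sub>F x::real in at_right 0. inverse x ^ n / exp (inverse x) = flat_exp n x"
    using eventually_at_right_less[of "0::real"] by eventually_elim (simp add: flat_exp_def exp_minus divide_inverse)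
  ultimately have r: "(flat_exp n \<longlongrightarrow> 0) (at_right 0)"
    by (rule Lim_transform_eventually)
  have "\<forall>\<^sub>F x::real in at_left 0. 0 = flat_exp n x"
    by (auto simp: eventually_at_filter flat_exp_def)
  then have l: "(flat_exp n \<longlongrightarrow> 0) (at_left 0)"
    by (rule Lim_transform_eventually[OF tendsto_const])
  show ?thesis using l r by (simp add: filterlim_at_split)
qed

text \<open>
  At \<open>0\<close> the difference quotient of \<open>flat_exp n\<close> is \<open>flat_exp (n +
  1)\<close>, which tends to \<open>0\<close>.
\<close>

lemma flat_exp_derivative:
  "(flat_exp n has_real_derivative flat_exp (n + 2) x - of_nat n * flat_exp (n + 1) x) (at x)"
proof (cases x "0::real" rule: linorder_cases)
  case less
  have "((\<lambda>_. 0) has_real_derivative 0) (at x)" by simp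
  then have "(flat_exp n has_real_derivative 0) (at x)"
    by (rule has_field_derivative_transform_within_open[where S="{..<0}"]) (use less in \<open>auto simp: flat_exp_def\<close>)
  then show ?thesis using less by (simp add: flat_exp_def)
next
  case equal
  have "((\<lambda>h. flat_exp n h / h) \<longlongrightarrow> 0) (at 0)"
  proof (rule Lim_transform_eventually[OF flat_exp_tendsto_0[of "n + 1"]])
    show "\<forall>\<^sub>F h in at 0. flat_exp (n + 1) h = flat_exp n h / h"
      by (rule always_eventually) (simp add: flat_exp_def field_simps)
  qed
  then have "(flat_exp n has_real_derivative 0) (at 0)"
    by (simp add: has_field_derivative_iff flat_exp_def)
  then show ?thesis using equal by (simp add: flat_exp_def)
next
  case greater
  have i: "(inverse has_real_derivative - (inverse x)\<^sup>2) (at x)"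
    using DERIV_inverse[of x] greater by (simp add: power2_eq_square)
  have ex: "((\<lambda>x. exp (- inverse x)) has_real_derivative exp (- inverse x) * (inverse x)\<^sup>2) (at x)"
    using DERIV_chain2[OF DERIV_exp DERIV_minus[OF i]] by simp
  have "((\<lambda>x. inverse x ^ n * exp (- inverse x)) has_real_derivative flat_exp (n + 2) x - of_nat n * flat_exp (n + 1) x) (at x)"
    using DERIV_mult[OF DERIV_power[OF i, of n] ex] greater
    by (cases n) (simp_all add: flat_exp_def power2_eq_square algebra_simps)
  then show ?thesis
    by (rule has_field_derivative_transform_within_open[where S="{0<..}"]) (use greater in \<open>auto simp: flat_exp_def\<close>)
qed

lemma Ck_diff:
  fixes f g :: "complex \<Rightarrow> 'a::real_normed_algebra_1"
  assumes "Ck k f" "Ck k g" shows "Ck k (\<lambda>z. f z - g z)"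
  using Ck_add[OF assms(1) Ck_mult[OF Ck_const[of k "-1"] assms(2)]] by simp

lemma Ck_id: "Ck k (\<lambda>z. z)"
proof (cases k)
  case (Suc m)
  show ?thesis unfolding Suc
    by (rule Ck_SucI(1)[where p="\<lambda>_. 1" and q="\<lambda>_. \<i>"])
       (auto simp: scaleR_conv_of_real complex_eq_iff intro!: has_derivative_eq_rhs[OF has_derivative_ident])
qed auto

lemma Ck_Re_Im: "Ck k Re" "Ck k Im"
  using Ck_bounded_linear[OF bounded_linear_Re Ck_id] Ck_bounded_linear[OF bounded_linear_Im Ck_id] by auto

definition bump :: "real \<Rightarrow> complex \<Rightarrow> real" where
  "bump s z = flat_exp 0 (s\<^sup>2 - (norm z)\<^sup>2)"

lemma Ck_flat_exp_norm: "Ck k (\<lambda>z. flat_exp n (c - (norm z)\<^sup>2))"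
proof (induction k arbitrary: n)
  case 0
  have "isCont (flat_exp n) x" for x
    using flat_exp_derivative by (rule DERIV_isCont)
  then have "continuous_on UNIV (flat_exp n)"
    by (simp add: continuous_at_imp_continuous_on)
  then have "continuous_on UNIV (\<lambda>z::complex. flat_exp n (c - (norm z)\<^sup>2))"
    by (rule continuous_on_compose2) (auto intro!: continuous_intros)
  then show ?case by simp
next
  case (Suc k)
  let ?D = "\<lambda>z. flat_exp (n + 2) (c - (norm z)\<^sup>2) - of_nat n * flat_exp (n + 1) (c - (norm z)\<^sup>2)"
  have D: "Ck k ?D" by (intro Ck_diff Ck_mult Ck_const Suc)
  have "((\<lambda>z. flat_exp n (c - (norm z)\<^sup>2)) has_derivative (\<lambda>h. Re h *\<^sub>R (- 2 * Re z * ?D z) + Im h *\<^sub>R (- 2 * Im z * ?D z))) (at z)" for z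
  proof -
    have "((\<lambda>z. c - (norm z)\<^sup>2) has_derivative (\<lambda>h. - 2 * (Re z * Re h + Im z * Im h))) (at z)"
      unfolding cmod_power2 by (auto intro!: derivative_eq_intros simp: algebra_simps)
    from has_derivative_compose[OF this flat_exp_derivative[of n "c - (norm z)\<^sup>2", unfolded has_field_derivative_def]]
    show ?thesis by (simp add: algebra_simps)
  qed
  then show ?case
    by (rule Ck_SucI(1)) (intro Ck_mult Ck_const D Ck_Re_Im)+
qed

lemma bump:
  shows "Ck k (bump s)" "0 \<le> bump s z" "bump s z \<le> 1" "s > 0 \<Longrightarrow> bump s z \<noteq> 0 \<longleftrightarrow> norm z < s" "bump s (- z) = bump s z"
proof -
  show "Ck k (bump s)" unfolding bump_def[abs_def] by (rule Ck_flat_exp_norm)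
  show "0 \<le> bump s z" "bump s z \<le> 1" "bump s (- z) = bump s z"
    by (auto simp: bump_def flat_exp_def)
  show "bump s z \<noteq> 0 \<longleftrightarrow> norm z < s" if "s > 0"
  proof -
    have "(norm z)\<^sup>2 < s\<^sup>2 \<longleftrightarrow> norm z < s"
      using that by (metis abs_norm_cancel abs_of_pos power2_less_imp_less power_strict_mono less_imp_le norm_ge_zero pos2)
    then show ?thesis by (auto simp: bump_def flat_exp_def)
  qed
qed

lemma continuous_bump: "continuous_on UNIV (bump s)"
  by (rule Ck_imp_continuous[OF bump(1)])

lemma bounded_bump: "s > 0 \<Longrightarrow> bounded {z. bump s z \<noteq> 0}"
  by (rule bounded_subset[OF bounded_ball[of 0 s]]) (auto simp: bump(4))

lemma integrable_bump: "s > 0 \<Longrightarrow> integrable lborel (bump s)"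
  by (intro integrable_compact_support continuous_bump bounded_bump)

lemma continuous_nonneg_integral_pos:
  fixes g :: "complex \<Rightarrow> real"
  assumes i: "integrable lborel g" and c: "continuous_on UNIV g" and nn: "\<And>z. 0 \<le> g z" and z0: "g z0 > 0"
  shows "integral\<^sup>L lborel g > 0"
proof (rule ccontr)
  assume "\<not> integral\<^sup>L lborel g > 0"
  moreover have "0 \<le> integral\<^sup>L lborel g"
    by (rule Bochner_Integration.integral_nonneg) (rule nn)
  ultimately have "integral\<^sup>L lborel g = 0" by linarith
  then have ae: "AE z in lborel. g z = 0"
    using integral_nonneg_eq_0_iff_AE[OF i] nn by simp
  have o: "open {z. g z > 0}"
    using c open_Collect_less[of "\<lambda>_. 0" g] by simp
  then obtain e where e: "e > 0" "ball z0 e \<subseteq> {z. g z > 0}"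
    using z0 openE[OF o, of z0] by blast
  have sub: "z \<notin> ball z0 e" if "g z = 0" for z
    using e(2) that by force
  have "AE z in lborel. z \<notin> ball z0 e"
    using ae by eventually_elim (rule sub)
  then have "emeasure lborel (ball z0 e) = 0"
    by (subst (asm) AE_iff_measurable[of "ball z0 e"]) auto
  then have "measure lborel (ball z0 e) = 0" by (simp add: measure_def)
  then show False using area_ball[of e z0] e by simp
qed

lemma integral_bump_pos: "s > 0 \<Longrightarrow> integral\<^sup>L lborel (bump s) > 0"
  by (rule continuous_nonneg_integral_pos[OF integrable_bump continuous_bump bump(2), of _ 0])
     (auto simp: bump_def flat_exp_def)

lemma integral_translate:
  fixes g :: "complex \<Rightarrow> 'a::{banach, second_countable_topology}"
  assumes [measurable]: "g \<in> borel_measurable borel"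
  shows "(\<integral>w. g (w - z) \<partial>lborel) = (\<integral>w. g w \<partial>lborel)"
proof -
  have "(\<integral>w. g w \<partial>lborel) = (\<integral>w. g w \<partial>(distr lborel borel ((+) (- z))))"
    by (simp add: lborel_distr_plus)
  also have "\<dots> = (\<integral>w. g (- z + w) \<partial>lborel)"
    by (subst integral_distr) auto
  finally show ?thesis by simp
qed

text \<open>
  Meant for \<open>\<psi>\<close> supported in the box. A compact domain is what differentiation under
  the integral sign asks for.
\<close>

definition conv :: "complex \<Rightarrow> complex \<Rightarrow> (complex \<Rightarrow> real) \<Rightarrow> (complex \<Rightarrow> complex) \<Rightarrow> complex \<Rightarrow> complex" where
  "conv a b q \<psi> z = integral (cbox a b) (\<lambda>w. q (z - w) *\<^sub>R \<psi> w)"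

lemma integral_cbox_lborel:
  fixes F :: "complex \<Rightarrow> complex"
  assumes c: "continuous_on UNIV F" and s: "\<And>w. F w \<noteq> 0 \<Longrightarrow> w \<in> cbox a b"
  shows "integral (cbox a b) F = (\<integral>w. F w \<partial>lborel)"
proof -
  have "integrable lborel F"
    by (rule integrable_compact_support[OF c]) (rule bounded_subset[OF bounded_cbox[of a b]], use s in auto)
  then have "(F has_integral (\<integral>w. F w \<partial>lborel)) UNIV"
    by (rule has_integral_integral_lborel)
  then have "integral UNIV F = (\<integral>w. F w \<partial>lborel)" by (rule integral_unique)
  moreover have "integral UNIV F = integral (cbox a b) F"
    by (rule integral_spike_set[OF empty_imp_negligible empty_imp_negligible]) (use s in auto)
  ultimately show ?thesis by simp
qed

lemma Ck_conv:
  assumes q: "\<And>k. Ck k q" and \<psi>: "continuous_on UNIV \<psi>"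
  shows "Ck k (conv a b q \<psi>)" "dx (conv a b q \<psi>) = conv a b (dx q) \<psi>" "dy (conv a b q \<psi>) = conv a b (dy q) \<psi>"
proof -
  have cont: "continuous_on S (\<lambda>(z, w). q (z - w) *\<^sub>R \<psi> w)" if "continuous_on UNIV q" for q :: "complex \<Rightarrow> real" and S
    unfolding case_prod_unfold
    by (intro continuous_intros continuous_on_compose2[OF that] continuous_on_compose2[OF \<psi>]) auto
  have D: "(conv a b q \<psi> has_derivative (\<lambda>k. Re k *\<^sub>R conv a b (dx q) \<psi> z + Im k *\<^sub>R conv a b (dy q) \<psi> z)) (at z)"
    if q: "\<And>k. Ck k q" for q z
    unfolding conv_def[abs_def]
  proof (rule leibniz_plane(1))
    fix z t :: complex
    have "((\<lambda>z. z - t) has_derivative (\<lambda>h. h)) (at z)" by (auto intro!: derivative_eq_intros)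
    from has_derivative_compose[OF this Ck_has_derivative[OF q[of 1] order_refl]]
    have "((\<lambda>z. q (z - t)) has_derivative (\<lambda>h. Re h *\<^sub>R dx q (z - t) + Im h *\<^sub>R dy q (z - t))) (at z)" by simp
    from has_derivative_scaleR[OF this has_derivative_const[of "\<psi> t"]]
    show "((\<lambda>z. q (z - t) *\<^sub>R \<psi> t) has_derivative (\<lambda>k. Re k *\<^sub>R dx q (z - t) *\<^sub>R \<psi> t + Im k *\<^sub>R dy q (z - t) *\<^sub>R \<psi> t)) (at z)"
      by (simp add: scaleR_left.add)
  qed (use q[of "Suc 0"] Ck_imp_continuous[OF q[of 1]] in \<open>auto intro: cont simp del: \<close>)
  have C0: "continuous_on UNIV (conv a b q \<psi>)" if "continuous_on UNIV q" for q
    unfolding conv_def[abs_def] by (rule integral_continuous_on_param) (rule cont[OF that])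
  have "Ck k (conv a b q \<psi>)" if "\<And>k. Ck k q" for q
    using that
  proof (induction k arbitrary: q)
    case 0
    then show ?case using C0 Ck_imp_continuous[of 0 q] by simp
  next
    case (Suc k)
    have "Ck j (dx q)" "Ck j (dy q)" for j using Suc.prems[of "Suc j"] by simp_all
    then show ?case by (intro Ck_SucI(1)[OF D] Suc)
  qed
  then show "Ck k (conv a b q \<psi>)" using q by blast
  show "dx (conv a b q \<psi>) = conv a b (dx q) \<psi>" "dy (conv a b q \<psi>) = conv a b (dy q) \<psi>"
    using dx_eqI[OF D[OF q]] dy_eqI[OF D[OF q]] by (auto simp: fun_eq_iff)
qed

text \<open>
  Integration by parts in \<open>w\<close> moves the derivative from \<open>q (z - w)\<close> to
  \<open>\<psi> w\<close>.
\<close>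

lemma conv_derivative:
  assumes q: "\<And>k. Ck k q" and bq: "bounded {z. q z \<noteq> 0}" and \<psi>: "Ck 1 \<psi>" and s: "\<And>w. w \<notin> cball 0 R \<Longrightarrow> \<psi> w = 0" and ab: "cball 0 R \<subseteq> cbox a b"
  shows "conv a b (dx q) \<psi> = conv a b q (dx \<psi>)" "conv a b (dy q) \<psi> = conv a b q (dy \<psi>)"
proof -
  have s': "dx \<psi> w = 0" "dy \<psi> w = 0" if "w \<notin> cball 0 R" for w
    using dx_zero_outside[of R \<psi> w] s that by auto
  have c\<psi>: "continuous_on UNIV \<psi>" "continuous_on UNIV (dx \<psi>)" "continuous_on UNIV (dy \<psi>)"
    using \<psi> Ck_imp_continuous[OF \<psi>] by auto
  have cq: "continuous_on UNIV q" "continuous_on UNIV (dx q)" "continuous_on UNIV (dy q)"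
    using q[of 1] Ck_imp_continuous[OF q[of 1]] by auto
  have cc: "continuous_on UNIV (\<lambda>w. p (z - w) *\<^sub>R \<eta> w)" if "continuous_on UNIV p" "continuous_on UNIV \<eta>" for p :: "complex \<Rightarrow> real" and \<eta> :: "complex \<Rightarrow> complex" and z
    by (intro continuous_intros that continuous_on_compose2[OF that(1)]) auto
  have int: "integrable lborel (\<lambda>w. p (z - w) *\<^sub>R \<eta> w)" if "continuous_on UNIV p" "continuous_on UNIV \<eta>" "\<And>w. w \<notin> cball 0 R \<Longrightarrow> \<eta> w = 0" for p :: "complex \<Rightarrow> real" and \<eta> :: "complex \<Rightarrow> complex" and z
    by (rule integrable_compact_support[OF cc[OF that(1,2)]]) (rule bounded_subset[OF bounded_cball[of 0 R]], use that in fastforce)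
  have eq: "conv a b p \<eta> z = (\<integral>w. p (z - w) *\<^sub>R \<eta> w \<partial>lborel)" if "continuous_on UNIV p" "continuous_on UNIV \<eta>" "\<And>w. w \<notin> cball 0 R \<Longrightarrow> \<eta> w = 0" for p :: "complex \<Rightarrow> real" and \<eta> :: "complex \<Rightarrow> complex" and z
    unfolding conv_def by (rule integral_cbox_lborel[OF cc[OF that(1,2)]]) (use that(3) ab in fastforce)
  have main: "conv a b (dx q) \<psi> z = conv a b q (dx \<psi>) z \<and> conv a b (dy q) \<psi> z = conv a b q (dy \<psi>) z" for z
  proof -
    let ?F = "\<lambda>w. q (z - w) *\<^sub>R \<psi> w"
    have D: "(?F has_derivative (\<lambda>h. Re h *\<^sub>R (q (z - w) *\<^sub>R dx \<psi> w - dx q (z - w) *\<^sub>R \<psi> w) + Im h *\<^sub>R (q (z - w) *\<^sub>R dy \<psi> w - dy q (z - w) *\<^sub>R \<psi> w))) (at w)" for w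
    proof -
      have "((\<lambda>w. z - w) has_derivative (\<lambda>h. - h)) (at w)" by (auto intro!: derivative_eq_intros)
      from has_derivative_compose[OF this Ck_has_derivative[OF q[of 1] order_refl]]
      have "((\<lambda>w. q (z - w)) has_derivative (\<lambda>h. - (Re h *\<^sub>R dx q (z - w) + Im h *\<^sub>R dy q (z - w)))) (at w)" by simp
      from has_derivative_scaleR[OF this Ck_has_derivative[OF \<psi> order_refl]]
      show ?thesis by (simp add: algebra_simps)
    qed
    have C1: "Ck 1 ?F" and dF: "dx ?F = (\<lambda>w. q (z - w) *\<^sub>R dx \<psi> w - dx q (z - w) *\<^sub>R \<psi> w)" "dy ?F = (\<lambda>w. q (z - w) *\<^sub>R dy \<psi> w - dy q (z - w) *\<^sub>R \<psi> w)"
    proof -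
      have "Ck 0 (\<lambda>w. q (z - w) *\<^sub>R dx \<psi> w - dx q (z - w) *\<^sub>R \<psi> w)" "Ck 0 (\<lambda>w. q (z - w) *\<^sub>R dy \<psi> w - dy q (z - w) *\<^sub>R \<psi> w)"
        unfolding Ck.simps(1) by (intro continuous_on_diff cc cq c\<psi>)+
      from Ck_SucI[OF D this]
      show "Ck 1 ?F" "dx ?F = (\<lambda>w. q (z - w) *\<^sub>R dx \<psi> w - dx q (z - w) *\<^sub>R \<psi> w)" "dy ?F = (\<lambda>w. q (z - w) *\<^sub>R dy \<psi> w - dy q (z - w) *\<^sub>R \<psi> w)"
        unfolding One_nat_def .
    qed
    have b: "bounded {w. ?F w \<noteq> 0}"
      by (rule bounded_subset[OF bounded_cball[of 0 R]]) (use s in fastforce)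
    have "(\<integral>w. q (z - w) *\<^sub>R dx \<psi> w - dx q (z - w) *\<^sub>R \<psi> w \<partial>lborel) = 0" "(\<integral>w. q (z - w) *\<^sub>R dy \<psi> w - dy q (z - w) *\<^sub>R \<psi> w \<partial>lborel) = 0"
      using integral_dx_eq_0(3,4)[OF C1 b] unfolding dF by auto
    then show ?thesis
      using eq[OF cq(2) c\<psi>(1) s] eq[OF cq(3) c\<psi>(1) s] eq[OF cq(1) c\<psi>(2) s'(1)] eq[OF cq(1) c\<psi>(3) s'(2)]
        int[OF cq(2) c\<psi>(1) s] int[OF cq(3) c\<psi>(1) s] int[OF cq(1) c\<psi>(2) s'(1)] int[OF cq(1) c\<psi>(3) s'(2)]
      by (simp add: Bochner_Integration.integral_diff)
  qed
  then show "conv a b (dx q) \<psi> = conv a b q (dx \<psi>)" "conv a b (dy q) \<psi> = conv a b q (dy \<psi>)"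
    by (auto simp: fun_eq_iff)
qed

text \<open>
  The normalised bump is a probability density in the ball of radius \<open>e\<close>, so the mean of
  \<open>\<psi>\<close> is close to \<open>y\<close> if all values of \<open>\<psi>\<close> in that ball
  are.
\<close>

lemma conv_bump_close:
  assumes \<psi>: "continuous_on UNIV \<psi>" and s: "\<And>w. w \<notin> cball 0 R \<Longrightarrow> \<psi> w = 0" and ab: "cball 0 R \<subseteq> cbox a b" and e: "e > 0"
    and d: "\<And>w. norm (w - z) < e \<Longrightarrow> norm (\<psi> w - y) \<le> \<delta>"
  shows "norm (conv a b (bump e) \<psi> z / of_real (integral\<^sup>L lborel (bump e)) - y) \<le> \<delta>"
proof -
  let ?c = "integral\<^sup>L lborel (bump e)"
  have c: "?c > 0" by (rule integral_bump_pos[OF e])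
  have sym: "bump e (z - w) = bump e (w - z)" for w
    using bump(5)[of e "w - z"] by simp
  have cb: "continuous_on UNIV (\<lambda>w. bump e (w - z))"
    by (rule continuous_on_compose2[OF continuous_bump]) (auto intro!: continuous_intros)
  have bb: "bounded {w. bump e (w - z) \<noteq> 0}"
    by (rule bounded_subset[OF bounded_ball[of z e]]) (auto simp: bump(4)[OF e] dist_norm norm_minus_commute)
  have i1: "integrable lborel (\<lambda>w. bump e (w - z))"
    by (rule integrable_compact_support[OF cb bb])
  have i2: "integrable lborel (\<lambda>w. bump e (w - z) *\<^sub>R \<psi> w)"
    by (rule integrable_compact_support) (auto intro!: continuous_intros cb \<psi> bounded_subset[OF bb])
  have i3: "integrable lborel (\<lambda>w. bump e (w - z) *\<^sub>R y)"
    using i1 by auto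
  have I: "(\<integral>w. bump e (w - z) \<partial>lborel) = ?c"
    by (rule integral_translate) (rule continuous_borel[OF continuous_bump])
  have cv: "conv a b (bump e) \<psi> z = (\<integral>w. bump e (w - z) *\<^sub>R \<psi> w \<partial>lborel)"
    unfolding conv_def sym by (rule integral_cbox_lborel) (use s ab in \<open>fastforce intro!: continuous_intros cb \<psi>\<close>)+
  have "conv a b (bump e) \<psi> z - of_real ?c * y = (\<integral>w. bump e (w - z) *\<^sub>R (\<psi> w - y) \<partial>lborel)"
  proof -
    have "(\<integral>w. bump e (w - z) *\<^sub>R (\<psi> w - y) \<partial>lborel) = (\<integral>w. bump e (w - z) *\<^sub>R \<psi> w \<partial>lborel) - (\<integral>w. bump e (w - z) *\<^sub>R y \<partial>lborel)"
      unfolding scaleR_diff_right by (rule Bochner_Integration.integral_diff[OF i2 i3])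
    also have "(\<integral>w. bump e (w - z) *\<^sub>R y \<partial>lborel) = ?c *\<^sub>R y"
      using integral_scaleR_left[of y lborel "\<lambda>w. bump e (w - z)"] i1 I by (simp only:)
    also have "\<dots> = of_real ?c * y" by (rule scaleR_conv_of_real)
    finally show ?thesis using cv by simp
  qed
  also have "norm \<dots> \<le> (\<integral>w. norm (bump e (w - z) *\<^sub>R (\<psi> w - y)) \<partial>lborel)"
    by (rule integral_norm_bound)
  also have "\<dots> \<le> (\<integral>w. bump e (w - z) * \<delta> \<partial>lborel)"
  proof (rule integral_mono)
    show "integrable lborel (\<lambda>w. norm (bump e (w - z) *\<^sub>R (\<psi> w - y)))"
      using i2 i3 by (auto simp: scaleR_diff_right intro!: integrable_norm Bochner_Integration.integrable_diff)
    show "integrable lborel (\<lambda>w. bump e (w - z) * \<delta>)" using i1 by auto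
    show "norm (bump e (w - z) *\<^sub>R (\<psi> w - y)) \<le> bump e (w - z) * \<delta>" for w
    proof (cases "norm (w - z) < e")
      case True
      then show ?thesis using d[OF True] bump(2)[of e "w - z"] by (simp add: mult_left_mono)
    next
      case False
      then have "bump e (w - z) = 0" using bump(4)[OF e, of "w - z"] by blast
      then show ?thesis by simp
    qed
  qed
  also have "\<dots> = ?c * \<delta>" using I by simp
  finally have le: "norm (conv a b (bump e) \<psi> z - of_real ?c * y) \<le> ?c * \<delta>" .
  have "conv a b (bump e) \<psi> z / of_real ?c - y = (conv a b (bump e) \<psi> z - of_real ?c * y) / of_real ?c"
    using c by (simp add: field_simps)
  then have "norm (conv a b (bump e) \<psi> z / of_real ?c - y) = norm (conv a b (bump e) \<psi> z - of_real ?c * y) / ?c"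
    using c by (simp add: norm_divide)
  also have "\<dots> \<le> \<delta>" using le c by (simp add: pos_divide_le_eq mult.commute)
  finally show ?thesis .
qed

text \<open>
  Mollifications of \<open>\<eta>\<close> are smooth and commute with \<open>dbar\<close>; they and
  their \<open>dbar\<close>-derivatives converge pointwise, with common bounds and supports, so
  dominated convergence applies. The gauged bumps used below are only once continuously differentiable.
\<close>

lemma weak_dbar_Ck_1:
  assumes wd: "weak_dbar u f"
    and u: "\<And>R. set_integrable lebesgue (cball 0 R) u" and f: "\<And>R. set_integrable lebesgue (cball 0 R) f"
    and um: "u \<in> borel_measurable lebesgue" and fm: "f \<in> borel_measurable lebesgue"
    and \<eta>: "Ck 1 \<eta>" and b\<eta>: "bounded {z. \<eta> z \<noteq> 0}"
  shows "(LINT z|lebesgue. u z * dbar \<eta> z) = - (LINT z|lebesgue. f z * \<eta> z)"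
proof -
  obtain R where "R > 0" and R: "\<And>z. z \<notin> cball 0 R \<Longrightarrow> \<eta> z = 0"
    using b\<eta> unfolding bounded_support_iff by blast
  have R': "dbar \<eta> z = 0" if "z \<notin> cball 0 R" for z
    using dx_zero_outside[of R \<eta> z] R that by (simp add: dbar_def)
  obtain b where "cball (0::complex) R \<subseteq> cbox (- b) b"
    by (rule bounded_subset_cbox_symmetric[OF bounded_cball[of "0::complex" R]]) (use that in blast)
  then obtain a where ab: "cball (0::complex) R \<subseteq> cbox a b" by (rule that)
  have c: "continuous_on UNIV \<eta>" "continuous_on UNIV (dx \<eta>)" "continuous_on UNIV (dy \<eta>)"
    using \<eta> Ck_imp_continuous[OF \<eta>] by auto
  have cd: "continuous_on UNIV (dbar \<eta>)"
    unfolding dbar_def[abs_def] by (intro continuous_intros c) simp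
  define e where "e n = 1 / real (Suc n)" for n
  have e: "e n > 0" "e n \<le> 1" for n by (auto simp: e_def)
  \<comment> \<open>normalisation of the bumps; \<open>M\<close> is the mollification\<close>
  define k where "k n = inverse (complex_of_real (integral\<^sup>L lborel (bump (e n))))" for n
  define M where "M \<psi> n z = conv a b (bump (e n)) \<psi> z * k n" for \<psi> n z
  have M_close: "norm (M \<psi> n z - y) \<le> \<delta>"
    if "continuous_on UNIV \<psi>" "\<And>w. w \<notin> cball 0 R \<Longrightarrow> \<psi> w = 0" "\<And>w. norm (w - z) < e n \<Longrightarrow> norm (\<psi> w - y) \<le> \<delta>" for \<psi> n z y \<delta>
    using conv_bump_close[OF that(1,2) ab e(1) that(3)] by (simp add: M_def k_def divide_inverse)
  have M_lim: "(\<lambda>n. M \<psi> n z) \<longlonglongrightarrow> \<psi> z" if c: "continuous_on UNIV \<psi>" and s: "\<And>w. w \<notin> cball 0 R \<Longrightarrow> \<psi> w = 0" for \<psi> z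
  proof (rule LIMSEQ_I)
    fix r :: real assume "r > 0"
    have "isCont \<psi> z" using c by (simp add: continuous_on_eq_continuous_at)
    then have "\<exists>d>0. \<forall>w. dist w z < d \<longrightarrow> dist (\<psi> w) (\<psi> z) < r / 2"
      using half_gt_zero[OF \<open>r > 0\<close>] unfolding continuous_at_eps_delta by blast
    then obtain d where d: "d > 0" "\<forall>w. dist w z < d \<longrightarrow> dist (\<psi> w) (\<psi> z) < r / 2"
      by blast
    have d': "norm (\<psi> w - \<psi> z) \<le> r / 2" if "norm (w - z) < d" for w
      using d(2) that by (simp add: dist_norm less_imp_le)
    obtain N where N: "inverse (real (Suc N)) < d" using reals_Archimedean[OF d(1)] by blast
    have "norm (M \<psi> n z - \<psi> z) < r" if "n \<ge> N" for n
    proof -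
      have "e n \<le> inverse (real (Suc N))" using that by (simp add: e_def field_simps)
      then have "norm (M \<psi> n z - \<psi> z) \<le> r / 2"
        using N by (intro M_close[OF c s] d') auto
      then show ?thesis using \<open>r > 0\<close> by simp
    qed
    then show "\<exists>no. \<forall>n\<ge>no. norm (M \<psi> n z - \<psi> z) < r" by blast
  qed
  have M_bound: "\<exists>C. \<forall>n z. norm (M \<psi> n z) \<le> C" if c: "continuous_on UNIV \<psi>" and s: "\<And>w. w \<notin> cball 0 R \<Longrightarrow> \<psi> w = 0" for \<psi>
  proof -
    have "bounded (\<psi> ` cball 0 R)"
      by (intro compact_imp_bounded compact_continuous_image continuous_on_subset[OF c]) auto
    then obtain C where C: "\<forall>x\<in>\<psi> ` cball 0 R. norm x \<le> C" unfolding bounded_iff by blast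
    have "norm (\<psi> w) \<le> max 0 C" for w
      using C s[of w] by (cases "w \<in> cball 0 R") force+
    then have "norm (M \<psi> n z - 0) \<le> max 0 C" for n z by (intro M_close c s) auto
    then show ?thesis by auto
  qed
  have M_supp: "M \<psi> n z = 0" if c: "continuous_on UNIV \<psi>" and s: "\<And>w. w \<notin> cball 0 R \<Longrightarrow> \<psi> w = 0" and z: "z \<notin> cball 0 (R + 1)" for \<psi> n z
  proof -
    have "norm (M \<psi> n z - 0) \<le> 0"
    proof (rule M_close[OF c s])
      fix w assume "norm (w - z) < e n"
      then have "norm z \<le> norm w + 1"
        using norm_triangle_ineq2[of z w] e(2)[of n] by (simp add: norm_minus_commute)
      then have "w \<notin> cball 0 R" using z by simp
      then show "norm (\<psi> w - 0) \<le> 0" using s by simp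
    qed
    then show ?thesis by simp
  qed
  have CkM: "Ck j (M \<eta> n)" for j n
    unfolding M_def[abs_def] by (intro Ck_mult Ck_const Ck_conv(1) bump c)
  have dM: "dbar (M \<eta> n) = M (dbar \<eta>) n" for n
  proof
    fix z
    let ?q = "bump (e n)"
    have d: "conv a b ?q \<eta> differentiable (at z)"
      using Ck_differentiable[OF Ck_conv(1)[OF bump(1) c(1), where k=1]] by simp
    have cv: "conv a b ?q (dbar \<eta>) z = (conv a b ?q (dx \<eta>) z + \<i> * conv a b ?q (dy \<eta>) z) / 2"
    proof -
      have ci: "continuous_on (cbox a b) (\<lambda>w. ?q (z - w) *\<^sub>R \<psi> w)" if "continuous_on UNIV \<psi>" for \<psi> :: "complex \<Rightarrow> complex"
        by (intro continuous_intros continuous_on_compose2[OF continuous_bump] continuous_on_subset[OF that]) auto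
      have "?q (z - w) *\<^sub>R dbar \<eta> w = (?q (z - w) *\<^sub>R dx \<eta> w) * (1/2) + (?q (z - w) *\<^sub>R dy \<eta> w) * (\<i> / 2)" for w
        by (simp add: dbar_def scaleR_conv_of_real algebra_simps)
      then have "conv a b ?q (dbar \<eta>) z = integral (cbox a b) (\<lambda>w. (?q (z - w) *\<^sub>R dx \<eta> w) * (1/2) + (?q (z - w) *\<^sub>R dy \<eta> w) * (\<i> / 2))"
        by (simp add: conv_def)
      also have "\<dots> = conv a b ?q (dx \<eta>) z * (1/2) + conv a b ?q (dy \<eta>) z * (\<i> / 2)"
        unfolding conv_def
        by (simp only: Henstock_Kurzweil_Integration.integral_add[OF
              integrable_on_mult_left[OF integrable_continuous[OF ci[OF c(2)]]]
              integrable_on_mult_left[OF integrable_continuous[OF ci[OF c(3)]]]]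
            Henstock_Kurzweil_Integration.integral_mult_left)
      finally show ?thesis by (simp add: algebra_simps)
    qed
    have cd: "conv a b (dx ?q) \<eta> = conv a b ?q (dx \<eta>)" "conv a b (dy ?q) \<eta> = conv a b ?q (dy \<eta>)"
      by (rule conv_derivative[OF bump(1) bounded_bump[OF e(1)] \<eta> R ab]; assumption)+
    have "dx (M \<eta> n) z = conv a b ?q (dx \<eta>) z * k n" "dy (M \<eta> n) z = conv a b ?q (dy \<eta>) z * k n"
      unfolding M_def[abs_def] dx_mult[OF d differentiable_const] Ck_conv(2,3)[OF bump(1) c(1)]
        cd by simp_all
    then show "dbar (M \<eta> n) z = M (dbar \<eta>) n z"
      unfolding dbar_def[of "M \<eta> n"] M_def[of "dbar \<eta>"] cv by (simp add: algebra_simps)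
  qed
  have test: "test_function (M \<eta> n)" for n
  proof (rule test_functionI[OF CkM])
    show "bounded {z. M \<eta> n z \<noteq> 0}"
      by (rule bounded_subset[OF bounded_cball[of 0 "R + 1"]]) (use M_supp[OF c(1) R] in blast)
  qed
  have lim: "(\<lambda>n. LINT z|lebesgue. g z * M \<psi> n z) \<longlonglongrightarrow> (LINT z|lebesgue. g z * \<psi> z)"
    if g: "\<And>R. set_integrable lebesgue (cball 0 R) g" "g \<in> borel_measurable lebesgue" and c: "continuous_on UNIV \<psi>" and s: "\<And>w. w \<notin> cball 0 R \<Longrightarrow> \<psi> w = 0"
      and mm: "\<And>n. continuous_on UNIV (M \<psi> n)" for g \<psi>
  proof -
    obtain C where C: "\<And>n z. norm (M \<psi> n z) \<le> C" using M_bound[OF c s] by blast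
    have [measurable]: "g \<in> borel_measurable lebesgue" "\<psi> \<in> borel_measurable lebesgue" "M \<psi> n \<in> borel_measurable lebesgue" for n
      using g(2) continuous_borel[OF c] continuous_borel[OF mm] by (auto intro!: measurable_completion)
    show ?thesis
    proof (rule integral_dominated_convergence[where w="\<lambda>z. norm (indicator (cball 0 (R + 1)) z *\<^sub>R g z) * C"])
      show "integrable lebesgue (\<lambda>z. norm (indicat_real (cball 0 (R + 1)) z *\<^sub>R g z) * C)"
        using g(1)[of "R + 1"] unfolding set_integrable_def by (intro integrable_mult_left integrable_norm)
      show "AE z in lebesgue. (\<lambda>n. g z * M \<psi> n z) \<longlonglongrightarrow> g z * \<psi> z"
        by (intro AE_I2 tendsto_intros M_lim c s)
      show "AE z in lebesgue. norm (g z * M \<psi> n z) \<le> norm (indicat_real (cball 0 (R + 1)) z *\<^sub>R g z) * C" for n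
      proof (rule AE_I2)
        fix z :: complex
        show "norm (g z * M \<psi> n z) \<le> norm (indicat_real (cball 0 (R + 1)) z *\<^sub>R g z) * C"
          using M_supp[OF c s, of z n] C[of n z] by (cases "z \<in> cball 0 (R + 1)") (auto simp: norm_mult mult_left_mono)
      qed
    qed measurable
  qed
  have cM: "continuous_on UNIV (M \<eta> n)" "continuous_on UNIV (M (dbar \<eta>) n)" for n
  proof -
    show "continuous_on UNIV (M \<eta> n)" by (rule Ck_imp_continuous[OF CkM])
    have "continuous_on UNIV (dx (M \<eta> n))" "continuous_on UNIV (dy (M \<eta> n))" using CkM[of 1 n] by auto
    then have "continuous_on UNIV (dbar (M \<eta> n))"
      unfolding dbar_def[abs_def] by (intro continuous_intros) auto
    then show "continuous_on UNIV (M (dbar \<eta>) n)"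
      unfolding dM .
  qed
  have "(\<lambda>n. LINT z|lebesgue. u z * dbar (M \<eta> n) z) \<longlonglongrightarrow> (LINT z|lebesgue. u z * dbar \<eta> z)"
    unfolding dM by (rule lim[OF u um cd R' cM(2)])
  moreover have "(\<lambda>n. - (LINT z|lebesgue. f z * M \<eta> n z)) \<longlonglongrightarrow> - (LINT z|lebesgue. f z * \<eta> z)"
    by (intro tendsto_minus lim[OF f fm c(1) R cM(1)])
  moreover have "(LINT z|lebesgue. u z * dbar (M \<eta> n) z) = - (LINT z|lebesgue. f z * M \<eta> n z)" for n
    using wd test[of n] unfolding weak_dbar_def by blast
  ultimately show ?thesis
    using LIMSEQ_unique by force
qed

section \<open>Localised solutions where the mass stays bounded\<close>

lemma Ck_1_of_Re:
  fixes F F' :: "real \<Rightarrow> real"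
  assumes F: "\<And>x. (F has_real_derivative F' x) (at x)" and c: "continuous_on UNIV F'"
  shows "Ck 1 (\<lambda>z. F (Re z))" "dx (\<lambda>z. F (Re z)) z = F' (Re z)" "dy (\<lambda>z. F (Re z)) z = 0"
proof -
  have D: "((\<lambda>z. F (Re z)) has_derivative (\<lambda>h. Re h *\<^sub>R F' (Re z) + Im h *\<^sub>R 0)) (at z)" for z
    using has_derivative_compose[OF bounded_linear.has_derivative[OF bounded_linear_Re has_derivative_ident] F[of "Re z", unfolded has_field_derivative_def]]
    by (simp add: mult.commute)
  have "continuous_on UNIV (\<lambda>z. F' (Re z))"
    by (rule continuous_on_compose2[OF c]) (auto intro!: continuous_intros)
  then have "Ck 0 (\<lambda>z. F' (Re z))" "Ck 0 (\<lambda>z::complex. 0::real)"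
    by simp_all
  from Ck_SucI[OF D this]
  show "Ck 1 (\<lambda>z. F (Re z))" "dx (\<lambda>z. F (Re z)) z = F' (Re z)" "dy (\<lambda>z. F (Re z)) z = 0"
    by simp_all
qed

text \<open>
  An antiderivative on the whole line, which makes the gauge function below defined and differentiable
  everywhere.
\<close>

lemma continuous_antiderivative:
  fixes q :: "real \<Rightarrow> real"
  assumes c: "continuous_on UNIV q"
  obtains F where "\<And>x. (F has_real_derivative q x) (at x)"
proof -
  define F where "F x = (LBINT y=0..x. q y)" for x :: real
  have "(F has_real_derivative q x) (at x)" for x
  proof -
    let ?a = "- \<bar>x\<bar> - 1" and ?b = "\<bar>x\<bar> + 1"
    have "((\<lambda>u. LBINT y=0..u. q y) has_vector_derivative q x) (at x within {?a..?b})"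
      using interval_integral_FTC2[of ?a 0 ?b q x] continuous_on_subset[OF c]
      by (simp add: zero_ereal_def)
    moreover have "at x within {?a..?b} = at x"
      by (rule at_within_interior) (auto simp: interior_atLeastAtMost_real)
    ultimately show ?thesis
      by (simp add: F_def[abs_def] has_real_derivative_iff_has_vector_derivative)
  qed
  then show thesis by (rule that)
qed

text \<open>
  Cauchy-Schwarz on a vertical segment of length at most \<open>1/2\<close>, inside a fixed interval of
  length \<open>1\<close>. The resulting bound depends on \<open>z\<close> only through its real part.
\<close>

lemma vertical_integral_bound:
  assumes h: "continuous_on UNIV h" and z: "\<bar>Im z - y0\<bar> < 1/2"
  shows "ennreal ((vertical_integral y0 h z)\<^sup>2) \<le> (\<integral>\<^sup>+t\<in>{y0-1/2..<y0-1/2+1}. ennreal ((h (Complex (Re z) t))\<^sup>2) \<partial>lborel)"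
proof -
  define k where "k t = h (Complex (Re z) t)" for t
  have ck: "continuous_on UNIV k"
    unfolding k_def[abs_def] by (rule continuous_on_compose2[OF h]) (auto intro!: continuous_intros)
  obtain P where P: "\<And>t. (P has_real_derivative k t) (at t)"
    using continuous_antiderivative[OF ck] by blast
  have "((\<lambda>t. (Im z - y0) * k (y0 + t * (Im z - y0))) has_integral P (y0 + 1 * (Im z - y0)) - P (y0 + 0 * (Im z - y0))) {0..1}"
  proof (rule fundamental_theorem_of_calculus)
    fix t :: real
    have "((\<lambda>t. y0 + t * (Im z - y0)) has_real_derivative Im z - y0) (at t within {0..1})"
      by (auto intro!: derivative_eq_intros)
    from DERIV_chain2[OF P this]
    show "((\<lambda>t. P (y0 + t * (Im z - y0))) has_vector_derivative (Im z - y0) * k (y0 + t * (Im z - y0))) (at t within {0..1})"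
      by (simp add: has_real_derivative_iff_has_vector_derivative mult.commute)
  qed simp
  from integral_unique[OF this] have vi: "vertical_integral y0 h z = P (Im z) - P y0"
    by (simp add: vertical_integral_def k_def)
  define a b where "a = min y0 (Im z)" and "b = max y0 (Im z)"
  have ab: "a \<le> b" "{a..b} \<subseteq> {y0-1/2..<y0-1/2+1}"
    using z by (auto simp: a_def b_def min_def max_def abs_less_iff)
  have n: "norm (P b - P a) = \<bar>vertical_integral y0 h z\<bar>"
    unfolding vi a_def b_def by (auto simp: min_def max_def abs_minus_commute)
  have "ennreal (norm (P b - P a)) \<le> (\<integral>\<^sup>+s\<in>{a..b}. ennreal (norm (k s)) \<partial>lborel)"
    by (rule norm_increment_le_nn_integral[OF ab(1)])
       (use P in \<open>auto simp: has_real_derivative_iff_has_vector_derivative[symmetric] intro: has_field_derivative_at_within continuous_on_subset[OF ck]\<close>)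
  then have "ennreal (\<bar>vertical_integral y0 h z\<bar>\<^sup>2) \<le> ennreal 1 * (\<integral>\<^sup>+s\<in>{y0-1/2..<y0-1/2+1}. ennreal (\<bar>k s\<bar>\<^sup>2) \<partial>lborel)"
    unfolding n by (intro nn_integral_interval_Cauchy_Schwarz[OF _ _ ab(2)])
      (auto intro!: continuous_borel continuous_intros ck)
  then show ?thesis by (simp add: k_def)
qed

context holder_weight
begin

text \<open>
  With radius \<open>1/2\<close> the bump lives in a square of side \<open>1\<close> that still lies in
  the unit disc.
\<close>

definition test_bump :: "complex \<Rightarrow> real" where "test_bump = bump (1/2)"

text \<open>
  The gauge \<open>\<theta>\<close> integrates the potential \<open>(\<phi>\<^sub>y,
  -\<phi>\<^sub>x)\<close> along the horizontal line through \<open>z0\<close> and then vertically. Its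
  vertical derivative is exactly \<open>-\<phi>\<^sub>x\<close>, and its horizontal derivative misses
  \<open>\<phi>\<^sub>y\<close> by the vertical integral of \<open>V\<close>. Hence \<open>\<eta> =
  \<xi> e\<^sup>i\<^sup>\<theta>\<^sup>-\<^sup>\<phi>\<close> has a \<open>dbar\<close>-derivative
  controlled by the bump and that integral.
\<close>

lemma gauged_bump:
  obtains \<eta> where "Ck 1 \<eta>" "\<And>z. \<eta> z \<noteq> 0 \<Longrightarrow> norm (z - z0) < 1/2"
    "\<And>z. norm (weighted \<eta> z) = test_bump (z - z0)"
    "\<And>z. norm (weighted (dbar \<eta>) z) \<le> norm (dx test_bump (z - z0)) + norm (dy test_bump (z - z0))
        + test_bump (z - z0) * \<bar>vertical_integral (Im z0) V z\<bar>"
proof -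
  define y0 where "y0 = Im z0"
  have C: "Ck 1 \<phi>" "Ck 1 (dx \<phi>)" "Ck 1 (dy \<phi>)"
    using \<phi>[unfolded Ck_2] Ck_2_imp_1[OF \<phi>] by auto
  have cdy: "continuous_on UNIV (\<lambda>x. dy \<phi> (Complex x y0))"
    using Ck_imp_continuous[OF C(3)] by (rule continuous_on_compose2) (auto intro!: continuous_intros)
  obtain F where F: "\<And>x. (F has_real_derivative dy \<phi> (Complex x y0)) (at x)"
    using continuous_antiderivative[OF cdy] by blast
  note Fz = Ck_1_of_Re[OF F cdy]
  note W = Ck_vertical_integral[OF C(2), of y0]
  \<comment> \<open>the gauge: \<open>F\<close> integrates \<open>\<phi>\<^sub>y\<close> along the horizontal line, the second term integrates \<open>-\<phi>\<^sub>x\<close> vertically\<close>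
  define \<theta> where "\<theta> z = F (Re z) - vertical_integral y0 (dx \<phi>) z" for z
  have \<theta>1: "Ck 1 \<theta>" unfolding \<theta>_def[abs_def] by (intro Ck_diff Fz W)
  have dif: "f differentiable (at z)" if "Ck 1 f" for f :: "complex \<Rightarrow> 'a::real_normed_vector" and z
    using that by (rule Ck_differentiable) simp
  have dy\<theta>: "dy \<theta> z = - dx \<phi> z" for z
    unfolding \<theta>_def[abs_def] by (simp add: dx_diff[OF dif[OF Fz(1)] dif[OF W(1)]] Fz W)
  have dx\<theta>: "dx \<theta> z = dy \<phi> z - vertical_integral y0 V z" for z
  proof -
    have "dx \<theta> z = dy \<phi> (Complex (Re z) y0) - vertical_integral y0 (dx (dx \<phi>)) z"
      unfolding \<theta>_def[abs_def] by (simp add: dx_diff[OF dif[OF Fz(1)] dif[OF W(1)]] Fz W)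
    moreover have "vertical_integral y0 (dy (dy \<phi>)) z = dy \<phi> z - dy \<phi> (Complex (Re z) y0)"
      by (rule vertical_integral_FTC[OF C(3)])
    moreover have "vertical_integral y0 V z = vertical_integral y0 (dx (dx \<phi>)) z + vertical_integral y0 (dy (dy \<phi>)) z"
    proof -
      have "continuous_on UNIV (dx (dx \<phi>))" "continuous_on UNIV (dy (dy \<phi>))" using C by auto
      note cs = this[THEN continuous_on_compose2, of "{0..1}" "\<lambda>t. Complex (Re z) (y0 + t * (Im z - y0))"]
      have "(\<lambda>t. dx (dx \<phi>) (Complex (Re z) (y0 + t * (Im z - y0)))) integrable_on {0..1}"
        "(\<lambda>t. dy (dy \<phi>) (Complex (Re z) (y0 + t * (Im z - y0)))) integrable_on {0..1}"
        by (auto intro!: integrable_continuous_real cs continuous_intros)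
      then show ?thesis
        unfolding vertical_integral_def laplacian_def by (simp add: Henstock_Kurzweil_Integration.integral_add distrib_left)
    qed
    ultimately show ?thesis by simp
  qed
  define \<xi> where "\<xi> z = test_bump (z - z0)" for z
  have D\<xi>: "(\<xi> has_derivative (\<lambda>h. Re h *\<^sub>R dx test_bump (z - z0) + Im h *\<^sub>R dy test_bump (z - z0))) (at z)" for z
  proof -
    have "((\<lambda>z. z - z0) has_derivative (\<lambda>h. h)) (at z)" by (auto intro!: derivative_eq_intros)
    from has_derivative_compose[OF this Ck_has_derivative[OF bump(1)[of 1 "1/2"] order_refl]]
    show ?thesis by (simp add: \<xi>_def[abs_def] test_bump_def)
  qed
  have ct: "continuous_on UNIV (dx test_bump)" "continuous_on UNIV (dy test_bump)"
    using bump(1)[of 1 "1/2"] by (auto simp: test_bump_def)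
  have "Ck 0 (\<lambda>z. dx test_bump (z - z0))" "Ck 0 (\<lambda>z. dy test_bump (z - z0))"
    unfolding Ck.simps by (rule continuous_on_compose2[OF ct(1)] continuous_on_compose2[OF ct(2)]; auto intro!: continuous_intros)+
  note \<xi> = Ck_SucI[OF D\<xi> this, folded One_nat_def]
  define g where "g z = exp (Complex (- \<phi> z) (\<theta> z))" for z
  have Dg: "(g has_derivative (\<lambda>h. Re h *\<^sub>R (Complex (- dx \<phi> z) (dx \<theta> z) * g z) + Im h *\<^sub>R (Complex (- dy \<phi> z) (dy \<theta> z) * g z))) (at z)" for z
  proof -
    have "((\<lambda>z. Complex (- \<phi> z) (\<theta> z)) has_derivative (\<lambda>h. of_real (- (Re h *\<^sub>R dx \<phi> z + Im h *\<^sub>R dy \<phi> z)) + \<i> * of_real (Re h *\<^sub>R dx \<theta> z + Im h *\<^sub>R dy \<theta> z))) (at z)"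
      unfolding Complex_eq_plus
      by (intro has_derivative_add has_derivative_of_real has_derivative_minus has_derivative_mult_right Ck_has_derivative[OF C(1)] Ck_has_derivative[OF \<theta>1] order_refl)
    from has_derivative_compose[OF this DERIV_exp[of "Complex (- \<phi> z) (\<theta> z)", unfolded has_field_derivative_def]]
    have "(g has_derivative (\<lambda>h. g z * (of_real (- (Re h *\<^sub>R dx \<phi> z + Im h *\<^sub>R dy \<phi> z)) + \<i> * of_real (Re h *\<^sub>R dx \<theta> z + Im h *\<^sub>R dy \<theta> z)))) (at z)"
      by (simp add: g_def[abs_def])
    then show ?thesis
      by (rule has_derivative_eq_rhs) (simp add: fun_eq_iff Complex_eq_plus scaleR_conv_of_real algebra_simps)
  qed
  have cg: "continuous_on UNIV g"
    using Dg by (meson continuous_at_imp_continuous_on has_derivative_continuous)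
  have "Ck 0 (\<lambda>z. Complex (- dx \<phi> z) (dx \<theta> z) * g z)" "Ck 0 (\<lambda>z. Complex (- dy \<phi> z) (dy \<theta> z) * g z)"
    unfolding Ck.simps using C(1) \<theta>1 by (auto intro!: continuous_intros cg)
  note g = Ck_SucI[OF Dg this, folded One_nat_def]
  define \<eta> where "\<eta> z = complex_of_real (\<xi> z) * g z" for z
  have c\<xi>: "Ck 1 (\<lambda>z. complex_of_real (\<xi> z))"
    by (rule Ck_bounded_linear[OF bounded_linear_of_real \<xi>(1)])
  have \<eta>1: "Ck 1 \<eta>" unfolding \<eta>_def[abs_def] by (intro Ck_mult c\<xi> g)
  have d\<eta>: "dx \<eta> z = of_real (\<xi> z) * (Complex (- dx \<phi> z) (dx \<theta> z) * g z) + of_real (dx test_bump (z - z0)) * g z"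
    "dy \<eta> z = of_real (\<xi> z) * (Complex (- dy \<phi> z) (dy \<theta> z) * g z) + of_real (dy test_bump (z - z0)) * g z" for z
    unfolding \<eta>_def[abs_def] dx_mult[OF dif[OF c\<xi>] dif[OF g(1)]] dx_bounded_linear[OF bounded_linear_of_real dif[OF \<xi>(1)]] g(2,3) \<xi>(2,3)
    by simp_all
  have ng: "norm (g z * of_real (exp (\<phi> z))) = 1" for z
    by (simp add: g_def norm_mult norm_exp_eq_Re flip: exp_add)
  have dbar\<eta>: "2 * dbar \<eta> z = (of_real (dx test_bump (z - z0)) + \<i> * of_real (dy test_bump (z - z0)) - \<i> * of_real (\<xi> z * vertical_integral y0 V z)) * g z" for z
  proof -
    have "2 * dbar \<eta> z = dx \<eta> z + \<i> * dy \<eta> z" by (simp add: dbar_def)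
    then show ?thesis unfolding d\<eta> dx\<theta> dy\<theta> by (simp add: Complex_eq_plus algebra_simps)
  qed
  have b: "norm (weighted (dbar \<eta>) z) \<le> norm (dx test_bump (z - z0)) + norm (dy test_bump (z - z0)) + test_bump (z - z0) * \<bar>vertical_integral (Im z0) V z\<bar>" for z
  proof -
    let ?A = "complex_of_real (dx test_bump (z - z0))" and ?B = "\<i> * complex_of_real (dy test_bump (z - z0))" and ?D = "\<i> * complex_of_real (\<xi> z * vertical_integral y0 V z)"
    have "2 * norm (weighted (dbar \<eta>) z) = norm ((2 * dbar \<eta> z) * of_real (exp (\<phi> z)))"
      by (simp add: norm_mult)
    also have "\<dots> = norm (?A + ?B - ?D) * norm (g z * of_real (exp (\<phi> z)))"
      unfolding dbar\<eta> by (simp add: norm_mult)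
    also have "\<dots> \<le> (norm ?A + norm ?B) + norm ?D"
      unfolding ng using norm_triangle_ineq4[of "?A + ?B" ?D] norm_triangle_ineq[of ?A ?B] by simp
    also have "\<dots> = norm (dx test_bump (z - z0)) + norm (dy test_bump (z - z0)) + test_bump (z - z0) * \<bar>vertical_integral (Im z0) V z\<bar>"
      using bump(2)[of "1/2" "z - z0"] by (simp add: norm_mult \<xi>_def y0_def test_bump_def abs_mult)
    finally show ?thesis
      using norm_ge_zero[of "weighted (dbar \<eta>) z"] by linarith
  qed
  show thesis
  proof (rule that[OF \<eta>1 _ _ b])
    show "norm (z - z0) < 1/2" if "\<eta> z \<noteq> 0" for z
      using that bump(4)[of "1/2" "z - z0"] by (auto simp: \<eta>_def \<xi>_def test_bump_def)
    have "norm (weighted \<eta> z) = norm (\<xi> z) * norm (g z * of_real (exp (\<phi> z)))" for z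
      unfolding \<eta>_def by (simp add: norm_mult)
    then show "norm (weighted \<eta> z) = test_bump (z - z0)" for z
      unfolding ng using bump(2)[of "1/2" "z - z0"] by (simp add: \<xi>_def test_bump_def)
  qed
qed

text \<open>
  The vertical integral of \<open>V\<close> is bounded in \<open>L\<^sup>2\<close> of the square by
  \<open>V\<close> itself, and the reverse Holder inequality bounds the latter by the mass of the unit
  ball.
\<close>

lemma bump_energy_bound:
  obtains k0 where "k0 > 0" "\<And>Z. \<exists>K. \<forall>z0. mass z0 1 \<le> Z \<longrightarrow> (\<exists>\<eta>. Ck 1 \<eta> \<and> (\<forall>z. \<eta> z \<noteq> 0 \<longrightarrow> norm (z - z0) < 1/2) \<and>
      (\<integral>z. (norm (weighted \<eta> z))\<^sup>2 \<partial>lborel) = k0 \<and> (\<integral>z. (norm (weighted (dbar \<eta>) z))\<^sup>2 \<partial>lborel) \<le> K)"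
proof -
  define k0 where "k0 = (\<integral>z. (test_bump z)\<^sup>2 \<partial>lborel)"
  have ct: "continuous_on UNIV test_bump" "continuous_on UNIV (dx test_bump)" "continuous_on UNIV (dy test_bump)"
    using bump(1)[of 1 "1/2"] continuous_bump[of "1/2"] by (auto simp: test_bump_def)
  have bt: "bounded {z. test_bump z \<noteq> 0}"
    unfolding test_bump_def by (rule bounded_bump) simp
  have c2: "continuous_on UNIV (\<lambda>z. (test_bump z)\<^sup>2)" by (intro continuous_intros ct)
  have "integrable lborel (\<lambda>z. (test_bump z)\<^sup>2)"
    by (rule integrable_compact_support[OF c2]) (rule bounded_subset[OF bt], auto)
  then have k0: "k0 > 0"
    unfolding k0_def by (rule continuous_nonneg_integral_pos[OF _ c2, of 0]) (auto simp: test_bump_def bump_def flat_exp_def)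
  define G where "G z = (norm (dx test_bump z) + norm (dy test_bump z))\<^sup>2" for z
  have cG: "continuous_on UNIV G" unfolding G_def[abs_def] by (intro continuous_intros ct)
  have bG: "bounded {z. G z \<noteq> 0}"
    by (rule bounded_subset[OF bounded_Un[THEN iffD2, OF conjI[OF bounded_support_dx[OF bt]]]]) (auto simp: G_def)
  have iG: "integrable lborel G" by (rule integrable_compact_support[OF cG bG])
  define KG where "KG = integral\<^sup>L lborel G"
  have KG: "KG \<ge> 0" unfolding KG_def by (rule Bochner_Integration.integral_nonneg) (simp add: G_def)
  obtain C where C: "C \<ge> 1" "\<And>a r. r > 0 \<Longrightarrow> (LINT z:ball a r|lborel. (V z)\<^sup>2) \<le> C\<^sup>2 * (mass a r)\<^sup>2 / (pi * r\<^sup>2)"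
    using reverse_Holder by blast
  have "\<exists>\<eta>. Ck 1 \<eta> \<and> (\<forall>z. \<eta> z \<noteq> 0 \<longrightarrow> norm (z - z0) < 1/2) \<and> (\<integral>z. (norm (weighted \<eta> z))\<^sup>2 \<partial>lborel) = k0 \<and>
      (\<integral>z. (norm (weighted (dbar \<eta>) z))\<^sup>2 \<partial>lborel) \<le> 2 * KG + 2 * (C\<^sup>2 * Z\<^sup>2)"
    if Z: "mass z0 1 \<le> Z" for z0 Z
  proof -
    obtain \<eta> where \<eta>: "Ck 1 \<eta>" "\<And>z. \<eta> z \<noteq> 0 \<Longrightarrow> norm (z - z0) < 1/2"
      "\<And>z. norm (weighted \<eta> z) = test_bump (z - z0)"
      and le: "\<And>z. norm (weighted (dbar \<eta>) z) \<le> norm (dx test_bump (z - z0)) + norm (dy test_bump (z - z0))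
        + test_bump (z - z0) * \<bar>vertical_integral (Im z0) V z\<bar>"
      using gauged_bump[of z0] by blast
    have k: "(\<integral>z. (norm (weighted \<eta> z))\<^sup>2 \<partial>lborel) = k0"
      unfolding \<eta>(3) k0_def by (rule integral_translate) (rule continuous_borel[OF c2])
    let ?Q = "square (Re z0 - 1/2) (Im z0 - 1/2) 1" and ?v = "vertical_integral (Im z0) V"
    have cv: "continuous_on UNIV ?v" by (rule continuous_vertical_integral[OF continuous_V])
    have [measurable]: "?v \<in> borel_measurable borel" "G \<in> borel_measurable borel"
      by (rule continuous_borel[OF cv], rule continuous_borel[OF cG])
    have pt: "ennreal ((norm (weighted (dbar \<eta>) z))\<^sup>2) \<le> 2 * ennreal (G (z - z0))
        + 2 * ((\<integral>\<^sup>+t\<in>{Im z0-1/2..<Im z0-1/2+1}. ennreal ((V (Complex (Re z) t))\<^sup>2) \<partial>lborel) * indicator ?Q z)" for z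
    proof (cases "norm (z - z0) < 1/2")
      case True
      let ?n = "norm (dx test_bump (z - z0)) + norm (dy test_bump (z - z0))"
      have tb: "0 \<le> test_bump (z - z0)" "test_bump (z - z0) \<le> 1" by (simp_all add: test_bump_def bump)
      have "norm (weighted (dbar \<eta>) z) \<le> ?n + 1 * \<bar>?v z\<bar>"
        using le[of z] mult_right_mono[OF tb(2), of "\<bar>?v z\<bar>"] by simp
      then have "(norm (weighted (dbar \<eta>) z))\<^sup>2 \<le> (?n + \<bar>?v z\<bar>)\<^sup>2" by (intro power_mono) auto
      also have "\<dots> \<le> 2 * G (z - z0) + 2 * (?v z)\<^sup>2"
        using sum_squares_bound[of ?n "\<bar>?v z\<bar>"] by (simp add: G_def power2_sum)
      finally have "ennreal ((norm (weighted (dbar \<eta>) z))\<^sup>2) \<le> ennreal (2 * G (z - z0) + 2 * (?v z)\<^sup>2)" by (rule ennreal_leI)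
      also have "\<dots> = 2 * ennreal (G (z - z0)) + 2 * ennreal ((?v z)\<^sup>2)"
        by (subst ennreal_plus) (auto simp: G_def ennreal_mult')
      also have "ennreal ((?v z)\<^sup>2) \<le> (\<integral>\<^sup>+t\<in>{Im z0-1/2..<Im z0-1/2+1}. ennreal ((V (Complex (Re z) t))\<^sup>2) \<partial>lborel)"
        by (rule vertical_integral_bound[OF continuous_V]) (use abs_Im_le_cmod[of "z - z0"] True in simp)
      finally have "ennreal ((norm (weighted (dbar \<eta>) z))\<^sup>2) \<le> 2 * ennreal (G (z - z0)) + 2 * (\<integral>\<^sup>+t\<in>{Im z0-1/2..<Im z0-1/2+1}. ennreal ((V (Complex (Re z) t))\<^sup>2) \<partial>lborel)"
        by (simp add: add_left_mono mult_left_mono)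
      moreover have "z \<in> ?Q"
        using True abs_Re_le_cmod[of "z - z0"] abs_Im_le_cmod[of "z - z0"] by (auto simp: square_def abs_if split: if_splits)
      ultimately show ?thesis by simp
    next
      case False
      then have "test_bump (z - z0) = 0" using bump(4)[of "1/2" "z - z0"] by (simp add: test_bump_def)
      then have "norm (weighted (dbar \<eta>) z) \<le> norm (dx test_bump (z - z0)) + norm (dy test_bump (z - z0))"
        using le[of z] by simp
      then have "(norm (weighted (dbar \<eta>) z))\<^sup>2 \<le> G (z - z0)"
        unfolding G_def by (intro power_mono) auto
      then have "ennreal ((norm (weighted (dbar \<eta>) z))\<^sup>2) \<le> ennreal (G (z - z0))" by (rule ennreal_leI)
      also have "\<dots> \<le> 2 * ennreal (G (z - z0))" by (simp add: mult_2)
      finally show ?thesis by (rule order_trans) simp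
    qed
    define B where "B x = (\<integral>\<^sup>+t\<in>{Im z0-1/2..<Im z0-1/2+1}. ennreal ((V (Complex x t))\<^sup>2) \<partial>lborel)" for x
    have [measurable]: "B \<in> borel_measurable borel" unfolding B_def[abs_def] by measurable
    have "(\<integral>\<^sup>+z. ennreal ((norm (weighted (dbar \<eta>) z))\<^sup>2) \<partial>lborel) \<le> (\<integral>\<^sup>+z. 2 * ennreal (G (z - z0)) + 2 * (B (Re z) * indicator ?Q z) \<partial>lborel)"
      unfolding B_def by (rule nn_integral_mono) (rule pt)
    also have "\<dots> = (\<integral>\<^sup>+z. 2 * ennreal (G (z - z0)) \<partial>lborel) + (\<integral>\<^sup>+z. 2 * (B (Re z) * indicator ?Q z) \<partial>lborel)"
      by (rule nn_integral_add) measurable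
    also have "(\<integral>\<^sup>+z. 2 * ennreal (G (z - z0)) \<partial>lborel) = 2 * (\<integral>\<^sup>+z. ennreal (G (z - z0)) \<partial>lborel)"
      by (rule nn_integral_cmult) measurable
    also have "(\<integral>\<^sup>+z. ennreal (G (z - z0)) \<partial>lborel) = ennreal KG"
    proof -
      have "integrable lborel (\<lambda>z. G (z - z0))"
      proof (rule integrable_compact_support)
        show "continuous_on UNIV (\<lambda>z. G (z - z0))"
          by (rule continuous_on_compose2[OF cG]) (auto intro!: continuous_intros)
        have "{z. G (z - z0) \<noteq> 0} = (\<lambda>w. z0 + w) ` {z. G z \<noteq> 0}"
          by (auto simp: image_iff) (metis add_diff_cancel_left' diff_add_cancel add.commute)
        then show "bounded {z. G (z - z0) \<noteq> 0}" using bounded_translation[OF bG, of z0] by simp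
      qed
      then have "(\<integral>\<^sup>+z. ennreal (G (z - z0)) \<partial>lborel) = ennreal (\<integral>z. G (z - z0) \<partial>lborel)"
        by (rule nn_integral_eq_integral) (simp add: G_def)
      then show ?thesis by (simp add: KG_def integral_translate)
    qed
    also have "(\<integral>\<^sup>+z. 2 * (B (Re z) * indicator ?Q z) \<partial>lborel) = 2 * (\<integral>\<^sup>+z\<in>?Q. B (Re z) \<partial>lborel)"
      by (rule nn_integral_cmult) measurable
    also have "(\<integral>\<^sup>+z\<in>?Q. B (Re z) \<partial>lborel) = (\<integral>\<^sup>+x\<in>{Re z0 - 1/2..<Re z0 - 1/2 + 1}. B x \<partial>lborel)"
      using nn_integral_square_Re(1)[of B 1 "Re z0 - 1/2" "Im z0 - 1/2"] by simp
    also have "\<dots> = (\<integral>\<^sup>+z\<in>?Q. ennreal ((V z)\<^sup>2) \<partial>lborel)"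
      unfolding B_def by (rule nn_integral_square(2)[symmetric]) measurable
    also have "\<dots> \<le> (\<integral>\<^sup>+z\<in>ball z0 1. ennreal ((V z)\<^sup>2) \<partial>lborel)"
    proof (intro nn_integral_mono mult_left_mono)
      fix z
      have "z \<in> ball z0 1" if "z \<in> ?Q"
      proof -
        have "\<bar>Re (z - z0)\<bar> \<le> 1/2" "\<bar>Im (z - z0)\<bar> \<le> 1/2" using that by (auto simp: square_def abs_if split: if_splits)
        then have "(Re (z - z0))\<^sup>2 \<le> (1/2)\<^sup>2" "(Im (z - z0))\<^sup>2 \<le> (1/2)\<^sup>2"
          by (metis abs_ge_zero power2_abs power_mono)+
        then have "(norm (z - z0))\<^sup>2 < 1\<^sup>2" unfolding cmod_power2 by (simp add: power2_eq_square)
        then have "norm (z - z0) < 1" by (rule power2_less_imp_less) simp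
        then show ?thesis by (simp add: dist_norm norm_minus_commute)
      qed
      then show "indicator ?Q z \<le> (indicator (ball z0 1) z :: ennreal)" by (auto simp: indicator_def)
    qed simp
    also have "\<dots> = ennreal (LINT z:ball z0 1|lborel. (V z)\<^sup>2)"
      by (rule nn_integral_set_eq[OF V_sq_set_integrable]) auto
    also have "\<dots> \<le> ennreal (C\<^sup>2 * Z\<^sup>2)"
    proof (rule ennreal_leI)
      have "(LINT z:ball z0 1|lborel. (V z)\<^sup>2) \<le> C\<^sup>2 * (mass z0 1)\<^sup>2 / pi" using C(2)[of 1 z0] by simp
      also have "\<dots> \<le> C\<^sup>2 * (mass z0 1)\<^sup>2 / 1"
        using pi_gt3 by (intro divide_left_mono) auto
      also have "\<dots> \<le> C\<^sup>2 * Z\<^sup>2"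
        using power_mono[OF Z mass_nonneg, of 2] by (simp add: mult_left_mono)
      finally show "(LINT z:ball z0 1|lborel. (V z)\<^sup>2) \<le> C\<^sup>2 * Z\<^sup>2" .
    qed
    finally have fin: "(\<integral>\<^sup>+z. ennreal ((norm (weighted (dbar \<eta>) z))\<^sup>2) \<partial>lborel) \<le> 2 * ennreal KG + 2 * ennreal (C\<^sup>2 * Z\<^sup>2)"
      by (simp add: add_left_mono mult_left_mono)
    also have "\<dots> = ennreal (2 * KG + 2 * (C\<^sup>2 * Z\<^sup>2))"
      using KG by (subst ennreal_plus) (auto simp: ennreal_mult')
    finally have "(\<integral>z. (norm (weighted (dbar \<eta>) z))\<^sup>2 \<partial>lborel) \<le> 2 * KG + 2 * (C\<^sup>2 * Z\<^sup>2)"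
      using KG by (intro integral_real_bounded) auto
    then show ?thesis using \<eta>(1,2) k by blast
  qed
  then show thesis using that[OF k0] by blast
qed

text \<open>
  On a disc \<open>|u|\<close> is at most \<open>1 + |u|\<^sup>2\<close>, and the weight is bounded
  below.
\<close>

lemma L2_locally_integrable:
  assumes u: "u \<in> L2_fun \<phi>"
  shows "set_integrable lebesgue (cball 0 R) u"
proof -
  have um[measurable]: "u \<in> borel_measurable lebesgue" using u by (rule L2_fun_measurable)
  have "compact (\<phi> ` cball 0 R)" by (intro compact_continuous_image continuous_on_subset[OF continuous_\<phi>]) auto
  then have "bounded (\<phi> ` cball 0 R)" by (rule compact_imp_bounded)
  then obtain c where c: "\<forall>x\<in>\<phi> ` cball 0 R. norm x \<le> c" unfolding bounded_iff by blast
  have [measurable]: "cball (0::complex) R \<in> sets lebesgue" by simp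
  have ic: "integrable lebesgue (indicat_real (cball (0::complex) R))"
    using emeasure_bounded_finite[OF bounded_cball[of "0::complex" R]] by (intro integrable_real_indicator) auto
  have i: "integrable lebesgue (\<lambda>z. indicat_real (cball 0 R) z + exp (2 * c) * ((norm (u z))\<^sup>2 * exp (- 2 * \<phi> z)))"
    using u ic by (intro Bochner_Integration.integrable_add integrable_mult_right) (auto simp: L2_fun_def)
  show ?thesis
    unfolding set_integrable_def
  proof (rule Bochner_Integration.integrable_bound[OF i])
    show "AE z in lebesgue. norm (indicat_real (cball 0 R) z *\<^sub>R u z) \<le> norm (indicat_real (cball 0 R) z + exp (2 * c) * ((norm (u z))\<^sup>2 * exp (- 2 * \<phi> z)))"
    proof (rule AE_I2)
      fix z :: complex
      show "norm (indicat_real (cball 0 R) z *\<^sub>R u z) \<le> norm (indicat_real (cball 0 R) z + exp (2 * c) * ((norm (u z))\<^sup>2 * exp (- 2 * \<phi> z)))"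
      proof (cases "z \<in> cball 0 R")
        case True
        then have "\<phi> z \<le> c" using c by force
        then have "1 \<le> exp (2 * c) * exp (- 2 * \<phi> z)" by (simp flip: exp_add)
        then have "(norm (u z))\<^sup>2 * 1 \<le> (norm (u z))\<^sup>2 * (exp (2 * c) * exp (- 2 * \<phi> z))" by (intro mult_left_mono) auto
        moreover have "norm (u z) \<le> 1 + (norm (u z))\<^sup>2"
        proof -
          have "2 * norm (u z) \<le> 1 + (norm (u z))\<^sup>2"
            using zero_le_power2[of "norm (u z) - 1"] by (simp add: power2_diff)
          then show ?thesis using norm_ge_zero[of "u z"] by linarith
        qed
        ultimately show ?thesis using True by (simp add: mult_ac)
      qed simp
    qed
  qed measurable
qed

lemma L2_tail_tendsto_0:
  assumes U: "U \<in> L2_fun \<phi>"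
  shows "(\<lambda>n. L2_norm \<phi> (\<lambda>z. indicator (- ball 0 (real n)) z * U z)) \<longlonglongrightarrow> 0"
proof -
  have [measurable]: "U \<in> borel_measurable lebesgue" using U by (rule L2_fun_measurable)
  note [measurable] = \<phi>_lebesgue
  have [measurable]: "- ball (0::complex) r \<in> sets lebesgue" for r by auto
  have "(\<lambda>n. LINT z|lebesgue. (norm (indicator (- ball 0 (real n)) z * U z))\<^sup>2 * exp (- 2 * \<phi> z)) \<longlonglongrightarrow> (LINT z|(lebesgue :: complex measure). (0::real))"
  proof (rule integral_dominated_convergence[where w="\<lambda>z. (norm (U z))\<^sup>2 * exp (- 2 * \<phi> z)"])
    show "integrable lebesgue (\<lambda>z. (norm (U z))\<^sup>2 * exp (- 2 * \<phi> z))" using U by (simp add: L2_fun_def)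
    show "AE z in lebesgue. (\<lambda>n. (norm (indicator (- ball 0 (real n)) z * U z))\<^sup>2 * exp (- 2 * \<phi> z)) \<longlonglongrightarrow> 0"
    proof (rule AE_I2)
      fix z :: complex
      obtain N where N: "norm z < real N" using reals_Archimedean2 by blast
      have "\<forall>\<^sub>F n in sequentially. 0 = (norm (indicator (- ball 0 (real n)) z * U z))\<^sup>2 * exp (- 2 * \<phi> z)"
        using eventually_ge_at_top[of N] by eventually_elim (use N in auto)
      then show "(\<lambda>n. (norm (indicator (- ball 0 (real n)) z * U z))\<^sup>2 * exp (- 2 * \<phi> z)) \<longlonglongrightarrow> 0"
        by (rule Lim_transform_eventually[OF tendsto_const])
    qed
    show "AE z in lebesgue. norm ((norm (indicator (- ball 0 (real n)) z * U z))\<^sup>2 * exp (- 2 * \<phi> z)) \<le> (norm (U z))\<^sup>2 * exp (- 2 * \<phi> z)" for n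
      by (rule AE_I2) (simp add: indicator_def)
  qed measurable
  from tendsto_real_sqrt[OF this] show ?thesis by (simp add: L2_norm_def)
qed

text \<open>
  If the masses stay bounded along \<open>\<zeta> n\<close>, the data \<open>f n = dual (\<eta>
  n)\<close> are bounded and the solutions \<open>u n\<close> have inner product \<open>-k0\<close> with
  \<open>g n = dual_dbar (\<eta> n)\<close>. A subsequential limit \<open>w\<close> of the \<open>u
  n\<close> would have inner products with \<open>g n\<close> bounded away from \<open>0\<close>,
  although \<open>g n\<close> is bounded and supported outside the disc of radius \<open>n\<close>.
\<close>

lemma necessity:
  assumes comp: "compact_operator_L2 \<phi> (canonical_solution_operator \<phi>)"
  shows "filterlim (\<lambda>z. mass z 1) at_top at_infinity"
proof (rule ccontr)
  interpret L: Metric_space "L2_space \<phi>" "L2_dist \<phi>"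
    by (rule Metric_space_L2[OF \<phi>_lebesgue])
  let ?T = "canonical_solution_operator \<phi>"
  assume "\<not> filterlim (\<lambda>z. mass z 1) at_top at_infinity"
  then obtain Z where Z: "\<not> eventually (\<lambda>z. Z \<le> mass z 1) at_infinity"
    unfolding filterlim_at_top by blast
  then have "\<exists>z. norm z \<ge> b \<and> mass z 1 < Z" for b
    unfolding eventually_at_infinity by (meson not_less)
  then have "\<forall>n. \<exists>z. norm z \<ge> real n + 1 \<and> mass z 1 < Z" by blast
  then obtain \<zeta> where \<zeta>: "\<And>n. norm (\<zeta> n) \<ge> real n + 1" "\<And>n. mass (\<zeta> n) 1 < Z" by metis
  obtain k0 where k0: "k0 > 0" and ex: "\<And>Z. \<exists>K. \<forall>z0. mass z0 1 \<le> Z \<longrightarrow> (\<exists>\<eta>. Ck 1 \<eta> \<and> (\<forall>z. \<eta> z \<noteq> 0 \<longrightarrow> norm (z - z0) < 1/2) \<and>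
      (\<integral>z. (norm (weighted \<eta> z))\<^sup>2 \<partial>lborel) = k0 \<and> (\<integral>z. (norm (weighted (dbar \<eta>) z))\<^sup>2 \<partial>lborel) \<le> K)"
    using bump_energy_bound by blast
  from ex[of Z] obtain K where ex_K: "\<And>z0. mass z0 1 \<le> Z \<Longrightarrow> (\<exists>\<eta>. Ck 1 \<eta> \<and> (\<forall>z. \<eta> z \<noteq> 0 \<longrightarrow> norm (z - z0) < 1/2) \<and>
      (\<integral>z. (norm (weighted \<eta> z))\<^sup>2 \<partial>lborel) = k0 \<and> (\<integral>z. (norm (weighted (dbar \<eta>) z))\<^sup>2 \<partial>lborel) \<le> K)" by blast
  have "\<exists>\<eta>. Ck 1 \<eta> \<and> (\<forall>z. \<eta> z \<noteq> 0 \<longrightarrow> norm (z - \<zeta> n) < 1/2) \<and>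
      (\<integral>z. (norm (weighted \<eta> z))\<^sup>2 \<partial>lborel) = k0 \<and> (\<integral>z. (norm (weighted (dbar \<eta>) z))\<^sup>2 \<partial>lborel) \<le> K" for n
    by (rule ex_K) (rule less_imp_le[OF \<zeta>(2)])
  then have "\<exists>\<eta>. \<forall>n. Ck 1 (\<eta> n) \<and> (\<forall>z. \<eta> n z \<noteq> 0 \<longrightarrow> norm (z - \<zeta> n) < 1/2) \<and>
      (\<integral>z. (norm (weighted (\<eta> n) z))\<^sup>2 \<partial>lborel) = k0 \<and> (\<integral>z. (norm (weighted (dbar (\<eta> n)) z))\<^sup>2 \<partial>lborel) \<le> K"
    by (intro choice allI)
  then obtain \<eta> where \<eta>_all: "\<forall>n. Ck 1 (\<eta> n) \<and> (\<forall>z. \<eta> n z \<noteq> 0 \<longrightarrow> norm (z - \<zeta> n) < 1/2) \<and>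
      (\<integral>z. (norm (weighted (\<eta> n) z))\<^sup>2 \<partial>lborel) = k0 \<and> (\<integral>z. (norm (weighted (dbar (\<eta> n)) z))\<^sup>2 \<partial>lborel) \<le> K"
    by (rule exE)
  have \<eta>: "Ck 1 (\<eta> n)" "\<eta> n z \<noteq> 0 \<Longrightarrow> norm (z - \<zeta> n) < 1/2"
      "(\<integral>z. (norm (weighted (\<eta> n) z))\<^sup>2 \<partial>lborel) = k0" "(\<integral>z. (norm (weighted (dbar (\<eta> n)) z))\<^sup>2 \<partial>lborel) \<le> K" for n z
    using \<eta>_all[THEN spec, of n] by (blast+)
  have b\<eta>: "bounded {z. \<eta> n z \<noteq> 0}" for n
    by (rule bounded_subset[OF bounded_ball[of "\<zeta> n" "1/2"]]) (use \<eta>(2) in \<open>auto simp: dist_norm norm_minus_commute\<close>)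
  have c\<eta>: "continuous_on UNIV (\<eta> n)" "continuous_on UNIV (dbar (\<eta> n))" for n
  proof -
    show "continuous_on UNIV (\<eta> n)" by (rule Ck_imp_continuous[OF \<eta>(1)])
    have "continuous_on UNIV (dx (\<eta> n))" "continuous_on UNIV (dy (\<eta> n))" using \<eta>(1)[of n] by auto
    then show "continuous_on UNIV (dbar (\<eta> n))" unfolding dbar_def[abs_def] by (intro continuous_intros) auto
  qed
  have bd\<eta>: "bounded {z. dbar (\<eta> n) z \<noteq> 0}" for n
    by (rule bounded_subset[OF bounded_Un[THEN iffD2, OF conjI[OF bounded_support_dx[OF b\<eta>[of n]]]]]) (auto simp: dbar_def)
  have far: "dbar (\<eta> n) z = 0" if z: "norm z < real n" for n z
  proof -
    have 0: "0 = \<eta> n w" if "w \<in> ball 0 (real n)" for w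
    proof (rule ccontr)
      assume "0 \<noteq> \<eta> n w"
      then have "norm (w - \<zeta> n) < 1/2" by (intro \<eta>(2)) simp
      then show False using \<zeta>(1)[of n] that norm_triangle_ineq2[of "\<zeta> n" w] by (simp add: norm_minus_commute)
    qed
    have "z \<in> ball 0 (real n)" using z by simp
    from has_derivative_transform_within_open[OF has_derivative_const open_ball this 0]
    have "(\<eta> n has_derivative (\<lambda>h. 0)) (at z)" .
    then have "dx (\<eta> n) z = 0" "dy (\<eta> n) z = 0" by (auto dest: dx_eqI dy_eqI)
    then show ?thesis by (simp add: dbar_def)
  qed
  define f where "f n = dual (\<eta> n)" for n
  define g where "g n = dual_dbar (\<eta> n)" for n
  have f: "f n \<in> L2_fun \<phi>" "(L2_norm \<phi> (f n))\<^sup>2 = k0" "L2_ip \<phi> h (f n) = (LINT z|lebesgue. h z * \<eta> n z)"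
    and g: "g n \<in> L2_fun \<phi>" "(L2_norm \<phi> (g n))\<^sup>2 \<le> K" "L2_ip \<phi> h (g n) = (LINT z|lebesgue. h z * dbar (\<eta> n) z)" for n h
    using compact_support_L2[OF c\<eta>(1) b\<eta>[of n]] compact_support_L2[OF c\<eta>(2) bd\<eta>[of n]] \<eta>(3,4)[of n]
    unfolding f_def g_def dual_def[abs_def] dual_dbar_def[abs_def] by simp_all
  have K0: "K \<ge> 0" using g(2)[of 0] by (meson order_trans zero_le_power2)
  have gK: "L2_norm \<phi> (g n) \<le> sqrt K" for n
    using g(2)[of n] by (simp add: real_le_rsqrt)
  define F where "F n = L2_class \<phi> (f n)" for n
  have F: "F n \<in> L2_space \<phi>" "f n \<in> F n" for n
    unfolding F_def by (rule L2_class_in[OF f(1)], rule L2_class_self[OF f(1)])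
  have bdd: "L.mbounded (range F)"
    unfolding L.mbounded_alt
  proof (intro conjI exI ballI)
    show "range F \<subseteq> L2_space \<phi>" using F by auto
    fix x y assume "x \<in> range F" "y \<in> range F"
    then obtain m n where mn: "x = F m" "y = F n" by blast
    have nf: "L2_norm \<phi> (f n) = sqrt k0" for n
      by (rule real_sqrt_unique[OF f(2) L2_norm_nonneg, symmetric])
    have "L2_dist \<phi> x y = L2_norm \<phi> (\<lambda>z. f m z + - f n z)"
      unfolding mn by (subst L2_dist_eq[OF F F]) simp
    also have "\<dots> \<le> L2_norm \<phi> (f m) + L2_norm \<phi> (\<lambda>z. - f n z)"
      by (rule L2_triangle[OF f(1) L2_fun_uminus[OF f(1)]])
    also have "L2_norm \<phi> (\<lambda>z. - f n z) = L2_norm \<phi> (f n)" by (simp add: L2_norm_def)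
    finally show "L2_dist \<phi> x y \<le> 2 * sqrt k0" by (simp add: nf)
  qed
  have Tin: "?T (F n) \<in> L2_space \<phi>" for n
    using comp F(1)[of n] unfolding compact_operator_L2_def by blast
  define u where "u n = (SOME u. u \<in> ?T (F n))" for n
  have u: "u n \<in> ?T (F n)" "u n \<in> L2_fun \<phi>" for n
    unfolding u_def using L2_space_some_in[OF Tin[of n]] by auto
  have key: "L2_ip \<phi> (u n) (g n) = - of_real k0" for n
  proof -
    obtain f' where f': "f' \<in> F n" "canonical_solution \<phi> f' (u n)"
      using u(1)[of n] unfolding canonical_solution_operator_def by blast
    have f'L: "f' \<in> L2_fun \<phi>" by (rule L2_space_member[OF F(1) f'(1)])
    have ae: "AE z in lebesgue. f' z = f n z" by (rule L2_space_members_AE[OF F(1) f'(1) F(2)])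
    have "weak_dbar (u n) f'" using f'(2) by (simp add: canonical_solution_def)
    then have "weak_dbar (u n) (f n)"
      using weak_dbar_cong_AE[OF L2_fun_measurable[OF f'L] L2_fun_measurable[OF f(1)] ae L2_fun_measurable[OF u(2)[of n]] L2_fun_measurable[OF u(2)[of n]]]
      by simp
    then have "(LINT z|lebesgue. u n z * dbar (\<eta> n) z) = - (LINT z|lebesgue. f n z * \<eta> n z)"
      by (rule weak_dbar_Ck_1[OF _ L2_locally_integrable[OF u(2)] L2_locally_integrable[OF f(1)] L2_fun_measurable[OF u(2)] L2_fun_measurable[OF f(1)] \<eta>(1) b\<eta>])
    then have "L2_ip \<phi> (u n) (g n) = - L2_ip \<phi> (f n) (f n)" by (simp only: f(3) g(3))
    also have "L2_ip \<phi> (f n) (f n) = of_real k0" by (simp only: L2_ip_self f(2))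
    finally show ?thesis .
  qed
  let ?S = "L.mtopology closure_of (?T ` range F)"
  have cpt: "compactin L.mtopology ?S"
    using comp bdd unfolding compact_operator_L2_def by blast
  have "?T ` range F \<subseteq> ?S"
    by (rule closure_of_subset) (use Tin in auto)
  then have "range (\<lambda>n. ?T (F n)) \<subseteq> ?S" by auto
  then obtain U r where r: "strict_mono r" and lim: "limitin L.mtopology ((\<lambda>n. ?T (F n)) \<circ> r) U sequentially"
    using cpt unfolding L.compactin_sequentially by metis
  have UL: "U \<in> L2_space \<phi>" using lim L.limitin_mspace by blast
  define w where "w = (SOME w. w \<in> U)"
  have w: "w \<in> U" "w \<in> L2_fun \<phi>" unfolding w_def using L2_space_some_in[OF UL] by auto
  have "(\<lambda>n. L2_dist \<phi> (?T (F (r n))) U) \<longlonglongrightarrow> 0"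
    using lim unfolding L.limitin_metric_dist_null by (simp add: o_def)
  then have d0: "(\<lambda>n. L2_norm \<phi> (\<lambda>z. u (r n) z - w z)) \<longlonglongrightarrow> 0"
    by (simp add: L2_dist_eq[OF Tin u(1) UL w(1)])
  have t0: "(\<lambda>n. L2_norm \<phi> (\<lambda>z. indicator (- ball 0 (real (r n))) z * w z)) \<longlonglongrightarrow> 0"
    using LIMSEQ_subseq_LIMSEQ[OF L2_tail_tendsto_0[OF w(2)] r] by (simp add: o_def)
  \<comment> \<open>only the part of \<open>w\<close> outside the disc meets the support of \<open>g\<close>\<close>
  have bound: "k0 \<le> (L2_norm \<phi> (\<lambda>z. u (r n) z - w z) + L2_norm \<phi> (\<lambda>z. indicator (- ball 0 (real (r n))) z * w z)) * sqrt K" for n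
  proof -
    let ?I = "\<lambda>z. indicator (- ball 0 (real (r n))) z * w z"
    have I: "?I \<in> L2_fun \<phi>"
    proof -
      have [measurable]: "w \<in> borel_measurable lebesgue" using w(2) by (rule L2_fun_measurable)
      note [measurable] = \<phi>_lebesgue
      have [measurable]: "- ball (0::complex) s \<in> sets lebesgue" for s by auto
      have "integrable lebesgue (\<lambda>z. (norm (?I z))\<^sup>2 * exp (- 2 * \<phi> z))"
      proof (rule Bochner_Integration.integrable_bound[where f="\<lambda>z. (norm (w z))\<^sup>2 * exp (- 2 * \<phi> z)"])
        show "integrable lebesgue (\<lambda>z. (norm (w z))\<^sup>2 * exp (- 2 * \<phi> z))" using w(2) by (simp add: L2_fun_def)
        show "(\<lambda>z. (norm (?I z))\<^sup>2 * exp (- 2 * \<phi> z)) \<in> borel_measurable lebesgue" by measurable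
      qed (simp add: indicator_def)
      moreover have "?I \<in> borel_measurable lebesgue" by measurable
      ultimately show ?thesis by (simp only: L2_fun_def mem_Collect_eq)
    qed
    have "L2_ip \<phi> w (g (r n)) = L2_ip \<phi> ?I (g (r n))"
      unfolding g(3) by (rule Bochner_Integration.integral_cong) (auto simp: indicator_def far)
    then have "L2_ip \<phi> (u (r n)) (g (r n)) = L2_ip \<phi> (\<lambda>z. u (r n) z - w z) (g (r n)) + L2_ip \<phi> ?I (g (r n))"
      using L2_ip_diff_left[OF u(2) w(2) g(1)] by simp
    then have sum: "L2_ip \<phi> (\<lambda>z. u (r n) z - w z) (g (r n)) + L2_ip \<phi> ?I (g (r n)) = - of_real k0"
      using key[of "r n"] by simp
    have "k0 = norm (L2_ip \<phi> (\<lambda>z. u (r n) z - w z) (g (r n)) + L2_ip \<phi> ?I (g (r n)))"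
      unfolding sum using k0 by simp
    also have "\<dots> \<le> norm (L2_ip \<phi> (\<lambda>z. u (r n) z - w z) (g (r n))) + norm (L2_ip \<phi> ?I (g (r n)))"
      by (rule norm_triangle_ineq)
    also have "\<dots> \<le> L2_norm \<phi> (\<lambda>z. u (r n) z - w z) * L2_norm \<phi> (g (r n)) + L2_norm \<phi> ?I * L2_norm \<phi> (g (r n))"
      by (intro add_mono L2_Cauchy_Schwarz L2_diff u w g I)
    also have "\<dots> \<le> L2_norm \<phi> (\<lambda>z. u (r n) z - w z) * sqrt K + L2_norm \<phi> ?I * sqrt K"
      by (intro add_mono mult_left_mono gK L2_norm_nonneg)
    finally show ?thesis by (simp add: distrib_right)
  qed
  have "(\<lambda>n. (L2_norm \<phi> (\<lambda>z. u (r n) z - w z) + L2_norm \<phi> (\<lambda>z. indicator (- ball 0 (real (r n))) z * w z)) * sqrt K) \<longlonglongrightarrow> (0 + 0) * sqrt K"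
    by (intro tendsto_intros d0 t0)
  then have "k0 \<le> (0 + 0) * sqrt K"
    by (rule LIMSEQ_le_const) (use bound in blast)
  then show False using k0 by simp
qed

end

theorem theorem2p3:
  fixes \<phi> :: "complex \<Rightarrow> real"
  assumes "Ck 2 \<phi>"
    and "subharmonic \<phi>"
    and "laplacian \<phi> \<in> reverse_Holder_2"
  shows "compact_operator_L2 \<phi> (canonical_solution_operator \<phi>) \<longleftrightarrow>
    filterlim (\<lambda>z. LINT y:ball z 1|lebesgue. laplacian \<phi> y) at_top at_infinity"
proof -
  interpret holder_weight \<phi>
    by unfold_locales (rule assms)+
  show ?thesis
    using sufficiency necessity unfolding mass_def by blast
qed

end
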